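(* Let $q=2^m$ with $m\ge 1$. There is an algorithm that decodes erasures of Reed-Solomon codes over $\mathbf{F}_{2^m}$ in $O(q\log_2^2 q)$ time using $O(q\log_2 q)$ memory. That is, given $m$, an integer $1\le k\le q$, and the values $P(\mathbf{x})$ at the points $\mathbf{x}$ of a known set of at least $k$ points of $\mathbf{F}_{2^m}$, where $P$ is an unknown polynomial over $\mathbf{F}_{2^m}$ of degree less than $k$, the algorithm computes the full image vector $[P]=(P(\mathbf{x}))_{\mathbf{x}\in\mathbf{F}_{2^m}}$ within these bounds. There is also an algorithm for the same problem that uses only $O(q)$ memory and runs in $O(q\log_2^3 q)$ time. The constants implied by the $O$-notation are absolute (independent of $m$, $k$, $P$ and the set of known points).
   Context: Elements of $\mathbf{F}_{2^m}$ are represented as binary vectors $(x_1,\dots,x_m)$ of length $m$, viewing the field as an $m$-dimensional vector space over $\mathbf{F}_2$. The points of $\mathbf{F}_{2^m}$ are ordered lexicographically by these vectors. For a function $F$ defined on $\mathbf{F}_{2^m}$, $[F]$ denotes the vector of its values at all $q$ points in this order. The codewords of the Reed-Solomon code of dimension $k$ over $\mathbf{F}_{2^m}$ (of full length $q$) are the vectors $[P]$, where $P$ ranges over the polynomials over $\mathbf{F}_{2^m}$ of degree less than $k$. Erasure decoding means recovering the codeword from the knowledge of a subset of its coordinates (positions and values). Cost model: each operation in the field $\mathbf{F}_{2^m}$ costs $O(1)$ time, and storing one field element costs $O(1)$ memory. Likewise, operations on integers of $O(m)$ bits (arithmetic, comparison, indexed memory access, reading a bit) cost $O(1)$ time, and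 storing such an integer costs $O(1)$ memory. *)

theory Defs
  imports Complex_Main "HOL-Algebra.Polynomials" "HOL-Library.List_Lexorder"
begin

section \<open>Binary vectors as words\<close>

text \<open>
  A binary vector \<open>(x\<^sub>1, \<dots>, x\<^sub>m)\<close> is stored as the number below \<open>2 ^ m\<close> whose most
  significant bit is \<open>x\<^sub>1\<close>. By \<open>bij_coords\<close> and \<open>coords_less_iff\<close> below, the words
  \<open>0, 1, \<dots>, 2 ^ m - 1\<close> are then exactly the binary vectors of length \<open>m\<close>, listed in
  lexicographic order.
\<close>

definition coords :: "nat \<Rightarrow> nat \<Rightarrow> bool list" where
  "coords m x = map (\<lambda>i. bit x (m - Suc i)) [0..<m]"

lemma length_coords [simp]: "length (coords m x) = m"
  by (simp add: coords_def)

lemma coords_0 [simp]: "coords 0 x = []"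
  by (simp add: coords_def)

lemma coords_Suc: "coords (Suc m) x = bit x m # coords m (x mod 2 ^ m)"
proof -
  have "map (\<lambda>i. bit x (m - Suc i)) [0..<m] = map (\<lambda>i. bit (x mod 2 ^ m) (m - Suc i)) [0..<m]"
    by (rule map_cong) (simp_all add: bit_take_bit_iff flip: take_bit_eq_mod)
  then show ?thesis
    by (simp add: coords_def upt_conv_Cons map_Suc_upt [symmetric] del: upt_Suc)
qed

lemma coords_less_iff:
  assumes "x < 2 ^ m" and "y < 2 ^ m"
  shows "coords m x < coords m y \<longleftrightarrow> x < y"
  using assms
proof (induction m arbitrary: x y)
  case 0
  then show ?case by simp
next
  case (Suc m)
  have split: "z = of_bool (bit z m) * 2 ^ m + z mod 2 ^ m" if "z < 2 ^ Suc m" for z :: nat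
  proof -
    have "z div 2 ^ m < 2"
      using that by (simp add: less_mult_imp_div_less)
    then have "z div 2 ^ m = of_bool (bit z m)"
      by (auto simp: bit_iff_odd less_2_cases_iff)
    then show ?thesis
      by (metis div_mult_mod_eq)
  qed
  define a b where "a = x mod 2 ^ m" and "b = y mod 2 ^ m"
  have ab: "a < 2 ^ m" "b < 2 ^ m"
    by (simp_all add: a_def b_def)
  have x: "x = of_bool (bit x m) * 2 ^ m + a" and y: "y = of_bool (bit y m) * 2 ^ m + b"
    using split Suc.prems by (simp_all add: a_def b_def)
  have "u < v \<longleftrightarrow> (\<not> c \<and> d) \<or> (c = d \<and> a < b)"
    if "u = of_bool c * 2 ^ m + a" "v = of_bool d * 2 ^ m + b" for u v c d
    using ab by (cases c; cases d) (simp_all add: that)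
  from this [OF x y]
  have "x < y \<longleftrightarrow> (\<not> bit x m \<and> bit y m) \<or> (bit x m = bit y m \<and> a < b)" .
  then show ?case
    using Suc.IH [OF ab] by (auto simp: coords_Suc a_def b_def less_bool_def)
qed

lemma bij_coords: "bij_betw (coords m) {0..<2 ^ m} {v. length v = m}"
proof -
  have inj: "inj_on (coords m) {0..<2 ^ m}"
    by (rule inj_onI) (metis atLeastLessThan_iff coords_less_iff linorder_neqE_nat order_less_irrefl)
  have "finite {v :: bool list. length v = m}" "card {v :: bool list. length v = m} = 2 ^ m"
    using finite_lists_length_eq [of "UNIV :: bool set" m] card_lists_length_eq [of "UNIV :: bool set" m]
    by simp_all
  moreover have "coords m ` {0..<2 ^ m} \<subseteq> {v. length v = m}"
    by auto
  ultimately have "coords m ` {0..<2 ^ m} = {v. length v = m}"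
    using inj by (intro card_subset_eq) (simp_all add: card_image)
  with inj show ?thesis
    by (simp add: bij_betw_def)
qed


section \<open>The field and its Reed-Solomon codewords\<close>

text \<open>
  A field with \<open>2 ^ m\<close> elements given by their coordinate vectors with respect to some basis
  over the prime field. The multiplication, hence the basis, is arbitrary.
\<close>

definition binary_field :: "nat \<Rightarrow> nat ring \<Rightarrow> bool" where
  "binary_field m F \<longleftrightarrow>
     field F \<and> carrier F = {0..<2 ^ m} \<and>
     (\<forall>x\<in>carrier F. \<forall>y\<in>carrier F.
        coords m (x \<oplus>\<^bsub>F\<^esub> y) = map2 (\<noteq>) (coords m x) (coords m y))"

text \<open>
  \<^const>\<open>degree\<close> is \<open>0\<close> for the zero polynomial, so for \<open>1 \<le> k\<close> the zero polynomial is included.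
\<close>

definition polys_below :: "nat ring \<Rightarrow> nat \<Rightarrow> nat list set" where
  "polys_below F k = {p \<in> carrier (univ_poly F (carrier F)). degree p < k}"

definition value_vector :: "nat \<Rightarrow> nat ring \<Rightarrow> nat list \<Rightarrow> nat list" where
  "value_vector m F p = map (ring.eval F p) [0..<2 ^ m]"


section \<open>The machine\<close>

text \<open>
  Programs are texts of a structured random access language with named registers and one
  memory, both holding words. A machine is given by a field \<open>F\<close>, whose operations
  are primitive, a word bound \<open>W\<close> and the number of memory cells (the length of the memory list,
  which never changes). Evaluation is undefined as soon as some value reaches \<open>W\<close>, an address is
  outside the memory, a divisor is zero, or a field operation is applied to a word that does not
  represent a field element. Field subtraction coincides with \<open>FAdd\<close>, since the
  characteristic is 2.
\<close>

datatype binop =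
    IAdd | ISub | IMul | IDiv | IMod
  | ILess | IEq
  | IBit
  | FAdd | FMul | FDiv

datatype expr =
    Const nat
  | Reg string
  | Load expr
  | Op binop expr expr

datatype prog =
    Skip
  | Assign string expr
  | Store expr expr
  | Seq prog prog
  | Cond expr prog prog
  | While expr prog

fun apply_op :: "nat ring \<Rightarrow> binop \<Rightarrow> nat \<Rightarrow> nat \<Rightarrow> nat option" where
  "apply_op F IAdd a b = Some (a + b)"
| "apply_op F ISub a b = Some (a - b)"
| "apply_op F IMul a b = Some (a * b)"
| "apply_op F IDiv a b = (if b = 0 then None else Some (a div b))"
| "apply_op F IMod a b = (if b = 0 then None else Some (a mod b))"
| "apply_op F ILess a b = Some (of_bool (a < b))"
| "apply_op F IEq a b = Some (of_bool (a = b))"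
| "apply_op F IBit a b = Some (of_bool (bit a b))"
| "apply_op F FAdd a b =
     (if a \<in> carrier F \<and> b \<in> carrier F then Some (a \<oplus>\<^bsub>F\<^esub> b) else None)"
| "apply_op F FMul a b =
     (if a \<in> carrier F \<and> b \<in> carrier F then Some (a \<otimes>\<^bsub>F\<^esub> b) else None)"
| "apply_op F FDiv a b =
     (if a \<in> carrier F \<and> b \<in> carrier F \<and> b \<noteq> \<zero>\<^bsub>F\<^esub> then Some (a \<otimes>\<^bsub>F\<^esub> inv\<^bsub>F\<^esub> b) else None)"

type_synonym state = "(string \<Rightarrow> nat) \<times> nat list"

definition fit :: "nat \<Rightarrow> nat \<Rightarrow> nat option" where
  "fit W v = (if v < W then Some v else None)"

fun eval_expr :: "nat ring \<Rightarrow> nat \<Rightarrow> state \<Rightarrow> expr \<Rightarrow> nat option" where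
  "eval_expr F W s (Const v) = fit W v"
| "eval_expr F W s (Reg x) = fit W (fst s x)"
| "eval_expr F W s (Load e) =
     Option.bind (eval_expr F W s e) (\<lambda>a.
       if a < length (snd s) then fit W (snd s ! a) else None)"
| "eval_expr F W s (Op f d e) =
     Option.bind (eval_expr F W s d) (\<lambda>a.
     Option.bind (eval_expr F W s e) (\<lambda>b.
     Option.bind (apply_op F f a b) (fit W)))"

text \<open>Every constant, register access, memory access and operation costs one unit of time.\<close>

fun cost :: "expr \<Rightarrow> nat" where
  "cost (Const v) = 1"
| "cost (Reg x) = 1"
| "cost (Load e) = Suc (cost e)"
| "cost (Op f d e) = Suc (cost d + cost e)"

text \<open>
  \<open>run F W c s t s'\<close>: started in \<open>s\<close>, the program \<open>c\<close> halts regularly in \<open>s'\<close> after time \<open>t\<close>.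
  A stuck or diverging execution has no derivation.
\<close>

inductive run :: "nat ring \<Rightarrow> nat \<Rightarrow> prog \<Rightarrow> state \<Rightarrow> nat \<Rightarrow> state \<Rightarrow> bool"
  for F :: "nat ring" and W :: nat where
  run_Skip: "run F W Skip s 1 s"
| run_Assign: "eval_expr F W (r, mem) e = Some v \<Longrightarrow>
     run F W (Assign x e) (r, mem) (Suc (cost e)) (r(x := v), mem)"
| run_Store: "eval_expr F W (r, mem) d = Some a \<Longrightarrow> a < length mem \<Longrightarrow>
     eval_expr F W (r, mem) e = Some v \<Longrightarrow>
     run F W (Store d e) (r, mem) (Suc (cost d + cost e)) (r, mem[a := v])"
| run_Seq: "run F W c1 s t1 s' \<Longrightarrow> run F W c2 s' t2 s'' \<Longrightarrow>
     run F W (Seq c1 c2) s (t1 + t2) s''"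
| run_Cond_true: "eval_expr F W s e = Some v \<Longrightarrow> v \<noteq> 0 \<Longrightarrow> run F W c1 s t s' \<Longrightarrow>
     run F W (Cond e c1 c2) s (Suc (cost e + t)) s'"
| run_Cond_false: "eval_expr F W s e = Some 0 \<Longrightarrow> run F W c2 s t s' \<Longrightarrow>
     run F W (Cond e c1 c2) s (Suc (cost e + t)) s'"
| run_While_false: "eval_expr F W s e = Some 0 \<Longrightarrow>
     run F W (While e c) s (Suc (cost e)) s"
| run_While_true: "eval_expr F W s e = Some v \<Longrightarrow> v \<noteq> 0 \<Longrightarrow> run F W c s t1 s' \<Longrightarrow>
     run F W (While e c) s' t2 s'' \<Longrightarrow>
     run F W (While e c) s (Suc (cost e + t1 + t2)) s''"

lemma run_deterministic:
  "run F W c s t s' \<Longrightarrow> run F W c s u s'' \<Longrightarrow> t = u \<and> s' = s''"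
proof (induction arbitrary: u s'' rule: run.induct)
  case run_Skip
  from run_Skip.prems show ?case by cases simp
next
  case run_Assign
  from run_Assign.prems show ?case
    by cases (use run_Assign.hyps in simp_all)
next
  case run_Store
  from run_Store.prems show ?case
    by cases (use run_Store.hyps in simp_all)
next
  case run_Seq
  from run_Seq.prems show ?case by cases (use run_Seq.IH in blast)
next
  case run_Cond_true
  from run_Cond_true.prems show ?case
    by cases (metis run_Cond_true.hyps run_Cond_true.IH option.inject)+
next
  case run_Cond_false
  from run_Cond_false.prems show ?case
    by cases (metis run_Cond_false.hyps run_Cond_false.IH option.inject)+
next
  case run_While_false
  from run_While_false.prems show ?case
    by cases (use run_While_false.hyps in simp_all)
next
  case run_While_true
  from run_While_true.prems show ?case
    by cases (metis run_While_true.hyps run_While_true.IH option.inject)+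
qed


section \<open>Erasure decoding\<close>

text \<open>
  The registers hold \<open>m\<close>, \<open>k\<close> and the number of known points; the memory holds the
  known points (in any order), followed by the values at these points, followed by zeros. At
  the end the first \<open>2 ^ m\<close> cells must hold the codeword. All \<open>N\<close> cells count as used memory,
  including those of the input and of the output.
\<close>

definition initial_state :: "nat \<Rightarrow> nat \<Rightarrow> nat \<Rightarrow> nat list \<Rightarrow> nat list \<Rightarrow> state" where
  "initial_state N m k xs ys =
     ((\<lambda>_. 0)(''m'' := m, ''k'' := k, ''n'' := length xs),
      xs @ ys @ replicate (N - (length xs + length ys)) 0)"

text \<open>
  One program \<open>c\<close> serves all fields, since \<open>c\<close> and the factor \<open>w\<close> in the word length \<open>w * m\<close>
  (in bits) are fixed before \<open>m\<close>. The functions \<open>T\<close> and \<open>M\<close> bound time and memory in terms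
  of the field size \<open>q = 2 ^ m\<close>.
\<close>

definition decodes_erasures :: "prog \<Rightarrow> nat \<Rightarrow> (real \<Rightarrow> real) \<Rightarrow> (real \<Rightarrow> real) \<Rightarrow> bool" where
  "decodes_erasures c w T M \<longleftrightarrow>
     (\<forall>m k F p xs.
        m \<ge> 1 \<and> 1 \<le> k \<and> k \<le> 2 ^ m \<and> binary_field m F \<and> p \<in> polys_below F k \<and>
        distinct xs \<and> set xs \<subseteq> carrier F \<and> k \<le> length xs \<longrightarrow>
        (\<exists>N t r mem.
           2 * length xs \<le> N \<and>
           run F (2 ^ (w * m)) c (initial_state N m k xs (map (ring.eval F p) xs)) t (r, mem) \<and>
           take (2 ^ m) mem = value_vector m F p \<and>
           real t \<le> T (2 ^ m) \<and> real N \<le> M (2 ^ m)))"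

end

theory Submission
  imports "HOL-Algebra.Multiplicative_Group" Defs
begin

text \<open>
  Let \<open>q = 2 ^ m\<close>, let \<open>E\<close> be the set of erased points and \<open>L x = (\<Prod>z\<in>E - {x}. x + z)\<close>. Since the sum
  over the whole field of a polynomial of degree at most \<open>q - 2\<close> vanishes, applying this to
  \<open>P x * (\<Prod>z\<in>E - {e}. x + z)\<close> gives \<open>P e * L e = (\<Sum>y\<notin>E. P y * L y / (e + y))\<close> for \<open>e \<in> E\<close>. As addition
  of field elements is the exclusive or of words, this sum is an exclusive-or convolution, and so is,
  in the multiplicative group, the product \<open>L\<close>.

  The product is computed by Walsh-Hadamard transforms with butterflies \<open>(a * b, a / b)\<close>; the factor
  \<open>2 ^ m\<close> which they produce acts as an exponent and is harmless because \<open>x ^ q = x\<close>.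

  In characteristic 2 the convolution algebra, whose generators satisfy \<open>t\<^sup>2 = 1\<close>, has no such
  transform. It is deformed to \<open>(t + 1) * (t + 1 + c) = 0\<close>, which for \<open>c \<noteq> 0\<close> is split and diagonalised by
  butterflies. The deformed convolution is a polynomial in \<open>c\<close> of degree at most \<open>m\<close>, so its values
  over an additive subgroup with at least \<open>m + 2\<close> elements add up to 0, and the value at \<open>c = 0\<close> is the
  sum of those at the other elements. This takes \<open>O(m)\<close> transforms of cost \<open>O(q * m)\<close> in place, so that a
  single program with time \<open>O(q * m\<^sup>2)\<close> and memory \<open>O(q)\<close> meets both bounds.
\<close>

section \<open>Butterfly transforms\<close>

text \<open>One vanishing theorem, \<open>finsum_subgroup_poly_fun\<close>, is used twice: over the
  whole field for the erasure identity, and over the first \<open>2 ^ s\<close> words for the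
  deformation parameters. Those words form an additive subgroup whatever basis represents the field,
  because addition is \<open>xor\<close>. The theorem rests on divided differences: a power-sum
  argument with a generator of the multiplicative group would cover the field, but not such
  subgroups.

  The parameter \<open>c = 0\<close> is the one that is wanted and the one that cannot be evaluated:
  there the two roots coincide and evaluation at them has no inverse. Each of the \<open>m\<close>
  variables raises the degree in \<open>c\<close> by at most one, and degree \<open>d\<close> is
  annihilated by \<open>d + 2\<close> nodes; this is the origin of \<open>m + 2\<close>. The least
  power of two that reaches \<open>m + 2\<close> is at most \<open>2 * m + 2\<close>, hence
  \<open>O(m)\<close> rounds.

  Neither a primitive element nor a table of logarithms is computed. The butterflies for the product
  multiply and divide field elements, only the exponents are integers modulo
  \<open>2 ^ m - 1\<close>, and logarithms occur in the proof alone.\<close>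

definition level :: "('a \<Rightarrow> 'a \<Rightarrow> 'a) \<Rightarrow> ('a \<Rightarrow> 'a \<Rightarrow> 'a) \<Rightarrow> nat \<Rightarrow> (nat \<Rightarrow> 'a) \<Rightarrow> nat \<Rightarrow> 'a" where
  "level f1 f2 l f x = (if bit x l then f2 (f (x - 2 ^ l)) (f x) else f1 (f x) (f (x + 2 ^ l)))"

primrec bfly :: "('a \<Rightarrow> 'a \<Rightarrow> 'a) \<Rightarrow> ('a \<Rightarrow> 'a \<Rightarrow> 'a) \<Rightarrow> nat \<Rightarrow> (nat \<Rightarrow> 'a) \<Rightarrow> nat \<Rightarrow> 'a" where
  "bfly f1 f2 0 f = f"
| "bfly f1 f2 (Suc l) f = level f1 f2 l (bfly f1 f2 l f)"

definition upper :: "nat \<Rightarrow> (nat \<Rightarrow> 'a) \<Rightarrow> nat \<Rightarrow> 'a" where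
  "upper l f x = f (x + 2 ^ l)"

lemma bit_add_mult_power:
  fixes x k :: nat
  assumes "i < l"
  shows "bit (x + 2 ^ l * k) i \<longleftrightarrow> bit x i"
proof -
  obtain d where l: "l = i + Suc d"
    using assms less_imp_Suc_add by auto
  have "(x + 2 * (2 ^ i * (2 ^ d * k))) div 2 ^ i = x div 2 ^ i + 2 * 2 ^ d * k"
    using div_mult_self2 [of "2 ^ i" x "2 * 2 ^ d * k"] by (simp add: ac_simps)
  then show ?thesis
    by (simp add: l bit_iff_odd power_add mult.assoc mult.left_commute [of 2])
qed

lemma bit_add_power_self:
  fixes x :: nat
  assumes "x < 2 ^ l"
  shows "bit (x + 2 ^ l) l" and "\<not> bit x l"
  using assms by (simp_all add: bit_iff_odd)

lemma power_le_of_bit: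
  fixes x :: nat
  assumes "bit x l"
  shows "2 ^ l \<le> x"
  using assms bit_add_power_self(2) not_less by blast

text \<open>Levels below \<open>n\<close> inspect and change only the low \<open>n\<close> bits of
  an index, so they act separately on aligned blocks of length \<open>2 ^ n\<close>.\<close>

lemma bfly_shift:
  "l \<le> n \<Longrightarrow> bfly f1 f2 l (\<lambda>y. f (y + 2 ^ n * k)) x = bfly f1 f2 l f (x + 2 ^ n * k)"
proof (induction l arbitrary: x)
  case (Suc l)
  then have "bit (x + 2 ^ n * k) l \<longleftrightarrow> bit x l"
    by (intro bit_add_mult_power) simp
  moreover have "x + 2 ^ n * k - 2 ^ l = x - 2 ^ l + 2 ^ n * k" if "bit x l"
    using power_le_of_bit [OF that] by simp
  ultimately show ?case
    using Suc by (simp add: level_def algebra_simps)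
qed simp

lemma bfly_upper: "bfly f1 f2 l (upper l f) x = bfly f1 f2 l f (x + 2 ^ l)"
  using bfly_shift [of l l f1 f2 f 1] by (simp add: upper_def [abs_def])

text \<open>The radix-2 recursion: the top level is applied last, so a transform of length
  \<open>2 ^ Suc l\<close> is one butterfly on the transforms of the two halves. Most inductions
  over transforms use this rule and the next one instead of the definition.\<close>

lemma bfly_Suc_low:
  "x < 2 ^ l \<Longrightarrow> bfly f1 f2 (Suc l) f x = f1 (bfly f1 f2 l f x) (bfly f1 f2 l (upper l f) x)"
  by (simp add: level_def bit_add_power_self bfly_upper)

lemma bfly_Suc_high:
  "x < 2 ^ l \<Longrightarrow> bfly f1 f2 (Suc l) f (x + 2 ^ l) = f2 (bfly f1 f2 l f x) (bfly f1 f2 l (upper l f) x)"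
  by (simp add: level_def bit_add_power_self bfly_upper)

lemma less_power_Suc_cases:
  fixes x :: nat
  assumes "x < 2 ^ Suc l"
  obtains (low) "x < 2 ^ l" | (high) y where "y < 2 ^ l" "x = y + 2 ^ l"
  using assms that by (cases "x < 2 ^ l") (auto intro: that(2) [of "x - 2 ^ l"])

lemma bfly_cong:
  "(\<And>y. y < 2 ^ l \<Longrightarrow> f y = g y) \<Longrightarrow> x < 2 ^ l \<Longrightarrow> bfly f1 f2 l f x = bfly f1 f2 l g x"
proof (induction l arbitrary: x f g)
  case (Suc l)
  have f: "bfly f1 f2 l f y = bfly f1 f2 l g y" if "y < 2 ^ l" for y
    using that Suc.prems by (intro Suc.IH) auto
  have u: "bfly f1 f2 l (upper l f) y = bfly f1 f2 l (upper l g) y" if "y < 2 ^ l" for y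
    using that Suc.prems by (intro Suc.IH) (auto simp: upper_def)
  from Suc.prems(2) show ?case
    by (cases rule: less_power_Suc_cases)
      (simp_all add: bfly_Suc_low bfly_Suc_high f u del: bfly.simps)
qed simp

lemma bfly_closed:
  assumes "\<And>a b. a \<in> V \<Longrightarrow> b \<in> V \<Longrightarrow> f1 a b \<in> V \<and> f2 a b \<in> V"
    and "\<And>y. y < 2 ^ l \<Longrightarrow> f y \<in> V" and "x < 2 ^ l"
  shows "bfly f1 f2 l f x \<in> V"
  using assms(2-)
proof (induction l arbitrary: x f)
  case (Suc l)
  have f: "bfly f1 f2 l f y \<in> V" "bfly f1 f2 l (upper l f) y \<in> V" if "y < 2 ^ l" for y
    using that Suc.prems by (auto intro!: Suc.IH simp: upper_def)
  from Suc.prems(2) show ?case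
    by (cases rule: less_power_Suc_cases)
      (simp_all add: bfly_Suc_low bfly_Suc_high f assms(1) del: bfly.simps)
qed simp

text \<open>A transform commutes with any operation that commutes with a single butterfly. Sums and
  linear combinations as \<open>\<phi>\<close> give linearity; the unary case
  \<open>bfly_map\<close> carries integers to residues and to powers of a generator.\<close>

lemma bfly_map2:
  assumes V: "\<And>a b. a \<in> V \<Longrightarrow> b \<in> V \<Longrightarrow> f1 a b \<in> V \<and> f2 a b \<in> V"
    and \<phi>: "\<And>a b c d. a \<in> V \<Longrightarrow> b \<in> V \<Longrightarrow> c \<in> V \<Longrightarrow> d \<in> V \<Longrightarrow>
      \<phi> (f1 a b) (f1 c d) = g1 (\<phi> a c) (\<phi> b d) \<and> \<phi> (f2 a b) (f2 c d) = g2 (\<phi> a c) (\<phi> b d)"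
    and "\<And>y. y < 2 ^ l \<Longrightarrow> f y \<in> V \<and> g y \<in> V" and "x < 2 ^ l"
  shows "bfly g1 g2 l (\<lambda>y. \<phi> (f y) (g y)) x = \<phi> (bfly f1 f2 l f x) (bfly f1 f2 l g x)"
  using assms(3-)
proof (induction l arbitrary: x f g)
  case (Suc l)
  have u: "upper l (\<lambda>y. \<phi> (f y) (g y)) = (\<lambda>y. \<phi> (upper l f y) (upper l g y))"
    by (simp add: fun_eq_iff upper_def)
  have *: "bfly f1 f2 l f y \<in> V" "bfly f1 f2 l (upper l f) y \<in> V"
      "bfly f1 f2 l g y \<in> V" "bfly f1 f2 l (upper l g) y \<in> V"
      "bfly g1 g2 l (\<lambda>y. \<phi> (f y) (g y)) y = \<phi> (bfly f1 f2 l f y) (bfly f1 f2 l g y)"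
      "bfly g1 g2 l (\<lambda>y. \<phi> (upper l f y) (upper l g y)) y =
        \<phi> (bfly f1 f2 l (upper l f) y) (bfly f1 f2 l (upper l g) y)" if "y < 2 ^ l" for y
    using that Suc.prems by (auto intro!: bfly_closed V Suc.IH simp: upper_def [abs_def])
  from Suc.prems(2) show ?case
    by (cases rule: less_power_Suc_cases)
      (simp_all add: bfly_Suc_low bfly_Suc_high u * \<phi> del: bfly.simps)
qed simp

lemma bfly_map:
  assumes "\<And>a b. a \<in> V \<Longrightarrow> b \<in> V \<Longrightarrow> f1 a b \<in> V \<and> f2 a b \<in> V"
    and "\<And>a b. a \<in> V \<Longrightarrow> b \<in> V \<Longrightarrow> \<phi> (f1 a b) = g1 (\<phi> a) (\<phi> b) \<and> \<phi> (f2 a b) = g2 (\<phi> a) (\<phi> b)"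
    and "\<And>y. y < 2 ^ l \<Longrightarrow> f y \<in> V" and "x < 2 ^ l"
  shows "bfly g1 g2 l (\<lambda>y. \<phi> (f y)) x = \<phi> (bfly f1 f2 l f x)"
  using bfly_map2 [of V f1 f2 "\<lambda>a b. \<phi> a" g1 g2 l f f x] assms by simp

section \<open>Exclusive or of words and the integer convolution theorem\<close>

lemma xor_add_power:
  fixes x y :: nat
  assumes "x < 2 ^ l" "y < 2 ^ l"
  shows "xor x (y + 2 ^ l) = xor x y + 2 ^ l" and "xor (x + 2 ^ l) y = xor x y + 2 ^ l"
    and "xor (x + 2 ^ l) (y + 2 ^ l) = xor x y" and "xor x y < 2 ^ l"
proof -
  have t: "take_bit l x = x" "take_bit l y = y"
    using assms by (simp_all add: take_bit_nat_eq_self_iff)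
  then have tx: "take_bit l (xor x y) = xor x y"
    by simp
  then show xor: "xor x y < 2 ^ l"
    by (metis take_bit_nat_less_exp)
  \<comment> \<open>Bit \<open>l\<close> of \<open>z\<close> is clear, so this addition has no
    carry.\<close>
  have s: "z + 2 ^ l = xor z (2 ^ l)" if "z < 2 ^ l" for z :: nat
  proof -
    have "and z (2 ^ l) = 0"
      using that by (simp add: and_exp_eq_0_iff_not_bit bit_add_power_self)
    then show ?thesis
      by (simp add: disjunctive_add_eq_xor)
  qed
  show "xor x (y + 2 ^ l) = xor x y + 2 ^ l" "xor (x + 2 ^ l) y = xor x y + 2 ^ l"
    "xor (x + 2 ^ l) (y + 2 ^ l) = xor x y"
    using assms xor by (simp_all add: s ac_simps)
qed

lemma sum_lessThan_double:
  fixes h :: "nat \<Rightarrow> 'a::comm_monoid_add"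
  shows "sum h {..<2 ^ Suc l} = (\<Sum>y<2 ^ l. h y) + (\<Sum>y<2 ^ l. h (y + 2 ^ l))"
proof -
  have "sum h {0..<2 ^ l + 2 ^ l} = (\<Sum>y\<in>{0..<2 ^ l}. h y) + (\<Sum>y\<in>{0..<2 ^ l}. h (y + 2 ^ l))"
    using sum.atLeastLessThan_concat [of 0 "2 ^ l" "2 ^ l + 2 ^ l" h]
      sum.shift_bounds_nat_ivl [of h 0 "2 ^ l" "2 ^ l"] by simp
  then show ?thesis
    by (simp add: lessThan_atLeast0 mult_2)
qed

abbreviation wht :: "nat \<Rightarrow> (nat \<Rightarrow> int) \<Rightarrow> nat \<Rightarrow> int" where
  "wht \<equiv> bfly (+) (-)"

text \<open>Split by the top bit, the product of the transforms is the sum (low half) or the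
  difference (high half) of the equal-bit products \<open>F0 * G0 + F1 * G1\<close> and the mixed
  products \<open>F0 * G1 + F1 * G0\<close>. The last butterfly turns this pair into twice the first
  and twice the second, which are the two halves of the convolution. The doublings multiply up to
  \<open>2 ^ l\<close>.\<close>

lemma wht_convolution:
  "x < 2 ^ l \<Longrightarrow> wht l (\<lambda>u. wht l f u * wht l g u) x = 2 ^ l * (\<Sum>y<2 ^ l. f (xor x y) * g y)"
proof (induction l arbitrary: x f g)
  case 0
  then show ?case by simp
next
  case (Suc l)
  define F0 F1 G0 G1 where "F0 = wht l f" "F1 = wht l (upper l f)" "G0 = wht l g" "G1 = wht l (upper l g)"
  note d = this
  define h where "h u = wht (Suc l) f u * wht (Suc l) g u" for u
  have h0: "h u = (F0 u * G0 u + F1 u * G1 u) + (F0 u * G1 u + F1 u * G0 u)" if "u < 2 ^ l" for u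
    using that by (simp add: h_def bfly_Suc_low d algebra_simps del: bfly.simps)
  have h1: "upper l h u = (F0 u * G0 u + F1 u * G1 u) - (F0 u * G1 u + F1 u * G0 u)" if "u < 2 ^ l" for u
    using that by (simp add: upper_def h_def bfly_Suc_high d algebra_simps del: bfly.simps)
  have add: "wht l (\<lambda>u. a u + b u) v = wht l a v + wht l b v" if "v < 2 ^ l" for a b v
    using that by (intro bfly_map2 [of UNIV]) auto
  have diff: "wht l (\<lambda>u. a u - b u) v = wht l a v - wht l b v" if "v < 2 ^ l" for a b v
    using that by (intro bfly_map2 [of UNIV]) auto
  note IH = Suc.IH [unfolded d [symmetric]]
  have s: "wht l (\<lambda>u. F0 u * G0 u) v = 2 ^ l * (\<Sum>y<2 ^ l. f (xor v y) * g y)"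
     "wht l (\<lambda>u. F1 u * G1 u) v = 2 ^ l * (\<Sum>y<2 ^ l. upper l f (xor v y) * upper l g y)"
     "wht l (\<lambda>u. F0 u * G1 u) v = 2 ^ l * (\<Sum>y<2 ^ l. f (xor v y) * upper l g y)"
     "wht l (\<lambda>u. F1 u * G0 u) v = 2 ^ l * (\<Sum>y<2 ^ l. upper l f (xor v y) * g y)"
    if "v < 2 ^ l" for v
    using that unfolding d by (simp_all add: Suc.IH)
  have H: "wht l h v = wht l (\<lambda>u. (F0 u * G0 u + F1 u * G1 u) + (F0 u * G1 u + F1 u * G0 u)) v"
     "wht l (upper l h) v = wht l (\<lambda>u. (F0 u * G0 u + F1 u * G1 u) - (F0 u * G1 u + F1 u * G0 u)) v"
    if "v < 2 ^ l" for v
    using that by (auto intro!: bfly_cong simp: h0 h1)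
  from Suc.prems show ?case unfolding h_def [symmetric]
  proof (cases rule: less_power_Suc_cases)
    case low
    then show "wht (Suc l) h x = 2 ^ Suc l * (\<Sum>y<2 ^ Suc l. f (xor x y) * g y)"
      unfolding sum_lessThan_double
      by (simp add: bfly_Suc_low H add diff s upper_def xor_add_power algebra_simps del: bfly.simps)
  next
    case (high v)
    then show "wht (Suc l) h x = 2 ^ Suc l * (\<Sum>y<2 ^ Suc l. f (xor x y) * g y)"
      unfolding sum_lessThan_double
      by (simp add: bfly_Suc_high H add diff s upper_def xor_add_power algebra_simps del: bfly.simps)
  qed
qed

section \<open>The field of binary words\<close>

locale word_field = field F for m :: nat and F :: "nat ring" (structure) +
  assumes binary_field: "binary_field m F"
begin

lemma carrier_eq: "carrier F = {0..<2 ^ m}"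
  using binary_field by (simp add: binary_field_def)

lemma finite_carrier [simp]: "finite (carrier F)"
  by (simp add: carrier_eq)

lemma add_eq_xor:
  assumes "x \<in> carrier F" "y \<in> carrier F"
  shows "x \<oplus> y = xor x y"
proof -
  have lt: "x < 2 ^ m" "y < 2 ^ m" "x \<oplus> y < 2 ^ m" "xor x y < 2 ^ m"
    using assms a_closed [OF assms] xor_add_power(4) [of x m y] by (auto simp: carrier_eq)
  have "coords m (x \<oplus> y) = map2 (\<noteq>) (coords m x) (coords m y)"
    using assms binary_field unfolding binary_field_def by blast
  also have "\<dots> = coords m (xor x y)"
    by (rule nth_equalityI) (auto simp: coords_def bit_xor_iff)
  finally show ?thesis
    using coords_less_iff lt by (metis linorder_neqE_nat order_less_irrefl)
qed

lemma zero_eq_0: "\<zero> = 0"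
  using add_eq_xor [of \<zero> \<zero>] by simp

text \<open>Only the zero of the field is a known word. Under an arbitrary basis the one can be any
  nonzero word, so the program has to compute it, as the quotient of the word 1 by itself.\<close>

lemma one_bounds: "\<one> < 2 ^ m" "\<one> \<noteq> 0"
  using one_closed one_not_zero by (auto simp: carrier_eq zero_eq_0)

section \<open>Arithmetic in characteristic 2\<close>

lemma add_self [simp]: "x \<in> carrier F \<Longrightarrow> x \<oplus> x = \<zero>"
  by (simp add: add_eq_xor zero_eq_0)

lemma add_add_self [simp]: "x \<in> carrier F \<Longrightarrow> y \<in> carrier F \<Longrightarrow> x \<oplus> (x \<oplus> y) = y"
  by (metis a_assoc add_self l_zero)

lemma add_eq_zero_iff: "x \<in> carrier F \<Longrightarrow> y \<in> carrier F \<Longrightarrow> x \<oplus> y = \<zero> \<longleftrightarrow> x = y"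
  by (metis add_add_self add_self r_zero)

lemma inv_closed' [simp]: "x \<in> carrier F \<Longrightarrow> x \<noteq> \<zero> \<Longrightarrow> inv x \<in> carrier F"
  using field_Units by auto

lemma r_inv' [simp]: "x \<in> carrier F \<Longrightarrow> x \<noteq> \<zero> \<Longrightarrow> x \<otimes> inv x = \<one>"
  using field_Units by (simp add: Units_r_inv)

lemma mult_mult_inv:
  assumes "x \<in> carrier F" "g \<in> carrier F" "a \<in> carrier F" "a \<noteq> \<zero>"
  shows "(x \<otimes> (a \<otimes> g)) \<otimes> inv a = x \<otimes> g"
proof -
  have "(x \<otimes> (a \<otimes> g)) \<otimes> inv a = (x \<otimes> g) \<otimes> (a \<otimes> inv a)"
    using assms by (simp add: m_ac del: r_inv')
  then show ?thesis
    using assms by simp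
qed

lemma inv_mult_distrib:
  assumes "x \<in> carrier F" "x \<noteq> \<zero>" "y \<in> carrier F" "y \<noteq> \<zero>"
  shows "inv (x \<otimes> y) = inv x \<otimes> inv y"
proof (rule comm_inv_char)
  have "(x \<otimes> y) \<otimes> (inv x \<otimes> inv y) = (x \<otimes> inv x) \<otimes> (y \<otimes> inv y)"
    using assms by (simp add: m_ac del: r_inv')
  then show "(x \<otimes> y) \<otimes> (inv x \<otimes> inv y) = \<one>"
    using assms by simp
qed (use assms in simp_all)

lemma finprod_nonzero:
  "finite A \<Longrightarrow> (\<And>x. x \<in> A \<Longrightarrow> f x \<in> carrier F \<and> f x \<noteq> \<zero>) \<Longrightarrow> finprod F f A \<noteq> \<zero>"
  by (induction A rule: finite_induct) (simp_all add: Pi_def integral_iff)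

subsection \<open>Polynomial functions and divided differences\<close>

text \<open>The index bounds the degree from above, so sums need no discussion of cancellation.
  Functions are preferred to coefficient lists because the deformed convolution, as a function of
  \<open>c\<close>, is given by a recursion.\<close>

inductive poly_fun :: "nat \<Rightarrow> (nat \<Rightarrow> nat) \<Rightarrow> bool" where
  poly_fun_const: "a \<in> carrier F \<Longrightarrow> poly_fun d (\<lambda>_. a)"
| poly_fun_add: "poly_fun d f \<Longrightarrow> poly_fun d g \<Longrightarrow> poly_fun d (\<lambda>x. f x \<oplus> g x)"
| poly_fun_shift: "poly_fun d f \<Longrightarrow> poly_fun (Suc d) (\<lambda>x. x \<otimes> f x)"
| poly_fun_cong: "poly_fun d f \<Longrightarrow> (\<And>x. x \<in> carrier F \<Longrightarrow> f x = g x) \<Longrightarrow> poly_fun d g"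

lemma poly_fun_closed: "poly_fun d f \<Longrightarrow> x \<in> carrier F \<Longrightarrow> f x \<in> carrier F"
  by (induction rule: poly_fun.induct) auto

lemma poly_fun_mono: "poly_fun d f \<Longrightarrow> d \<le> d' \<Longrightarrow> poly_fun d' f"
proof (induction arbitrary: d' rule: poly_fun.induct)
  case (poly_fun_shift d f)
  then show ?case
    using poly_fun.poly_fun_shift by (cases d') auto
next
  case (poly_fun_cong d f g)
  then show ?case
    by (meson poly_fun.poly_fun_cong)
qed (simp_all add: poly_fun.poly_fun_const poly_fun.poly_fun_add)

lemma poly_fun_smult: "poly_fun d f \<Longrightarrow> a \<in> carrier F \<Longrightarrow> poly_fun d (\<lambda>x. a \<otimes> f x)"
proof (induction rule: poly_fun.induct)
  case (poly_fun_const b d)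
  then show ?case
    by (intro poly_fun.poly_fun_const) simp
next
  case (poly_fun_add d f g)
  then have "poly_fun d (\<lambda>x. a \<otimes> f x \<oplus> a \<otimes> g x)"
    by (intro poly_fun.poly_fun_add)
  then show ?case
    by (rule poly_fun_cong) (use poly_fun_add in \<open>auto simp: r_distr poly_fun_closed\<close>)
next
  case (poly_fun_shift d f)
  then have "poly_fun (Suc d) (\<lambda>x. x \<otimes> (a \<otimes> f x))"
    by (intro poly_fun.poly_fun_shift)
  then show ?case
    by (rule poly_fun_cong) (use poly_fun_shift in \<open>auto simp: m_lcomm poly_fun_closed\<close>)
next
  case (poly_fun_cong d f g)
  then show ?case
    using poly_fun.poly_fun_cong [of d "\<lambda>x. a \<otimes> f x" "\<lambda>x. a \<otimes> g x"] by simp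
qed

lemma poly_fun_linear_mult:
  assumes "poly_fun d f" "z \<in> carrier F"
  shows "poly_fun (Suc d) (\<lambda>x. (x \<oplus> z) \<otimes> f x)"
proof -
  have "poly_fun (Suc d) (\<lambda>x. x \<otimes> f x \<oplus> z \<otimes> f x)"
    using assms poly_fun_mono [OF assms(1)] by (intro poly_fun_add poly_fun_shift poly_fun_smult) auto
  then show ?thesis
    by (rule poly_fun_cong) (use assms in \<open>auto simp: l_distr poly_fun_closed\<close>)
qed

lemma poly_fun_prod:
  assumes "finite Z" "poly_fun d f" "Z \<subseteq> carrier F"
  shows "poly_fun (d + card Z) (\<lambda>x. f x \<otimes> (\<Otimes>z\<in>Z. x \<oplus> z))"
  using assms
proof (induction Z rule: finite_induct)
  case empty
  then show ?case
    using poly_fun_cong [of d f "\<lambda>x. f x \<otimes> finprod F ((\<oplus>) x) {}"] by (simp add: poly_fun_closed)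
next
  case (insert a Z)
  then have "poly_fun (Suc (d + card Z)) (\<lambda>x. (x \<oplus> a) \<otimes> (f x \<otimes> (\<Otimes>z\<in>Z. x \<oplus> z)))"
    by (intro poly_fun_linear_mult) auto
  moreover have "(x \<oplus> a) \<otimes> (f x \<otimes> (\<Otimes>z\<in>Z. x \<oplus> z)) = f x \<otimes> (\<Otimes>z\<in>insert a Z. x \<oplus> z)"
    if "x \<in> carrier F" for x
  proof -
    have "(\<Otimes>z\<in>insert a Z. x \<oplus> z) = (x \<oplus> a) \<otimes> (\<Otimes>z\<in>Z. x \<oplus> z)"
      using that insert by (intro finprod_insert) auto
    moreover have "(\<Otimes>z\<in>Z. x \<oplus> z) \<in> carrier F"
      using that insert by (intro finprod_closed) auto
    ultimately show ?thesis
      using that insert by (simp add: m_lcomm poly_fun_closed)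
  qed
  ultimately show ?case
    using insert.hyps by (simp add: poly_fun_cong)
qed

lemma poly_fun_eval:
  assumes "set p \<subseteq> carrier F"
  shows "poly_fun (length p - 1) (eval p)"
  using assms
proof (induction p)
  case Nil
  then show ?case
    by (auto intro: poly_fun_const)
next
  case (Cons a p)
  have "poly_fun n (\<lambda>x. x [^] n)" for n :: nat
  proof (induction n)
    case 0
    show ?case by (auto intro: poly_fun_const)
  next
    case (Suc n)
    then show ?case
      by (rule poly_fun_shift [THEN poly_fun_cong]) (auto simp: m_comm)
  qed
  \<comment> \<open>Coefficient lists begin with the leading coefficient, so \<open>a\<close>
    belongs to the power \<open>length p\<close>.\<close>
  then have "poly_fun (length p) (\<lambda>x. a \<otimes> x [^] length p \<oplus> eval p x)"
    using Cons poly_fun_mono [OF Cons.IH, of "length p"] by (intro poly_fun_add poly_fun_smult) auto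
  then show ?case
    by (simp add: poly_fun_cong)
qed

text \<open>For \<open>c\<close> in \<open>D\<close> this is the derivative at \<open>c\<close> of
  the monic polynomial with the simple roots \<open>D\<close>; for other \<open>c\<close> it is the
  value of that polynomial. The same formula thus serves as the Lagrange denominators and as the
  function \<open>L\<close> of the decoder.\<close>

definition nodal :: "nat set \<Rightarrow> nat \<Rightarrow> nat" where
  "nodal D c = (\<Otimes>i\<in>D - {c}. c \<oplus> i)"

text \<open>The Lagrange form, that is, the leading coefficient of interpolation at the nodes
  \<open>D\<close>. Differences of nodes are sums in characteristic 2.\<close>

definition divided_difference :: "nat set \<Rightarrow> (nat \<Rightarrow> nat) \<Rightarrow> nat" where
  "divided_difference D f = (\<Oplus>c\<in>D. f c \<otimes> inv (nodal D c))"

lemma nodal_closed [simp]: "D \<subseteq> carrier F \<Longrightarrow> c \<in> carrier F \<Longrightarrow> nodal D c \<in> carrier F"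
  unfolding nodal_def by (intro finprod_closed) auto

lemma nodal_nonzero [simp]: 
  assumes "D \<subseteq> carrier F" "c \<in> carrier F"
  shows "nodal D c \<noteq> \<zero>"
proof -
  have "finite D"
    using assms finite_subset finite_carrier by blast
  then show ?thesis
    unfolding nodal_def using assms by (intro finprod_nonzero) (auto simp: add_eq_zero_iff)
qed

lemma nodal_remove:
  assumes "D \<subseteq> carrier F" "c \<in> carrier F" "b \<in> D" "b \<noteq> c"
  shows "nodal D c = (c \<oplus> b) \<otimes> nodal (D - {b}) c"
proof -
  have "finite D"
    using assms finite_subset finite_carrier by blast
  moreover have "D - {c} = insert b (D - {b} - {c})"
    using assms by auto
  ultimately show ?thesis
    unfolding nodal_def using assms by (simp add: Pi_def subset_iff)
qed

lemma divided_difference_add: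
  assumes "D \<subseteq> carrier F" "\<And>c. c \<in> D \<Longrightarrow> f c \<in> carrier F" "\<And>c. c \<in> D \<Longrightarrow> g c \<in> carrier F"
  shows "divided_difference D (\<lambda>c. f c \<oplus> g c) = divided_difference D f \<oplus> divided_difference D g"
proof -
  have "divided_difference D (\<lambda>c. f c \<oplus> g c) =
      (\<Oplus>c\<in>D. f c \<otimes> inv (nodal D c) \<oplus> g c \<otimes> inv (nodal D c))"
    unfolding divided_difference_def using assms by (intro finsum_cong') (auto simp: l_distr subset_iff)
  then show ?thesis
    unfolding divided_difference_def using assms by (subst (asm) finsum_addf) (auto simp: subset_iff)
qed

lemma divided_difference_smult:
  assumes "D \<subseteq> carrier F" "\<And>c. c \<in> D \<Longrightarrow> f c \<in> carrier F" "a \<in> carrier F"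
  shows "divided_difference D (\<lambda>c. a \<otimes> f c) = a \<otimes> divided_difference D f"
proof -
  have "finite D"
    using assms finite_subset finite_carrier by blast
  have "divided_difference D (\<lambda>c. a \<otimes> f c) = (\<Oplus>c\<in>D. a \<otimes> (f c \<otimes> inv (nodal D c)))"
    unfolding divided_difference_def using assms by (intro finsum_cong') (auto simp: m_assoc subset_iff)
  then show ?thesis
    unfolding divided_difference_def using assms \<open>finite D\<close>
    by (subst finsum_rdistr) (auto simp: subset_iff)
qed

lemma divided_difference_closed:
  assumes "D \<subseteq> carrier F" "\<And>c. c \<in> D \<Longrightarrow> f c \<in> carrier F"
  shows "divided_difference D f \<in> carrier F"
  unfolding divided_difference_def using assms by (intro finsum_closed) (auto simp: subset_iff)

text \<open>The factor \<open>c \<oplus> b\<close> kills the term of the node \<open>b\<close> and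
  cancels the factor that \<open>b\<close> contributes to every other nodal value.\<close>

lemma divided_difference_linear:
  assumes "D \<subseteq> carrier F" "\<And>c. c \<in> D \<Longrightarrow> f c \<in> carrier F" "b \<in> D"
  shows "divided_difference D (\<lambda>c. (c \<oplus> b) \<otimes> f c) = divided_difference (D - {b}) f"
proof -
  have fin: "finite D"
    using assms finite_subset finite_carrier by blast
  have D: "D = insert b (D - {b})"
    using assms by auto
  define h where "h c = (c \<oplus> b) \<otimes> f c \<otimes> inv (nodal D c)" for c
  have c: "h c \<in> carrier F" if "c \<in> D" for c
    unfolding h_def using that assms by (auto simp: subset_iff)
  have b: "h b = \<zero>"
    unfolding h_def using assms by (auto simp: subset_iff)
  have o: "h c = f c \<otimes> inv (nodal (D - {b}) c)" if "c \<in> D - {b}" for c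
  proof -
    have *: "c \<in> carrier F" "b \<in> carrier F" "D - {b} \<subseteq> carrier F" "c \<oplus> b \<noteq> \<zero>" "f c \<in> carrier F"
      using that assms by (auto simp: add_eq_zero_iff subset_iff)
    have "inv (nodal D c) = inv (c \<oplus> b) \<otimes> inv (nodal (D - {b}) c)"
      using that assms * by (simp add: nodal_remove [of D c b] inv_mult_distrib)
    then have "h c = ((c \<oplus> b) \<otimes> inv (c \<oplus> b)) \<otimes> (f c \<otimes> inv (nodal (D - {b}) c))"
      unfolding h_def using * by (simp add: m_assoc m_lcomm [of "f c"] del: r_inv')
    then show ?thesis
      using * by simp
  qed
  have "finsum F h D = h b \<oplus> finsum F h (D - {b})"
    using c assms fin by (subst D, subst finsum_insert) (auto simp: Pi_def)
  also have "\<dots> = (\<Oplus>c\<in>D - {b}. h c)"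
    using b c assms by (auto intro!: l_zero finsum_closed)
  also have "\<dots> = divided_difference (D - {b}) f"
    unfolding divided_difference_def
  proof (rule finsum_cong')
    show "(\<lambda>c. f c \<otimes> inv (nodal (D - {b}) c)) \<in> D - {b} \<rightarrow> carrier F"
      using c by (intro funcsetI) (metis o DiffD1)
  qed (use o in simp_all)
  finally show ?thesis
    unfolding divided_difference_def h_def .
qed

text \<open>For two nodes \<open>a\<close> and \<open>b\<close>, the constant
  \<open>a \<oplus> b\<close> equals \<open>(c \<oplus> a) \<oplus> (c \<oplus> b)\<close>, and each
  linear factor removes one node. This is the classical recursion: a nonzero multiple of the divided
  difference is the sum of those over \<open>D - {a}\<close> and \<open>D - {b}\<close>. These are
  both 1 if \<open>D\<close> has two elements, and otherwise both 0 by induction.\<close>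

lemma divided_difference_one:
  assumes "D \<subseteq> carrier F" "2 \<le> card D"
  shows "divided_difference D (\<lambda>_. \<one>) = \<zero>"
  using assms
proof (induction "card D" arbitrary: D rule: less_induct)
  case less
  have fin: "finite D"
    using less.prems card.infinite by fastforce
  obtain a b where ab: "a \<in> D" "b \<in> D" "a \<noteq> b"
    using less.prems card_le_Suc0_iff_eq [OF fin] by fastforce
  then have *: "a \<in> carrier F" "b \<in> carrier F"
    using less.prems by auto
  have one: "divided_difference (D - {a}) (\<lambda>_. \<one>) \<oplus> divided_difference (D - {b}) (\<lambda>_. \<one>) = \<zero>"
  proof (cases "card D = 2")
    case True
    then have "D = {a, b}"
      using ab by (auto simp: card_2_iff)
    then have D: "D - {a} = {b}" "D - {b} = {a}"
      using ab by auto
    have "divided_difference {c} (\<lambda>_. \<one>) = \<one>" if "c \<in> carrier F" for c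
      using that by (simp add: divided_difference_def nodal_def)
    then show ?thesis
      using * by (simp add: D)
  next
    case False
    then have "2 \<le> card (D - {c})" "card (D - {c}) < card D" if "c \<in> D" for c
      using that less.prems fin by (auto simp: card_Diff_singleton)
    moreover have "D - {c} \<subseteq> carrier F" for c
      using less.prems by auto
    ultimately show ?thesis
      using ab less.hyps by simp
  qed
  have "(a \<oplus> b) \<otimes> divided_difference D (\<lambda>_. \<one>) = divided_difference D (\<lambda>c. (a \<oplus> b) \<otimes> \<one>)"
    using less.prems * by (subst divided_difference_smult) auto
  also have "\<dots> = divided_difference D (\<lambda>c. (c \<oplus> a) \<otimes> \<one> \<oplus> (c \<oplus> b) \<otimes> \<one>)"
  proof -
    have "(a \<oplus> b) \<otimes> \<one> = (c \<oplus> a) \<otimes> \<one> \<oplus> (c \<oplus> b) \<otimes> \<one>" if "c \<in> D" for c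
    proof -
      have "c \<in> carrier F"
        using that less.prems by auto
      then show ?thesis
        using * by (simp add: a_ac)
    qed
    then show ?thesis
      unfolding divided_difference_def using less.prems * by (intro finsum_cong') (auto simp: subset_iff)
  qed
  also have "\<dots> = \<zero>"
    using less.prems * ab one
    by (subst divided_difference_add) (auto simp: divided_difference_linear subset_iff simp del: r_one)
  finally show ?case
    using * ab less.prems by (simp add: integral_iff add_eq_zero_iff divided_difference_closed)
qed

lemma divided_difference_poly_fun:
  assumes "poly_fun d f" "D \<subseteq> carrier F" "d + 2 \<le> card D"
  shows "divided_difference D f = \<zero>"
  using assms
proof (induction arbitrary: D rule: poly_fun.induct)
  case (poly_fun_const a d)
  then show ?case
    using divided_difference_smult [of D "\<lambda>_. \<one>" a] by (simp add: divided_difference_one)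
next
  case (poly_fun_add d f g)
  then show ?case
    by (subst divided_difference_add) (auto simp: poly_fun_closed subset_iff)
next
  case (poly_fun_shift d f)
  then obtain b where b: "b \<in> D"
    by (metis card.empty ex_in_conv le_zero_eq add_is_0 zero_neq_numeral)
  then have bc: "b \<in> carrier F" "finite D"
    using poly_fun_shift.prems finite_subset [OF _ finite_carrier] by auto
  have f: "f c \<in> carrier F" if "c \<in> D" for c
    using that poly_fun_shift.prems poly_fun_shift.hyps by (auto simp: poly_fun_closed)
  \<comment> \<open>Splitting \<open>c\<close> as \<open>(c \<oplus> b) \<oplus> b\<close> with a
    node \<open>b\<close> pays for the additional degree with a node: the first part is a divided
    difference over \<open>D - {b}\<close>, the second a multiple of the one over
    \<open>D\<close>.\<close>
  have "divided_difference D (\<lambda>c. c \<otimes> f c) = divided_difference D (\<lambda>c. (c \<oplus> b) \<otimes> f c \<oplus> b \<otimes> f c)"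
  proof -
    have "c \<otimes> f c = (c \<oplus> b) \<otimes> f c \<oplus> b \<otimes> f c" if "c \<in> D" for c
    proof -
      have "c \<in> carrier F"
        using that poly_fun_shift.prems by auto
      then show ?thesis
        using f [OF that] bc by (simp add: l_distr a_assoc)
    qed
    then show ?thesis
      unfolding divided_difference_def using poly_fun_shift.prems bc f by (intro finsum_cong') (auto simp: subset_iff)
  qed
  also have "\<dots> = divided_difference (D - {b}) f \<oplus> b \<otimes> divided_difference D f"
    using poly_fun_shift.prems bc b f
    by (subst divided_difference_add) (auto simp: divided_difference_linear divided_difference_smult subset_iff)
  also have "\<dots> = \<zero>"
  proof -
    have "divided_difference (D - {b}) f = \<zero>"
      using poly_fun_shift.prems b bc by (intro poly_fun_shift.IH) auto
    moreover have "divided_difference D f = \<zero>"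
      using poly_fun_shift.prems by (intro poly_fun_shift.IH) auto
    ultimately show ?thesis
      using bc by simp
  qed
  finally show ?case .
next
  case (poly_fun_cong d f g)
  have "divided_difference D g = divided_difference D f"
    unfolding divided_difference_def
    using poly_fun_cong.prems poly_fun_cong.hyps poly_fun_closed [OF poly_fun_cong.hyps(1)]
    by (intro finsum_cong') (auto simp: subset_iff)
  then show ?case
    using poly_fun_cong by simp
qed

text \<open>
  On a subgroup all nodal values coincide, so the divided difference is a multiple of the sum.
\<close>

lemma finsum_subgroup_poly_fun:
  assumes f: "poly_fun d f" and U: "U \<subseteq> carrier F" "\<zero> \<in> U" "d + 2 \<le> card U"
    and closed: "\<And>x y. x \<in> U \<Longrightarrow> y \<in> U \<Longrightarrow> x \<oplus> y \<in> U"
  shows "finsum F f U = \<zero>"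
proof -
  have nodal: "nodal U c = nodal U \<zero>" if c: "c \<in> U" for c
  proof -
    \<comment> \<open>Translation by \<open>c\<close> is an involution of \<open>U\<close> that
      exchanges \<open>\<zero>\<close> and \<open>c\<close>, so it reindexes one nodal product into
      the other.\<close>
    have "(\<lambda>i. c \<oplus> i) ` (U - {\<zero>}) = U - {c}"
    proof (intro equalityI subsetI)
      fix j assume "j \<in> (\<lambda>i. c \<oplus> i) ` (U - {\<zero>})"
      then obtain i where "i \<in> U" "i \<noteq> \<zero>" "j = c \<oplus> i"
        by auto
      moreover have "c \<oplus> (c \<oplus> i) = i" "c \<oplus> c = \<zero>"
        using U c \<open>i \<in> U\<close> by (auto simp: subset_iff)
      ultimately show "j \<in> U - {c}"
        using closed c by auto
    next
      fix j assume "j \<in> U - {c}"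
      moreover from this have "c \<oplus> (c \<oplus> j) = j" "c \<oplus> j \<noteq> \<zero>"
        using U c by (auto simp: add_eq_zero_iff subset_iff)
      ultimately show "j \<in> (\<lambda>i. c \<oplus> i) ` (U - {\<zero>})"
        using closed c by (metis DiffD1 DiffI image_eqI singletonD)
    qed
    moreover have "finprod F (\<lambda>i. c \<oplus> i) ((\<lambda>i. c \<oplus> i) ` (U - {\<zero>})) =
        (\<Otimes>i\<in>U - {\<zero>}. c \<oplus> (c \<oplus> i))"
    proof (rule finprod_reindex)
      show "inj_on (\<lambda>i. c \<oplus> i) (U - {\<zero>})"
        using U c by (intro inj_onI) (metis DiffD1 add_add_self subset_iff)
      show "(\<lambda>i. c \<oplus> i) \<in> (\<lambda>i. c \<oplus> i) ` (U - {\<zero>}) \<rightarrow> carrier F"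
        using U c by (simp add: Pi_def subset_iff image_iff) blast
    qed
    ultimately have "nodal U c = (\<Otimes>i\<in>U - {\<zero>}. c \<oplus> (c \<oplus> i))"
      unfolding nodal_def by simp
    also have "\<dots> = nodal U \<zero>"
      unfolding nodal_def using U c by (intro finprod_cong') (auto simp: subset_iff)
    finally show ?thesis .
  qed
  have fin: "finite U"
    using U finite_subset [OF _ finite_carrier] by auto
  have *: "inv (nodal U \<zero>) \<in> carrier F" "nodal U \<zero> \<in> carrier F" "nodal U \<zero> \<noteq> \<zero>"
    using U by simp_all
  have sum: "finsum F f U \<in> carrier F"
    using U f by (intro finsum_closed) (auto simp: poly_fun_closed)
  have "\<zero> = divided_difference U f"
    using divided_difference_poly_fun [OF f] U by simp
  also have "\<dots> = (\<Oplus>c\<in>U. f c \<otimes> inv (nodal U \<zero>))"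
    unfolding divided_difference_def
  proof (rule finsum_cong')
    show "(\<lambda>c. f c \<otimes> inv (nodal U \<zero>)) \<in> U \<rightarrow> carrier F"
      using U f * by (auto simp: poly_fun_closed subset_iff)
    show "f c \<otimes> inv (nodal U c) = f c \<otimes> inv (nodal U \<zero>)" if "c \<in> U" for c
      using nodal [OF that] by simp
  qed simp
  also have "\<dots> = finsum F f U \<otimes> inv (nodal U \<zero>)"
    using U f * fin by (intro finsum_ldistr [symmetric]) (auto simp: poly_fun_closed)
  finally have "\<zero> \<otimes> nodal U \<zero> = (finsum F f U \<otimes> inv (nodal U \<zero>)) \<otimes> nodal U \<zero>"
    by simp
  also have "\<dots> = finsum F f U"
    using * sum by (simp add: m_assoc m_comm [of "inv _"])
  finally show ?thesis
    using * by simp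
qed

subsection \<open>The erasure identity\<close>

text \<open>The value at \<open>\<zero>\<close> removes the diagonal term \<open>y = e\<close> from
  the convolution, where the kernel would have its pole.\<close>

definition recip :: "nat \<Rightarrow> nat" where
  "recip z = (if z = \<zero> then \<zero> else inv z)"

lemma recip_closed [simp]: "z \<in> carrier F \<Longrightarrow> recip z \<in> carrier F"
  by (simp add: recip_def)

definition weighted :: "nat set \<Rightarrow> (nat \<Rightarrow> nat) \<Rightarrow> nat \<Rightarrow> nat" where
  "weighted E P y = (if y \<in> E then \<zero> else P y \<otimes> nodal E y)"

lemma weighted_closed [simp]:
  "E \<subseteq> carrier F \<Longrightarrow> y \<in> carrier F \<Longrightarrow> P y \<in> carrier F \<Longrightarrow> weighted E P y \<in> carrier F"
  by (simp add: weighted_def)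

text \<open>As the sum of \<open>R\<close> over the field vanishes, \<open>R e\<close> is the sum of
  all its other values. Erased points other than \<open>e\<close> are roots of \<open>R\<close>, and
  at known points the kernel cancels exactly the factor of \<open>nodal E y\<close> that
  \<open>R\<close> lacks. So the terms of the convolution are those of \<open>R\<close> with the one
  at \<open>e\<close> deleted.\<close>

lemma erasure_identity:
  assumes P: "poly_fun d P" and E: "E \<subseteq> carrier F" "e \<in> E" "d + card E + 1 \<le> card (carrier F)"
  shows "(\<Oplus>y\<in>carrier F. weighted E P y \<otimes> recip (e \<oplus> y)) = P e \<otimes> nodal E e"
proof -
  have e: "e \<in> carrier F" and fin: "finite E"
    using E finite_subset [OF _ finite_carrier] by auto
  define R where "R x = P x \<otimes> (\<Otimes>z\<in>E - {e}. x \<oplus> z)" for x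
  have "poly_fun (d + card (E - {e})) R"
    unfolding R_def using P E fin by (intro poly_fun_prod) auto
  \<comment> \<open>Leaving out \<open>e\<close> makes the degree at most
    \<open>d + card E - 1\<close>, hence at most the field size minus 2, just as the vanishing
    theorem requires.\<close>
  moreover have "card (E - {e}) + 1 = card E"
    using E fin by (metis Suc_eq_plus1 card.remove)
  ultimately have sum: "finsum F R (carrier F) = \<zero>"
    using E by (intro finsum_subgroup_poly_fun) auto
  have R: "R x \<in> carrier F" if "x \<in> carrier F" for x
    using \<open>poly_fun _ R\<close> that by (rule poly_fun_closed)
  have terms: "weighted E P y \<otimes> recip (e \<oplus> y) = (if y = e then \<zero> else R y)" if y: "y \<in> carrier F" for y
  proof (cases "y \<in> E")
    case True
    show ?thesis
    proof (cases "y = e")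
      case True
      then show ?thesis
        using E e by (simp add: weighted_def recip_def)
    next
      case False
      have *: "E - {e} = insert y (E - {e} - {y})"
        using False True by auto
      have "(\<Otimes>z\<in>E - {e}. y \<oplus> z) = (\<Otimes>z\<in>insert y (E - {e} - {y}). y \<oplus> z)"
        using * by simp
      also have "\<dots> = (y \<oplus> y) \<otimes> (\<Otimes>z\<in>E - {e} - {y}. y \<oplus> z)"
        using E y fin by (intro finprod_insert) auto
      also have "\<dots> = \<zero>"
        using E y by (simp add: Pi_def subset_iff)
      finally show ?thesis
        using False True e y P by (simp add: R_def weighted_def poly_fun_closed)
    qed
  next
    case False
    then have ye: "y \<noteq> e" "e \<oplus> y \<noteq> \<zero>"
      using E e y by (auto simp: add_eq_zero_iff)
    have *: "E = insert e (E - {e})" "E - {y} = E"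
      using E False by auto
    have c: "(\<Otimes>z\<in>E - {e}. y \<oplus> z) \<in> carrier F"
      using E y by (intro finprod_closed) auto
    have "nodal E y = (\<Otimes>z\<in>E. y \<oplus> z)"
      by (simp add: nodal_def *(2))
    also have "\<dots> = (\<Otimes>z\<in>insert e (E - {e}). y \<oplus> z)"
      using *(1) by simp
    also have "\<dots> = (y \<oplus> e) \<otimes> (\<Otimes>z\<in>E - {e}. y \<oplus> z)"
      using E y fin e by (intro finprod_insert) auto
    also have "y \<oplus> e = e \<oplus> y"
      using y e by (rule a_comm)
    finally have "weighted E P y \<otimes> recip (e \<oplus> y) =
        (P y \<otimes> ((e \<oplus> y) \<otimes> (\<Otimes>z\<in>E - {e}. y \<oplus> z))) \<otimes> inv (e \<oplus> y)"
      using False ye by (simp add: weighted_def recip_def)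
    also have "\<dots> = P y \<otimes> (\<Otimes>z\<in>E - {e}. y \<oplus> z)"
      using ye e y c poly_fun_closed [OF P y] by (intro mult_mult_inv) auto
    finally show ?thesis
      using ye by (simp add: R_def)
  qed
  have C: "carrier F = insert e (carrier F - {e})"
    using e by auto
  have c: "finsum F R (carrier F - {e}) \<in> carrier F"
    using R by (intro finsum_closed) auto
  have "R e \<oplus> finsum F R (carrier F - {e}) = \<zero>"
    using sum R e by (subst (asm) C, subst (asm) finsum_insert) (auto simp: Pi_def)
  then have Re: "R e = finsum F R (carrier F - {e})"
    using R c e by (simp add: add_eq_zero_iff)
  have "(\<Oplus>y\<in>carrier F. weighted E P y \<otimes> recip (e \<oplus> y)) = (\<Oplus>y\<in>carrier F. if y = e then \<zero> else R y)"
    using terms R by (intro finsum_cong') auto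
  also have "\<dots> = \<zero> \<oplus> (\<Oplus>y\<in>carrier F - {e}. if y = e then \<zero> else R y)"
    using R e by (subst C, subst finsum_insert) (auto simp: Pi_def)
  also have "\<dots> = \<zero> \<oplus> finsum F R (carrier F - {e})"
    using R by (intro arg_cong2 [of _ _ _ _ "(\<oplus>)"] finsum_cong') auto
  also have "\<dots> = R e"
    using Re c by simp
  also have "\<dots> = P e \<otimes> nodal E e"
    by (simp add: R_def nodal_def)
  finally show ?thesis .
qed

end

section \<open>Convolution in characteristic 2 by deformation\<close>

context word_field
begin

lemma finsum_lessThan_double:
  fixes h :: "nat \<Rightarrow> nat"
  assumes "\<And>y. y < 2 ^ Suc l \<Longrightarrow> h y \<in> carrier F"
  shows "finsum F h {..<2 ^ Suc l} = finsum F h {..<2 ^ l} \<oplus> (\<Oplus>y\<in>{..<2 ^ l}. h (y + 2 ^ l))"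
proof -
  have "{..<2 ^ Suc l} = {..<2 ^ l} \<union> (\<lambda>y. y + 2 ^ l) ` {..<2 ^ l :: nat}"
  proof (intro equalityI subsetI)
    fix x :: nat assume "x \<in> {..<2 ^ Suc l}"
    then have "x < 2 ^ Suc l"
      by simp
    then show "x \<in> {..<2 ^ l} \<union> (\<lambda>y. y + 2 ^ l) ` {..<2 ^ l}"
      by (cases rule: less_power_Suc_cases) auto
  qed auto
  moreover have "(\<Oplus>y\<in>(\<lambda>y. y + 2 ^ l) ` {..<2 ^ l}. h y) = (\<Oplus>y\<in>{..<2 ^ l}. h (y + 2 ^ l))"
    using assms by (intro finsum_reindex) auto
  moreover have "{..<2 ^ l} \<inter> (\<lambda>y. y + 2 ^ l) ` {..<2 ^ l :: nat} = {}"
    by auto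
  moreover have "h \<in> {..<2 ^ l} \<rightarrow> carrier F" "h \<in> (\<lambda>y. y + 2 ^ l) ` {..<2 ^ l} \<rightarrow> carrier F"
    using assms by auto
  ultimately show ?thesis
    by (simp add: finsum_Un_disjoint)
qed

text \<open>
  Evaluation at the roots \<open>1\<close> and \<open>1 + c\<close> of \<open>(t + 1) * (t + 1 + c)\<close> in each of the \<open>m\<close> variables, and
  its inverse. Accordingly \<open>deformed_conv\<close> below multiplies with \<open>t\<^sup>2 = c * t + (1 + c)\<close>, one variable
  for each bit of the index, the most significant one first.
\<close>

abbreviation deform :: "nat \<Rightarrow> nat \<Rightarrow> (nat \<Rightarrow> nat) \<Rightarrow> nat \<Rightarrow> nat" where
  "deform c \<equiv> bfly (\<oplus>) (\<lambda>a b. a \<oplus> (\<one> \<oplus> c) \<otimes> b)"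

abbreviation undeform :: "nat \<Rightarrow> nat \<Rightarrow> (nat \<Rightarrow> nat) \<Rightarrow> nat \<Rightarrow> nat" where
  "undeform c \<equiv> bfly (\<lambda>u v. u \<oplus> (u \<oplus> v) \<otimes> inv c) (\<lambda>u v. (u \<oplus> v) \<otimes> inv c)"

primrec deformed_conv :: "nat \<Rightarrow> nat \<Rightarrow> (nat \<Rightarrow> nat) \<Rightarrow> (nat \<Rightarrow> nat) \<Rightarrow> nat \<Rightarrow> nat" where
  "deformed_conv c 0 f g = (\<lambda>x. f 0 \<otimes> g 0)"
| "deformed_conv c (Suc l) f g = (\<lambda>x.
     if x < 2 ^ l then deformed_conv c l f g x \<oplus> (\<one> \<oplus> c) \<otimes> deformed_conv c l (upper l f) (upper l g) x
     else deformed_conv c l f (upper l g) (x - 2 ^ l) \<oplus> (deformed_conv c l (upper l f) g (x - 2 ^ l) \<oplus>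
       c \<otimes> deformed_conv c l (upper l f) (upper l g) (x - 2 ^ l)))"

lemma deformed_conv_closed:
  "c \<in> carrier F \<Longrightarrow> (\<And>y. y < 2 ^ l \<Longrightarrow> f y \<in> carrier F) \<Longrightarrow>
   (\<And>y. y < 2 ^ l \<Longrightarrow> g y \<in> carrier F) \<Longrightarrow> deformed_conv c l f g x \<in> carrier F"
  by (induction l arbitrary: f g x) (auto simp: upper_def)

section \<open>Linearity, multiplicativity and inversion of the deformed transform\<close>

lemma deform_closed:
  "c \<in> carrier F \<Longrightarrow> (\<And>y. y < 2 ^ l \<Longrightarrow> f y \<in> carrier F) \<Longrightarrow> x < 2 ^ l \<Longrightarrow> deform c l f x \<in> carrier F"
  by (rule bfly_closed) auto

lemma deform_linear:
  assumes "c \<in> carrier F" "k \<in> carrier F"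
    and "\<And>y. y < 2 ^ l \<Longrightarrow> f y \<in> carrier F" "\<And>y. y < 2 ^ l \<Longrightarrow> g y \<in> carrier F" "x < 2 ^ l"
  shows "deform c l (\<lambda>y. f y \<oplus> k \<otimes> g y) x = deform c l f x \<oplus> k \<otimes> deform c l g x"
proof (rule bfly_map2 [of "carrier F"])
  fix a b c' d assume "a \<in> carrier F" "b \<in> carrier F" "c' \<in> carrier F" "d \<in> carrier F"
  then show "a \<oplus> b \<oplus> k \<otimes> (c' \<oplus> d) = a \<oplus> k \<otimes> c' \<oplus> (b \<oplus> k \<otimes> d) \<and>
    a \<oplus> (\<one> \<oplus> c) \<otimes> b \<oplus> k \<otimes> (c' \<oplus> (\<one> \<oplus> c) \<otimes> d) = a \<oplus> k \<otimes> c' \<oplus> (\<one> \<oplus> c) \<otimes> (b \<oplus> k \<otimes> d)"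
    using assms(1,2) by (simp add: r_distr l_distr a_ac m_ac)
qed (use assms in auto)

lemma undeform_linear:
  assumes "c \<in> carrier F" "c \<noteq> \<zero>" "k \<in> carrier F"
    and "\<And>y. y < 2 ^ l \<Longrightarrow> f y \<in> carrier F" "\<And>y. y < 2 ^ l \<Longrightarrow> g y \<in> carrier F" "x < 2 ^ l"
  shows "undeform c l (\<lambda>y. f y \<oplus> k \<otimes> g y) x = undeform c l f x \<oplus> k \<otimes> undeform c l g x"
proof (rule bfly_map2 [of "carrier F"])
  have "inv c \<in> carrier F"
    using assms by simp
  moreover fix a b c' d assume "a \<in> carrier F" "b \<in> carrier F" "c' \<in> carrier F" "d \<in> carrier F"
  ultimately show "a \<oplus> (a \<oplus> b) \<otimes> inv c \<oplus> k \<otimes> (c' \<oplus> (c' \<oplus> d) \<otimes> inv c) =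
      a \<oplus> k \<otimes> c' \<oplus> (a \<oplus> k \<otimes> c' \<oplus> (b \<oplus> k \<otimes> d)) \<otimes> inv c \<and>
      (a \<oplus> b) \<otimes> inv c \<oplus> k \<otimes> ((c' \<oplus> d) \<otimes> inv c) = (a \<oplus> k \<otimes> c' \<oplus> (b \<oplus> k \<otimes> d)) \<otimes> inv c"
    using assms(1,3) by (simp add: r_distr l_distr a_ac m_ac)
qed (use assms in auto)

lemma one_add_mult:
  assumes "c \<in> carrier F" "x \<in> carrier F"
  shows "(\<one> \<oplus> c) \<otimes> x \<oplus> c \<otimes> x = x" and "x \<oplus> c \<otimes> x = (\<one> \<oplus> c) \<otimes> x"
    and "x \<oplus> (\<one> \<oplus> c) \<otimes> x = c \<otimes> x"
  using assms by (simp_all add: l_distr a_assoc)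

text \<open>The product of \<open>a + a' * t\<close> and \<open>b + b' * t\<close>, reduced by
  \<open>t * t = c * t + d\<close>, is evaluated at the roots \<open>t = 1\<close> and
  \<open>t = d\<close>. The second evaluation rests on \<open>d * d = c * d + d\<close>.\<close>

lemma deformed_product:
  assumes C: "c \<in> carrier F" "a \<in> carrier F" "a' \<in> carrier F" "b \<in> carrier F" "b' \<in> carrier F"
  defines "d \<equiv> \<one> \<oplus> c"
  shows "(a \<otimes> b \<oplus> d \<otimes> (a' \<otimes> b')) \<oplus> (a \<otimes> b' \<oplus> (a' \<otimes> b \<oplus> c \<otimes> (a' \<otimes> b'))) = (a \<oplus> a') \<otimes> (b \<oplus> b')"
    and "(a \<otimes> b \<oplus> d \<otimes> (a' \<otimes> b')) \<oplus> d \<otimes> (a \<otimes> b' \<oplus> (a' \<otimes> b \<oplus> c \<otimes> (a' \<otimes> b'))) =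
      (a \<oplus> d \<otimes> a') \<otimes> (b \<oplus> d \<otimes> b')"
proof -
  have d: "d \<in> carrier F"
    using C by (simp add: d_def)
  define e where "e = a' \<otimes> b'"
  have e: "e \<in> carrier F"
    using C by (simp add: e_def)
  have "(a \<otimes> b \<oplus> d \<otimes> e) \<oplus> (a \<otimes> b' \<oplus> (a' \<otimes> b \<oplus> c \<otimes> e)) =
      a \<otimes> b \<oplus> (a \<otimes> b' \<oplus> (a' \<otimes> b \<oplus> (d \<otimes> e \<oplus> c \<otimes> e)))"
    using C d e by (simp add: a_ac)
  also have "d \<otimes> e \<oplus> c \<otimes> e = e"
    using C e by (simp add: d_def one_add_mult)
  finally show "(a \<otimes> b \<oplus> d \<otimes> (a' \<otimes> b')) \<oplus> (a \<otimes> b' \<oplus> (a' \<otimes> b \<oplus> c \<otimes> (a' \<otimes> b'))) = (a \<oplus> a') \<otimes> (b \<oplus> b')"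
    using C by (simp add: e_def l_distr r_distr a_ac)
  have "(a \<otimes> b \<oplus> d \<otimes> e) \<oplus> d \<otimes> (a \<otimes> b' \<oplus> (a' \<otimes> b \<oplus> c \<otimes> e)) =
      a \<otimes> b \<oplus> (d \<otimes> (a \<otimes> b') \<oplus> (d \<otimes> (a' \<otimes> b) \<oplus> d \<otimes> (e \<oplus> c \<otimes> e)))"
    using C d e by (simp add: r_distr a_ac)
  also have "e \<oplus> c \<otimes> e = d \<otimes> e"
    using C e by (simp add: d_def one_add_mult)
  finally show "(a \<otimes> b \<oplus> d \<otimes> (a' \<otimes> b')) \<oplus> d \<otimes> (a \<otimes> b' \<oplus> (a' \<otimes> b \<oplus> c \<otimes> (a' \<otimes> b'))) =
      (a \<oplus> d \<otimes> a') \<otimes> (b \<oplus> d \<otimes> b')"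
    using C d by (simp add: e_def l_distr r_distr a_ac m_ac)
qed

text \<open>Evaluation at roots of the defining relations is multiplicative. The lower levels are
  linear, so they pass through the recursion for the top variable, and
  \<open>deformed_product\<close> settles the remaining butterfly.\<close>

lemma deform_deformed_conv:
  "c \<in> carrier F \<Longrightarrow> (\<And>y. y < 2 ^ l \<Longrightarrow> f y \<in> carrier F) \<Longrightarrow> (\<And>y. y < 2 ^ l \<Longrightarrow> g y \<in> carrier F) \<Longrightarrow>
   x < 2 ^ l \<Longrightarrow> deform c l (deformed_conv c l f g) x = deform c l f x \<otimes> deform c l g x"
proof (induction l arbitrary: f g x)
  case 0
  then show ?case by simp
next
  case (Suc l)
  note c = Suc.prems(1)
  define h where "h = deformed_conv c (Suc l) f g"
  have C: "f y \<in> carrier F" "g y \<in> carrier F" "upper l f y \<in> carrier F" "upper l g y \<in> carrier F"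
    if "y < 2 ^ l" for y
    using that Suc.prems by (auto simp: upper_def)
  have D: "deformed_conv c l f g y \<in> carrier F" "deformed_conv c l f (upper l g) y \<in> carrier F"
     "deformed_conv c l (upper l f) g y \<in> carrier F" "deformed_conv c l (upper l f) (upper l g) y \<in> carrier F" for y
    using c C by (auto intro!: deformed_conv_closed)
  have T: "deform c l f v \<in> carrier F" "deform c l (upper l f) v \<in> carrier F"
      "deform c l g v \<in> carrier F" "deform c l (upper l g) v \<in> carrier F" if "v < 2 ^ l" for v
    using that c C by (auto intro!: deform_closed)
  have IH: "deform c l (deformed_conv c l f g) v = deform c l f v \<otimes> deform c l g v"
    "deform c l (deformed_conv c l f (upper l g)) v = deform c l f v \<otimes> deform c l (upper l g) v"
    "deform c l (deformed_conv c l (upper l f) g) v = deform c l (upper l f) v \<otimes> deform c l g v"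
    "deform c l (deformed_conv c l (upper l f) (upper l g)) v = deform c l (upper l f) v \<otimes> deform c l (upper l g) v"
    if "v < 2 ^ l" for v
    using that c C by (auto intro!: Suc.IH)
  have low: "deform c l h v = deform c l f v \<otimes> deform c l g v \<oplus>
      (\<one> \<oplus> c) \<otimes> (deform c l (upper l f) v \<otimes> deform c l (upper l g) v)" if v: "v < 2 ^ l" for v
  proof -
    have "deform c l h v = deform c l (\<lambda>y. deformed_conv c l f g y \<oplus> (\<one> \<oplus> c) \<otimes> deformed_conv c l (upper l f) (upper l g) y) v"
      using v by (intro bfly_cong) (auto simp: h_def)
    then show ?thesis
      using c D v by (simp add: deform_linear IH)
  qed
  have high: "deform c l (upper l h) v = deform c l f v \<otimes> deform c l (upper l g) v \<oplus>
      (deform c l (upper l f) v \<otimes> deform c l g v \<oplus> c \<otimes> (deform c l (upper l f) v \<otimes> deform c l (upper l g) v))"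
    if v: "v < 2 ^ l" for v
  proof -
    have "deform c l (upper l h) v = deform c l (\<lambda>y. deformed_conv c l f (upper l g) y \<oplus> \<one> \<otimes>
        (deformed_conv c l (upper l f) g y \<oplus> c \<otimes> deformed_conv c l (upper l f) (upper l g) y)) v"
      using v c D by (intro bfly_cong) (auto simp: h_def upper_def)
    also have "\<dots> = deform c l (deformed_conv c l f (upper l g)) v \<oplus> \<one> \<otimes>
        deform c l (\<lambda>y. deformed_conv c l (upper l f) g y \<oplus> c \<otimes> deformed_conv c l (upper l f) (upper l g) y) v"
      using c D v by (intro deform_linear) auto
    finally show ?thesis
      using c D v T by (simp add: deform_linear IH)
  qed
  from Suc.prems(4) have "deform c (Suc l) h x = deform c (Suc l) f x \<otimes> deform c (Suc l) g x"
  proof (cases rule: less_power_Suc_cases)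
    case low': low
    then show ?thesis
      using c T by (simp add: bfly_Suc_low low high deformed_product del: bfly.simps)
  next
    case high': (high v)
    then show ?thesis
      using c T by (simp add: bfly_Suc_high low high deformed_product del: bfly.simps)
  qed
  then show ?case
    by (simp only: h_def)
qed

lemma add_add_self_right: "x \<in> carrier F \<Longrightarrow> y \<in> carrier F \<Longrightarrow> (x \<oplus> y) \<oplus> y = x"
  by (simp add: a_assoc)

text \<open>From \<open>u = a + b\<close> and \<open>v = a + (1 + c) * b\<close> one gets
  \<open>b = (u + v) / c\<close> and \<open>a = u + b\<close>, which requires distinct roots. The
  inverse runs through the levels in the same order as the transform, not in reverse; linearity
  moves its lower levels past the top butterfly.\<close>

lemma undeform_deform:
  "c \<in> carrier F \<Longrightarrow> c \<noteq> \<zero> \<Longrightarrow> (\<And>y. y < 2 ^ l \<Longrightarrow> f y \<in> carrier F) \<Longrightarrow> x < 2 ^ l \<Longrightarrow>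
   undeform c l (deform c l f) x = f x"
proof (induction l arbitrary: f x)
  case 0
  then show ?case by simp
next
  case (Suc l)
  note c = Suc.prems(1,2)
  define h where "h = deform c (Suc l) f"
  have C: "f y \<in> carrier F" "upper l f y \<in> carrier F" if "y < 2 ^ l" for y
    using that Suc.prems by (auto simp: upper_def)
  have T: "deform c l f v \<in> carrier F" "deform c l (upper l f) v \<in> carrier F" if "v < 2 ^ l" for v
    using that c C by (auto intro!: deform_closed)
  have IH: "undeform c l (deform c l f) v = f v" "undeform c l (deform c l (upper l f)) v = upper l f v" if "v < 2 ^ l" for v
    using that c C by (auto intro!: Suc.IH)
  have low: "undeform c l h v = f v \<oplus> upper l f v" if v: "v < 2 ^ l" for v
  proof -
    have "undeform c l h v = undeform c l (\<lambda>y. deform c l f y \<oplus> \<one> \<otimes> deform c l (upper l f) y) v"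
      using v T by (intro bfly_cong) (auto simp: h_def bfly_Suc_low simp del: bfly.simps)
    also have "\<dots> = undeform c l (deform c l f) v \<oplus> \<one> \<otimes> undeform c l (deform c l (upper l f)) v"
      using c T v by (intro undeform_linear) auto
    finally show ?thesis
      using C v by (simp add: IH)
  qed
  have high: "undeform c l (upper l h) v = f v \<oplus> (\<one> \<oplus> c) \<otimes> upper l f v" if v: "v < 2 ^ l" for v
  proof -
    have "undeform c l (upper l h) v = undeform c l (\<lambda>y. deform c l f y \<oplus> (\<one> \<oplus> c) \<otimes> deform c l (upper l f) y) v"
      using v T by (intro bfly_cong) (auto simp: h_def upper_def bfly_Suc_high simp del: bfly.simps)
    also have "\<dots> = undeform c l (deform c l f) v \<oplus> (\<one> \<oplus> c) \<otimes> undeform c l (deform c l (upper l f)) v"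
      using c T v by (intro undeform_linear) auto
    finally show ?thesis
      using C v by (simp add: IH)
  qed
  have quot: "((a \<oplus> b) \<oplus> (a \<oplus> (\<one> \<oplus> c) \<otimes> b)) \<otimes> inv c = b" if "a \<in> carrier F" "b \<in> carrier F" for a b
  proof -
    have "(a \<oplus> b) \<oplus> (a \<oplus> (\<one> \<oplus> c) \<otimes> b) = (a \<oplus> a) \<oplus> (b \<oplus> (\<one> \<oplus> c) \<otimes> b)"
      using that c by (simp add: a_ac del: add_self)
    also have "\<dots> = c \<otimes> b"
      using that c by (simp add: one_add_mult)
    finally show ?thesis
      using mult_mult_inv [of \<one> b c] that c by simp
  qed
  from Suc.prems(4) have "undeform c (Suc l) h x = f x"
  proof (cases rule: less_power_Suc_cases)
    case low': low
    then show ?thesis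
      using c C by (simp add: bfly_Suc_low low high quot add_add_self_right del: bfly.simps)
  next
    case high': (high v)
    then show ?thesis
      using c C [of v] by (simp add: bfly_Suc_high low high quot upper_def del: bfly.simps)
  qed
  then show ?case
    by (simp only: h_def)
qed

lemma undeform_mult:
  assumes "c \<in> carrier F" "c \<noteq> \<zero>" "\<And>y. y < 2 ^ l \<Longrightarrow> f y \<in> carrier F" "\<And>y. y < 2 ^ l \<Longrightarrow> g y \<in> carrier F"
    and "x < 2 ^ l"
  shows "undeform c l (\<lambda>u. deform c l f u \<otimes> deform c l g u) x = deformed_conv c l f g x"
proof -
  have "undeform c l (\<lambda>u. deform c l f u \<otimes> deform c l g u) x = undeform c l (deform c l (deformed_conv c l f g)) x"
    using assms by (intro bfly_cong) (auto simp: deform_deformed_conv)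
  then show ?thesis
    using assms by (simp add: undeform_deform deformed_conv_closed)
qed

text \<open>Reducing the square of a variable brings in one factor \<open>c\<close> or
  \<open>1 + c\<close>, and each of the \<open>l\<close> variables is reduced once.\<close>

lemma poly_fun_deformed_conv:
  "(\<And>y. y < 2 ^ l \<Longrightarrow> f y \<in> carrier F) \<Longrightarrow> (\<And>y. y < 2 ^ l \<Longrightarrow> g y \<in> carrier F) \<Longrightarrow>
   poly_fun l (\<lambda>c. deformed_conv c l f g x)"
proof (induction l arbitrary: f g x)
  case 0
  then show ?case by (auto intro: poly_fun_const)
next
  case (Suc l)
  have C: "f y \<in> carrier F" "g y \<in> carrier F" "upper l f y \<in> carrier F" "upper l g y \<in> carrier F"
    if "y < 2 ^ l" for y
    using that Suc.prems by (auto simp: upper_def)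
  have IH: "poly_fun l (\<lambda>c. deformed_conv c l f g v)" "poly_fun l (\<lambda>c. deformed_conv c l f (upper l g) v)"
     "poly_fun l (\<lambda>c. deformed_conv c l (upper l f) g v)" "poly_fun l (\<lambda>c. deformed_conv c l (upper l f) (upper l g) v)" for v
    using C by (auto intro!: Suc.IH)
  note IH' = IH [THEN poly_fun_mono, OF le_SucI [OF order_refl]]
  show ?case
  proof (cases "x < 2 ^ l")
    case True
    \<comment> \<open>\<open>poly_fun_shift\<close> multiplies by the variable only, so
      \<open>(1 + c) * y\<close> is written as \<open>y + c * y\<close>.\<close>
    have "poly_fun (Suc l) (\<lambda>c. deformed_conv c l f g x \<oplus> (deformed_conv c l (upper l f) (upper l g) x \<oplus>
        c \<otimes> deformed_conv c l (upper l f) (upper l g) x))"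
      using IH IH' by (intro poly_fun_add poly_fun_shift)
    then show ?thesis
      by (rule poly_fun_cong) (use True C in \<open>simp add: one_add_mult deformed_conv_closed\<close>)
  next
    case False
    have "poly_fun (Suc l) (\<lambda>c. deformed_conv c l f (upper l g) (x - 2 ^ l) \<oplus>
        (deformed_conv c l (upper l f) g (x - 2 ^ l) \<oplus> c \<otimes> deformed_conv c l (upper l f) (upper l g) (x - 2 ^ l)))"
      using IH IH' by (intro poly_fun_add poly_fun_shift)
    then show ?thesis
      by (rule poly_fun_cong) (use False in simp)
  qed
qed

text \<open>At \<open>c = 0\<close> the relation is \<open>t * t = 1\<close>, and the deformed
  algebra is the group algebra of the words under \<open>xor\<close>.\<close>

lemma deformed_conv_zero:
  "(\<And>y. y < 2 ^ l \<Longrightarrow> f y \<in> carrier F) \<Longrightarrow> (\<And>y. y < 2 ^ l \<Longrightarrow> g y \<in> carrier F) \<Longrightarrow> x < 2 ^ l \<Longrightarrow>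
   deformed_conv \<zero> l f g x = (\<Oplus>y\<in>{..<2 ^ l}. f y \<otimes> g (xor x y))"
proof (induction l arbitrary: f g x)
  case 0
  then show ?case by (simp add: lessThan_Suc)
next
  case (Suc l)
  have C: "f y \<in> carrier F" "g y \<in> carrier F" "upper l f y \<in> carrier F" "upper l g y \<in> carrier F"
    if "y < 2 ^ l" for y
    using that Suc.prems by (auto simp: upper_def)
  have IH: "deformed_conv \<zero> l f g v = (\<Oplus>y\<in>{..<2 ^ l}. f y \<otimes> g (xor v y))"
     "deformed_conv \<zero> l f (upper l g) v = (\<Oplus>y\<in>{..<2 ^ l}. f y \<otimes> upper l g (xor v y))"
     "deformed_conv \<zero> l (upper l f) g v = (\<Oplus>y\<in>{..<2 ^ l}. upper l f y \<otimes> g (xor v y))"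
     "deformed_conv \<zero> l (upper l f) (upper l g) v = (\<Oplus>y\<in>{..<2 ^ l}. upper l f y \<otimes> upper l g (xor v y))"
     if "v < 2 ^ l" for v
    using that C by (auto intro!: Suc.IH)
  have D: "deformed_conv \<zero> l f (upper l g) v \<in> carrier F" "deformed_conv \<zero> l (upper l f) g v \<in> carrier F"
     "deformed_conv \<zero> l (upper l f) (upper l g) v \<in> carrier F" for v
    using C by (auto intro!: deformed_conv_closed)
  have fg: "f y \<otimes> g (xor x y) \<in> carrier F" if "y < 2 ^ Suc l" for y
    using that Suc.prems xor_add_power(4) [of x "Suc l" y] by auto
  from Suc.prems(3) have "deformed_conv \<zero> (Suc l) f g x = (\<Oplus>y\<in>{..<2 ^ l}. f y \<otimes> g (xor x y)) \<oplus>
       (\<Oplus>y\<in>{..<2 ^ l}. f (y + 2 ^ l) \<otimes> g (xor x (y + 2 ^ l)))"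
  proof (cases rule: less_power_Suc_cases)
    case low
    have "(\<Oplus>y\<in>{..<2 ^ l}. f (y + 2 ^ l) \<otimes> g (xor x (y + 2 ^ l))) =
       (\<Oplus>y\<in>{..<2 ^ l}. upper l f y \<otimes> upper l g (xor x y))"
      using low C by (intro finsum_cong') (auto simp: upper_def xor_add_power)
    then show ?thesis
      using low D [of x] by (simp add: IH)
  next
    case (high v)
    have "(\<Oplus>y\<in>{..<2 ^ l}. f (y + 2 ^ l) \<otimes> g (xor x (y + 2 ^ l))) =
       (\<Oplus>y\<in>{..<2 ^ l}. upper l f y \<otimes> g (xor v y))"
      using high C by (intro finsum_cong') (auto simp: upper_def xor_add_power)
    moreover have "(\<Oplus>y\<in>{..<2 ^ l}. f y \<otimes> g (xor x y)) =
       (\<Oplus>y\<in>{..<2 ^ l}. f y \<otimes> upper l g (xor v y))"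
      using high C by (intro finsum_cong') (auto simp: upper_def xor_add_power)
    ultimately show ?thesis
      using high D [of v] by (simp add: IH [symmetric])
  qed
  then show ?case
    using finsum_lessThan_double [of l "\<lambda>y. f y \<otimes> g (xor x y)"] fg by simp
qed

text \<open>\<open>s \<le> m\<close> keeps the parameters inside the field, and
  \<open>m + 2 \<le> 2 ^ s\<close> supplies enough nodes for degree \<open>m\<close>. In a vanishing
  sum of characteristic 2, the term at \<open>\<zero>\<close> equals the sum of the remaining
  ones.\<close>

lemma deformed_convolution_sum:
  assumes f: "\<And>y. y < 2 ^ m \<Longrightarrow> f y \<in> carrier F" and g: "\<And>y. y < 2 ^ m \<Longrightarrow> g y \<in> carrier F"
    and x: "x \<in> carrier F" and s: "s \<le> m" "m + 2 \<le> 2 ^ s"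
  shows "(\<Oplus>c\<in>{1..<2 ^ s}. undeform c m (\<lambda>u. deform c m f u \<otimes> deform c m g u) x) =
    (\<Oplus>y\<in>carrier F. f y \<otimes> g (x \<oplus> y))"
proof -
  define H where "H c = deformed_conv c m f g x" for c
  have x': "x < 2 ^ m"
    using x by (simp add: carrier_eq)
  have le: "(2::nat) ^ s \<le> 2 ^ m"
    using s by simp
  have U: "{..<2 ^ s} \<subseteq> carrier F"
    using le by (metis carrier_eq lessThan_atLeast0 lessThan_subset_iff)
  have HC: "H c \<in> carrier F" if "c \<in> carrier F" for c
    unfolding H_def using f g that by (intro deformed_conv_closed) auto
  have "finsum F H {..<2 ^ s} = \<zero>"
  proof (rule finsum_subgroup_poly_fun)
    show "poly_fun m H"
      unfolding H_def [abs_def] using f g by (rule poly_fun_deformed_conv)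
    show "c \<oplus> d \<in> {..<2 ^ s}" if "c \<in> {..<2 ^ s}" "d \<in> {..<2 ^ s}" for c d
      using that U by (subst add_eq_xor) (auto simp: xor_add_power)
  qed (use U s in \<open>auto simp: zero_eq_0\<close>)
  moreover have "{..<2 ^ s} = insert \<zero> {1..<2 ^ s}"
    by (auto simp: zero_eq_0)
  moreover have "finsum F H (insert \<zero> {1..<2 ^ s}) = H \<zero> \<oplus> finsum F H {1..<2 ^ s}"
    using U HC by (intro finsum_insert) (auto simp: zero_eq_0 subset_iff)
  moreover have "finsum F H {1..<2 ^ s} \<in> carrier F"
    using U HC by (intro finsum_closed) (auto simp: subset_iff)
  ultimately have sum: "finsum F H {1..<2 ^ s} = H \<zero>"
    using HC by (metis add_eq_zero_iff zero_closed)
  have "(\<Oplus>c\<in>{1..<2 ^ s}. undeform c m (\<lambda>u. deform c m f u \<otimes> deform c m g u) x) = finsum F H {1..<2 ^ s}"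
    using U HC f g x' by (intro finsum_cong') (auto simp: undeform_mult H_def zero_eq_0 subset_iff)
  also have "\<dots> = (\<Oplus>y\<in>{..<2 ^ m}. f y \<otimes> g (xor x y))"
    unfolding sum H_def using f g x' by (rule deformed_conv_zero)
  also have "\<dots> = (\<Oplus>y\<in>carrier F. f y \<otimes> g (x \<oplus> y))"
  proof (rule finsum_cong')
    show "(\<lambda>y. f y \<otimes> g (x \<oplus> y)) \<in> carrier F \<rightarrow> carrier F"
    proof
      fix y assume y: "y \<in> carrier F"
      then have "x \<oplus> y < 2 ^ m"
        using x a_closed by (simp add: carrier_eq)
      then show "f y \<otimes> g (x \<oplus> y) \<in> carrier F"
        using f [of y] g y by (intro m_closed) (simp_all add: carrier_eq)
    qed
  qed (use x in \<open>simp_all add: add_eq_xor carrier_eq lessThan_atLeast0\<close>)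
  finally show ?thesis .
qed

end

section \<open>The locator polynomial by Walsh-Hadamard transforms\<close>

context word_field
begin

text \<open>
  The word 0 is replaced by the field element 1, so that the factor \<open>x + x\<close> drops out of products.
\<close>

definition unit_word :: "nat \<Rightarrow> nat" where
  "unit_word z = (if z = 0 then \<one> else z)"

abbreviation mwht :: "nat \<Rightarrow> (nat \<Rightarrow> nat) \<Rightarrow> nat \<Rightarrow> nat" where
  "mwht \<equiv> bfly (\<otimes>) (\<lambda>a b. a \<otimes> inv b)"

text \<open>Exponents count only modulo the order \<open>2 ^ m - 1\<close> of the multiplicative
  group, and reducing after every butterfly keeps them within \<open>m\<close> bits. The modulus is
  added before the subtraction because subtraction of natural numbers is truncated at 0.\<close>

definition cwht :: "nat \<Rightarrow> (nat \<Rightarrow> nat) \<Rightarrow> nat \<Rightarrow> nat" where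
  "cwht = bfly (\<lambda>a b. (a + b) mod (2 ^ m - 1)) (\<lambda>a b. (a + (2 ^ m - 1) - b) mod (2 ^ m - 1))"

lemma cwht_eq:
  assumes "\<And>y. y < 2 ^ m \<Longrightarrow> f y = nat (z y mod int (2 ^ m - 1))" and "x < 2 ^ m" and "1 \<le> m"
  shows "cwht m f x = nat (wht m z x mod int (2 ^ m - 1))"
proof -
  define M where "M = (2::nat) ^ m - 1"
  have "(2::nat) ^ 1 \<le> 2 ^ m"
    using assms(3) by (intro power_increasing) auto
  then have M: "M > 0"
    by (simp add: M_def)
  have add: "nat ((a + b) mod int M) = (nat (a mod int M) + nat (b mod int M)) mod M" for a b :: int
  proof -
    have "int ((nat (a mod int M) + nat (b mod int M)) mod M) = (a + b) mod int M"
      using M by (simp add: of_nat_mod mod_simps)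
    from arg_cong [OF this, of nat, symmetric] show ?thesis
      by (simp only: nat_int)
  qed
  have diff: "nat ((a - b) mod int M) = (nat (a mod int M) + M - nat (b mod int M)) mod M" for a b :: int
  proof -
    have "nat (b mod int M) \<le> M"
      using M by (simp add: nat_le_iff less_imp_le)
    then have "int ((nat (a mod int M) + M - nat (b mod int M)) mod M) = (a mod int M + int M - b mod int M) mod int M"
      using M by (simp add: of_nat_mod of_nat_diff)
    also have "a mod int M + int M - b mod int M = (a mod int M - b mod int M) + int M"
      by simp
    also have "\<dots> mod int M = (a - b) mod int M"
      by (simp only: mod_add_self2 mod_diff_eq)
    finally show ?thesis
      using nat_int by metis
  qed
  have "cwht m f x = cwht m (\<lambda>y. nat (z y mod int M)) x"
    unfolding cwht_def using assms by (intro bfly_cong) (auto simp: M_def)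
  also have "\<dots> = nat (wht m z x mod int M)"
    unfolding cwht_def M_def [symmetric] using add diff assms(2) by (intro bfly_map [of UNIV]) auto
  finally show ?thesis
    by (simp add: M_def)
qed

section \<open>Discrete exponentials and the values of the locator\<close>

abbreviation nonzeros :: "nat monoid" where
  "nonzeros \<equiv> Multiplicative_Group.mult_of F"

text \<open>The exponents are integers rather than naturals, so that the butterfly
  \<open>a \<otimes> inv b\<close> corresponds to a subtraction and the integer transform can be
  pulled through \<open>ex\<close>.\<close>

lemma exists_exponential:
  obtains ex :: "int \<Rightarrow> nat"
  where "\<And>i. ex i \<in> carrier F" "\<And>i. ex i \<noteq> \<zero>" "\<And>i j. ex (i + j) = ex i \<otimes> ex j"
    "\<And>i j. ex (i - j) = ex i \<otimes> inv (ex j)" "\<And>i n. ex i [^] (n::nat) = ex (i * int n)"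
    "\<And>i k. ex (i + int (2 ^ m - 1) * k) = ex i" "ex 0 = \<one>"
    "\<And>x. x \<in> carrier F \<Longrightarrow> x \<noteq> \<zero> \<Longrightarrow> \<exists>i. x = ex i"
proof -
  interpret G: group "nonzeros"
    by (rule field_mult_group)
  obtain g where g: "g \<in> carrier (nonzeros)" "carrier (nonzeros) = {g [^] i | i::nat. i \<in> UNIV}"
    using finite_field_mult_group_has_gen by auto
  define ex where "ex i = g [^]\<^bsub>nonzeros\<^esub> i" for i :: int
  have c: "ex i \<in> carrier (nonzeros)" for i
    unfolding ex_def by (rule G.int_pow_closed) (rule g)
  have add: "ex (i + j) = ex i \<otimes> ex j" for i j
    using G.int_pow_mult [OF g(1)] by (simp add: ex_def)
  have zero: "ex 0 = \<one>"
    by (simp add: ex_def)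
  have ord: "order (nonzeros) = 2 ^ m - 1"
    by (simp add: order_def card_Diff_singleton carrier_eq zero_eq_0)
  have pow: "ex i [^] n = ex (i * int n)" for i and n :: nat
  proof -
    have "ex i [^] n = ex i [^]\<^bsub>nonzeros\<^esub> int n"
      by (simp add: int_pow_int Multiplicative_Group.nat_pow_mult_of)
    then show ?thesis
      unfolding ex_def by (simp only: G.int_pow_pow [OF g(1)])
  qed
  have per: "ex (int (2 ^ m - 1) * k) = \<one>" for k
    using G.pow_order_eq_1 [OF c [of k]] unfolding ord Multiplicative_Group.nat_pow_mult_of pow by (simp add: mult.commute)
  show thesis
  proof
    show "ex i \<in> carrier F" "ex i \<noteq> \<zero>" for i
      using c [of i] by simp_all
    show "ex (i - j) = ex i \<otimes> inv (ex j)" for i j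
      using G.int_pow_diff [OF g(1), of i j] m_inv_mult_of [OF c [of j]] by (simp add: ex_def)
    show "ex (i + int (2 ^ m - 1) * k) = ex i" for i k
      using c [of i] unfolding add per by simp
    show "\<exists>i. x = ex i" if "x \<in> carrier F" "x \<noteq> \<zero>" for x
    proof -
      have "x \<in> {g [^] i | i::nat. i \<in> UNIV}"
        using that g(2) by auto
      then obtain i :: nat where "x = g [^] i"
        by auto
      then have "x = ex (int i)"
        by (simp add: ex_def int_pow_int Multiplicative_Group.nat_pow_mult_of)
      then show ?thesis ..
    qed
  qed (fact add pow zero)+
qed

text \<open>
  Logarithms to a primitive element reduce this to the integer transform. The factor \<open>2 ^ m\<close> of
  \<open>wht_convolution\<close> is congruent to 1 modulo the group order \<open>2 ^ m - 1\<close>.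
\<close>

lemma nodal_via_wht:
  assumes m: "2 \<le> m" and E: "E \<subseteq> carrier F" and x: "x \<in> carrier F"
  shows "mwht m (\<lambda>u. mwht m unit_word u [^] cwht m (\<lambda>y. of_bool (y \<in> E)) u) x = nodal E x"
proof -
  define M where "M = (2::nat) ^ m - 1"
  \<comment> \<open>For \<open>m = 1\<close> the modulus would be 1 and the indicator value 1 would
    collapse to 0. With \<open>M > 1\<close> both indicator values are their own residues.\<close>
  have "(2::nat) ^ 2 \<le> 2 ^ m"
    using m by (intro power_increasing) auto
  then have M: "M > 1"
    by (simp add: M_def)
  obtain ex :: "int \<Rightarrow> nat" where ex: "\<And>i. ex i \<in> carrier F" "\<And>i. ex i \<noteq> \<zero>" 
    "\<And>i j. ex (i + j) = ex i \<otimes> ex j"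
    "\<And>i j. ex (i - j) = ex i \<otimes> inv (ex j)" "\<And>i n. ex i [^] (n::nat) = ex (i * int n)"
    "\<And>i k. ex (i + int M * k) = ex i" "ex 0 = \<one>"
    and ex_surj: "\<And>x. x \<in> carrier F \<Longrightarrow> x \<noteq> \<zero> \<Longrightarrow> \<exists>i. x = ex i"
    by (rule exists_exponential [folded M_def]) (rule that)
  have "\<exists>i. unit_word z = ex i" if "z < 2 ^ m" for z
    using that one_bounds by (intro ex_surj) (auto simp: unit_word_def carrier_eq zero_eq_0)
  then obtain dl where dl: "\<And>z. z < 2 ^ m \<Longrightarrow> unit_word z = ex (dl z)"
    by metis
  define ind :: "nat \<Rightarrow> int" where "ind y = of_bool (y \<in> E)" for y
  have exmod: "ex i = ex j" if "i mod int M = j mod int M" for i j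
  proof -
    have "int M dvd i - j"
      using that by (simp add: mod_eq_dvd_iff)
    then obtain k where "i = j + int M * k"
      by (metis dvdE diff_add_cancel add.commute)
    then show ?thesis
      using ex(6) by metis
  qed
  have mw: "mwht m (\<lambda>u. ex (f u)) u = ex (wht m f u)" if "u < 2 ^ m" for f u
    using that by (intro bfly_map [of UNIV]) (auto simp: ex(3,4))
  have a: "mwht m unit_word u = ex (wht m dl u)" if "u < 2 ^ m" for u
    using that bfly_cong [of m unit_word "\<lambda>z. ex (dl z)" u] dl mw by metis
  have n: "cwht m (\<lambda>y. of_bool (y \<in> E)) u = nat (wht m ind u mod int M)" if "u < 2 ^ m" for u
  proof (rule cwht_eq [folded M_def])
    show "of_bool (y \<in> E) = nat (ind y mod int M)" for y
      using M by (simp add: ind_def)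
  qed (use that m in auto)
  have "mwht m unit_word u [^] cwht m (\<lambda>y. of_bool (y \<in> E)) u = ex (wht m dl u * wht m ind u)"
    if "u < 2 ^ m" for u
  proof -
    have "ex (wht m dl u * (wht m ind u mod int M)) = ex (wht m dl u * wht m ind u)"
      by (rule exmod) (simp add: mod_mult_right_eq)
    then show ?thesis
      using that M by (simp add: a n ex(5))
  qed
  then have "mwht m (\<lambda>u. mwht m unit_word u [^] cwht m (\<lambda>y. of_bool (y \<in> E)) u) x =
     mwht m (\<lambda>u. ex (wht m dl u * wht m ind u)) x"
    using x by (intro bfly_cong) (auto simp: carrier_eq)
  also have "\<dots> = ex (2 ^ m * (\<Sum>y<2 ^ m. dl (xor x y) * ind y))"
    using x by (simp add: mw wht_convolution carrier_eq)
  also have "\<dots> = ex (\<Sum>y<2 ^ m. dl (xor x y) * ind y)"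
  proof (rule exmod)
    have "(2::int) ^ m = int M + 1"
      by (simp add: M_def of_nat_diff)
    then show "2 ^ m * (\<Sum>y<2 ^ m. dl (xor x y) * ind y) mod int M = (\<Sum>y<2 ^ m. dl (xor x y) * ind y) mod int M"
      by (simp add: distrib_right)
  qed
  also have "\<dots> = (\<Otimes>y\<in>{..<2 ^ m}. ex (dl (xor x y) * ind y))"
  proof -
    have "ex (\<Sum>y\<in>Y. h y) = (\<Otimes>y\<in>Y. ex (h y))" if "finite Y" for Y :: "nat set" and h
      using that by (induction Y rule: finite_induct) (simp_all add: ex Pi_def)
    then show ?thesis
      by simp
  qed
  also have "\<dots> = (\<Otimes>y\<in>E - {x}. x \<oplus> y)"
  proof (rule finprod_mono_neutral_cong_right)
    show "E - {x} \<subseteq> {..<2 ^ m}"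
      using E by (auto simp: carrier_eq)
    have xor: "xor x y < 2 ^ m" "xor x y = x \<oplus> y" if "y < 2 ^ m" for y
      using that x by (auto simp: carrier_eq xor_add_power add_eq_xor)
    have xx: "x \<oplus> x = 0"
      using x by (simp add: zero_eq_0)
    show "ex (dl (xor x y) * ind y) = \<one>" if "y \<in> {..<2 ^ m} - (E - {x})" for y
    proof (cases "y \<in> E")
      case True
      then have y: "y = x" "x < 2 ^ m"
        using that by auto
      then have "ex (dl (xor x x)) = \<one>"
        using dl [of "xor x x"] xor [of x] xx by (simp add: unit_word_def)
      then show ?thesis
        using True y by (simp add: ind_def)
    next
      case False
      then show ?thesis
        by (simp add: ind_def ex)
    qed
    show "ex (dl (xor x y) * ind y) = x \<oplus> y" if "y \<in> E - {x}" for y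
    proof -
      have y: "y < 2 ^ m" "y \<in> carrier F" "y \<in> E" "y \<noteq> x"
        using that E by (auto simp: carrier_eq)
      then have "x \<oplus> y \<noteq> 0"
        using add_eq_zero_iff [OF x y(2)] by (simp add: zero_eq_0)
      then show ?thesis
        using y dl [of "xor x y"] xor by (simp add: ind_def unit_word_def)
    qed
  qed (use ex in auto)
  finally show ?thesis
    by (simp add: nodal_def)
qed

end

section \<open>Symbolic execution and timed triples\<close>

definition For :: "string \<Rightarrow> string \<Rightarrow> prog \<Rightarrow> prog" where
  "For x y c = Seq (Assign x (Const 0))
     (While (Op ILess (Reg x) (Reg y)) (Seq c (Assign x (Op IAdd (Reg x) (Const 1)))))"

definition addr :: "nat \<Rightarrow> expr \<Rightarrow> expr" where
  "addr d e = Op IAdd (Op IMul (Const d) (Reg ''q'')) e"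

definition At :: "nat \<Rightarrow> expr \<Rightarrow> expr" where
  "At d e = Load (addr d e)"

definition Put :: "nat \<Rightarrow> expr \<Rightarrow> expr \<Rightarrow> prog" where
  "Put d i e = Store (addr d i) e"

lemma cost_addr [simp]: "cost (addr d e) = 4 + cost e"
  by (simp add: addr_def)

lemma cost_At [simp]: "cost (At d e) = 5 + cost e"
  by (simp add: At_def)

type_synonym regs = "string \<Rightarrow> nat option"
type_synonym regions = "nat \<Rightarrow> (nat \<Rightarrow> nat) option"

text \<open>The word bound admits every address of the eight regions and the multiples of
  \<open>2 ^ m\<close> formed in computing it; a value reaching \<open>W\<close> would make the
  evaluation undefined.\<close>

locale ram = word_field +
  fixes W :: nat
  assumes W_large: "8 * 2 ^ m < W" and m_pos: "1 \<le> m"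
begin

text \<open>
  The memory is cut into 8 regions of \<open>2 ^ m\<close> cells. A symbolic state records the contents of
  some registers and of some regions; nothing is known about the others.
\<close>

fun St :: "regs \<Rightarrow> regions \<Rightarrow> state \<Rightarrow> bool" where
  "St R A (r, mem) \<longleftrightarrow> (\<forall>x v. R x = Some v \<longrightarrow> r x = v) \<and> length mem = 8 * 2 ^ m \<and>
     (\<forall>d g i. A d = Some g \<longrightarrow> d < 8 \<longrightarrow> i < 2 ^ m \<longrightarrow> mem ! (d * 2 ^ m + i) = g i)"

text \<open>Total correctness: a regular run must exist. The time is an upper bound, so that
  branches of different cost can share a triple.\<close>

definition hoare :: "(state \<Rightarrow> bool) \<Rightarrow> prog \<Rightarrow> nat \<Rightarrow> (state \<Rightarrow> bool) \<Rightarrow> bool" where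
  "hoare P c t Q \<longleftrightarrow> (\<forall>s. P s \<longrightarrow> (\<exists>t' s'. run F W c s t' s' \<and> t' \<le> t \<and> Q s'))"

text \<open>A partial interpreter whose values are logical terms, which turns reasoning about
  expressions into rewriting. \<open>None\<close> stands for a value that is unknown as well as for
  a stuck evaluation.\<close>

fun sym_eval :: "regs \<Rightarrow> regions \<Rightarrow> expr \<Rightarrow> nat option" where
  "sym_eval R A (Const v) = fit W v"
| "sym_eval R A (Reg x) = Option.bind (R x) (fit W)"
| "sym_eval R A (Load e) = Option.bind (sym_eval R A e) (\<lambda>a.
     if a < 8 * 2 ^ m then Option.bind (A (a div 2 ^ m)) (\<lambda>g. fit W (g (a mod 2 ^ m))) else None)"
| "sym_eval R A (Op f d e) = Option.bind (sym_eval R A d) (\<lambda>a. Option.bind (sym_eval R A e) (\<lambda>b.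
     Option.bind (apply_op F f a b) (fit W)))"

lemma addr_less: "d < 8 \<Longrightarrow> j < 2 ^ m \<Longrightarrow> d * 2 ^ m + j < 8 * 2 ^ m" for d :: nat
proof -
  assume "d < 8" "j < 2 ^ m"
  then have "d * 2 ^ m + j < Suc d * 2 ^ m"
    by simp
  also have "\<dots> \<le> 8 * 2 ^ m"
    using \<open>d < 8\<close> by (intro mult_le_mono1) simp
  finally show ?thesis .
qed

lemma St_D:
  assumes "St R A (r, mem)"
  shows "R x = Some v \<Longrightarrow> r x = v" and "length mem = 8 * 2 ^ m"
    and "A d = Some g \<Longrightarrow> d < 8 \<Longrightarrow> i < 2 ^ m \<Longrightarrow> mem ! (d * 2 ^ m + i) = g i"
  using assms unfolding St.simps by blast+

lemma St_I:
  assumes "\<And>x v. R x = Some v \<Longrightarrow> r x = v" "length mem = 8 * 2 ^ m"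
    and "\<And>d g i. A d = Some g \<Longrightarrow> d < 8 \<Longrightarrow> i < 2 ^ m \<Longrightarrow> mem ! (d * 2 ^ m + i) = g i"
  shows "St R A (r, mem)"
  using assms unfolding St.simps by blast

lemma St_store:
  assumes St: "St R A (r, mem)" and a: "a < 8 * 2 ^ m" "A (a div 2 ^ m) = Some g"
  shows "St R (A(a div 2 ^ m \<mapsto> g(a mod 2 ^ m := v))) (r, mem[a := v])"
proof (rule St_I)
  fix d i :: nat and g'
  assume d: "(A(a div 2 ^ m \<mapsto> g(a mod 2 ^ m := v))) d = Some g'" "d < 8" "i < 2 ^ m"
  then have i: "(d * 2 ^ m + i) div 2 ^ m = d" "(d * 2 ^ m + i) mod 2 ^ m = i"
    by simp_all
  show "mem[a := v] ! (d * 2 ^ m + i) = g' i"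
  proof (cases "d * 2 ^ m + i = a")
    case True
    then have "d = a div 2 ^ m" "i = a mod 2 ^ m"
      using i by simp_all
    moreover have "mem[a := v] ! a = v"
      using a(1) St_D(2) [OF St] by simp
    ultimately show ?thesis
      using d(1) True by auto
  next
    case False
    then have ne: "d \<noteq> a div 2 ^ m \<or> i \<noteq> a mod 2 ^ m"
      by (metis div_mult_mod_eq)
    have "\<exists>g''. A d = Some g'' \<and> g' i = g'' i"
      using d(1) a(2) ne by (auto split: if_splits)
    then obtain g'' where "A d = Some g''" "g' i = g'' i"
      by blast
    then show ?thesis
      using False St_D(3) [OF St _ d(2,3)] by simp
  qed
qed (use St_D [OF St] in auto)

lemma sym_eval_sound:
  assumes "St R A s"
  shows "sym_eval R A e = Some v \<Longrightarrow> eval_expr F W s e = Some v"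
proof (induction e arbitrary: v)
  case (Load e)
  obtain r mem where s: "s = (r, mem)"
    by (cases s)
  from Load.prems obtain a g where a: "sym_eval R A e = Some a" "a < 8 * 2 ^ m" "A (a div 2 ^ m) = Some g"
      "fit W (g (a mod 2 ^ m)) = Some v"
    by (auto simp: bind_eq_Some_conv split: if_splits)
  have "a div 2 ^ m < 8"
    using a(2) by (simp add: less_mult_imp_div_less)
  then have "mem ! (a div 2 ^ m * 2 ^ m + a mod 2 ^ m) = g (a mod 2 ^ m)"
    using St_D(3) [OF assms [unfolded s] a(3)] by simp
  then have "mem ! a = g (a mod 2 ^ m)"
    by (simp only: div_mult_mod_eq)
  then show ?case
    using a Load.IH [OF a(1)] St_D(2) [OF assms [unfolded s]] by (simp add: s)
qed (use assms in \<open>cases s; auto simp: bind_eq_Some_conv\<close>)+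

lemma sym_eval_mono:
  assumes "R \<subseteq>\<^sub>m R'"
  shows "sym_eval R A e = Some v \<Longrightarrow> sym_eval R' A e = Some v"
proof (induction e arbitrary: v)
  case (Reg x)
  then obtain w where "R x = Some w" "fit W w = Some v"
    by (auto simp: bind_eq_Some_conv)
  moreover from this have "R' x = Some w"
    using assms by (metis domI map_le_def)
  ultimately show ?case
    by simp
qed (auto simp: bind_eq_Some_conv simp del: apply_op.simps split: if_splits)

text \<open>Without loops, and with all conditions decided by the symbolic state, the running time
  is exact. Loops are left to \<open>hoare_for\<close>.\<close>

fun sym_exec :: "prog \<Rightarrow> regs \<times> regions \<Rightarrow> (nat \<times> regs \<times> regions) option" where
  "sym_exec Skip (R, A) = Some (1, R, A)"
| "sym_exec (Assign x e) (R, A) = Option.bind (sym_eval R A e) (\<lambda>v. Some (Suc (cost e), R(x \<mapsto> v), A))"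
| "sym_exec (Store d e) (R, A) = Option.bind (sym_eval R A d) (\<lambda>a. Option.bind (sym_eval R A e) (\<lambda>v.
     if a < 8 * 2 ^ m then Option.bind (A (a div 2 ^ m)) (\<lambda>g.
       Some (Suc (cost d + cost e), R, A(a div 2 ^ m \<mapsto> g(a mod 2 ^ m := v)))) else None))"
| "sym_exec (Seq c1 c2) (R, A) = Option.bind (sym_exec c1 (R, A)) (\<lambda>(t1, RA).
     Option.bind (sym_exec c2 RA) (\<lambda>(t2, RA'). Some (t1 + t2, RA')))"
| "sym_exec (Cond e c1 c2) (R, A) = Option.bind (sym_eval R A e) (\<lambda>v.
     Option.bind (sym_exec (if v \<noteq> 0 then c1 else c2) (R, A)) (\<lambda>(t, RA). Some (Suc (cost e + t), RA)))"
| "sym_exec (While e c) RA = None"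

lemma sym_exec_sound:
  "sym_exec c (R, A) = Some (t, R', A') \<Longrightarrow> St R A s \<Longrightarrow> \<exists>s'. run F W c s t s' \<and> St R' A' s'"
proof (induction c arbitrary: R A t R' A' s)
  case Skip
  then have "t = 1" "R' = R" "A' = A"
    by simp_all
  then show ?case
    using run_Skip [of F W s] Skip.prems(2) by blast
next
  case (Assign x e)
  obtain r mem where s: "s = (r, mem)"
    by (cases s)
  from Assign.prems(1) obtain v where v: "sym_eval R A e = Some v" "t = Suc (cost e)" "R' = R(x \<mapsto> v)" "A' = A"
    by (auto simp: bind_eq_Some_conv)
  have "run F W (Assign x e) s t (r(x := v), mem)"
    using sym_eval_sound [OF Assign.prems(2) v(1)] unfolding s v(2) by (rule run_Assign)
  moreover have "St R' A' (r(x := v), mem)"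
    using Assign.prems(2) v unfolding s by auto
  ultimately show ?case
    by blast
next
  case (Store d e)
  obtain r mem where s: "s = (r, mem)"
    by (cases s)
  obtain a where a1: "sym_eval R A d = Some a"
    using Store.prems(1) by (cases "sym_eval R A d") simp_all
  obtain v where a2: "sym_eval R A e = Some v"
    using Store.prems(1) a1 by (cases "sym_eval R A e") simp_all
  have a3: "a < 8 * 2 ^ m"
    using Store.prems(1) a1 a2 by (simp split: if_splits)
  obtain g where a4: "A (a div 2 ^ m) = Some g"
    using Store.prems(1) a1 a2 a3 by (cases "A (a div 2 ^ m)") simp_all
  have a5: "t = Suc (cost d + cost e)" "R' = R" "A' = A(a div 2 ^ m \<mapsto> g(a mod 2 ^ m := v))"
    using Store.prems(1) a1 a2 a3 a4 by simp_all
  note a = a1 a2 a3 a4 a5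
  have "run F W (Store d e) (r, mem) t (r, mem[a := v])"
    unfolding a(5)
  proof (rule run_Store)
    show "eval_expr F W (r, mem) d = Some a" "eval_expr F W (r, mem) e = Some v"
      by (rule sym_eval_sound [OF Store.prems(2) [unfolded s]], rule a)+
    show "a < length mem"
      using a(3) St_D(2) [OF Store.prems(2) [unfolded s]] by simp
  qed
  moreover have "St R' A' (r, mem[a := v])"
    using St_store [OF Store.prems(2) [unfolded s] a(3,4)] unfolding a(6,7) .
  ultimately show ?case
    unfolding s by blast
next
  case (Seq c1 c2)
  from Seq.prems(1) obtain t1 R1 A1 t2 where *:
    "sym_exec c1 (R, A) = Some (t1, R1, A1)" "sym_exec c2 (R1, A1) = Some (t2, R', A')" "t = t1 + t2"
    by (auto simp: bind_eq_Some_conv)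
  obtain s1 where 1: "run F W c1 s t1 s1" "St R1 A1 s1"
    using Seq.IH(1) [OF *(1) Seq.prems(2)] by blast
  obtain s2 where 2: "run F W c2 s1 t2 s2" "St R' A' s2"
    using Seq.IH(2) [OF *(2) 1(2)] by blast
  show ?case
    using run_Seq [OF 1(1) 2(1)] 2(2) unfolding *(3) by blast
next
  case (Cond e c1 c2)
  from Cond.prems(1) obtain v t1 where v: "sym_eval R A e = Some v"
    and t: "sym_exec (if v \<noteq> 0 then c1 else c2) (R, A) = Some (t1, R', A')" "t = Suc (cost e + t1)"
    by (auto simp: bind_eq_Some_conv simp del: sym_exec.simps(1,2,3,4) split del: if_split)
  have e: "eval_expr F W s e = Some v"
    using Cond.prems(2) v by (rule sym_eval_sound)
  show ?case
  proof (cases "v = 0")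
    case True
    then obtain s' where "run F W c2 s t1 s'" "St R' A' s'"
      using Cond.IH(2) [OF _ Cond.prems(2), of t1 R' A'] t(1) by auto
    then show ?thesis
      using run_Cond_false [of F W s e c2 t1 s' c1] e True unfolding t(2) by blast
  next
    case False
    then obtain s' where "run F W c1 s t1 s'" "St R' A' s'"
      using Cond.IH(1) [OF _ Cond.prems(2), of t1 R' A'] t(1) by auto
    then show ?thesis
      using run_Cond_true [OF e False] unfolding t(2) by blast
  qed
next
  case (While e c)
  then show ?case
    by simp
qed

text \<open>The weakening order: the smaller side knows less. Contents are total functions, so they
  are compared only at the cells that exist.\<close>

definition region_le :: "regions \<Rightarrow> regions \<Rightarrow> bool" (infix "\<preceq>" 50) where
  "A \<preceq> A' \<longleftrightarrow> (\<forall>d g. A d = Some g \<longrightarrow> (\<exists>g'. A' d = Some g' \<and> (\<forall>i<2 ^ m. g i = g' i)))"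

lemma region_le_refl [simp]: "A \<preceq> A"
  by (simp add: region_le_def)

lemma region_le_upd: "(\<And>i. i < 2 ^ m \<Longrightarrow> g i = g' i) \<Longrightarrow> A \<preceq> A' \<Longrightarrow> A(d \<mapsto> g) \<preceq> A'(d \<mapsto> g')"
  by (auto simp: region_le_def)

lemma region_le_upd_left: "A' d = Some g' \<Longrightarrow> (\<And>i. i < 2 ^ m \<Longrightarrow> g i = g' i) \<Longrightarrow> A \<preceq> A' \<Longrightarrow> A(d \<mapsto> g) \<preceq> A'"
  by (auto simp: region_le_def)

lemma St_mono: "St R A s \<Longrightarrow> R' \<subseteq>\<^sub>m R \<Longrightarrow> A' \<preceq> A \<Longrightarrow> St R' A' s"
  by (cases s) (fastforce simp: map_le_def region_le_def dom_def)

section \<open>Rules for timed triples\<close>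

lemma hoare_sym_exec:
  assumes "sym_exec c (R, A) = Some (t', R1, A1)" "t' \<le> t" "R' \<subseteq>\<^sub>m R1" "A' \<preceq> A1"
  shows "hoare (St R A) c t (St R' A')"
  unfolding hoare_def using sym_exec_sound [OF assms(1)] assms(2-) St_mono by blast

lemma hoare_seq:
  "hoare P c1 t1 Q \<Longrightarrow> hoare Q c2 t2 Q' \<Longrightarrow> hoare P (Seq c1 c2) (t1 + t2) Q'"
  unfolding hoare_def by (meson add_mono run_Seq)

lemma hoare_time: "hoare P c t Q \<Longrightarrow> t \<le> t' \<Longrightarrow> hoare P c t' Q"
  unfolding hoare_def by (meson le_trans)

lemma hoare_mono:
  assumes "hoare (St R A) c t (St R' A')" "R \<subseteq>\<^sub>m R1" "A \<preceq> A1" "R1' \<subseteq>\<^sub>m R'" "A1' \<preceq> A'" "t \<le> t'"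
  shows "hoare (St R1 A1) c t' (St R1' A1')"
  using assms unfolding hoare_def by (meson St_mono le_trans)

lemma hoare_cond:
  assumes "sym_eval R A e = Some v" "v \<noteq> 0 \<Longrightarrow> hoare (St R A) c1 t Q" "v = 0 \<Longrightarrow> hoare (St R A) c2 t Q"
  shows "hoare (St R A) (Cond e c1 c2) (Suc (cost e + t)) Q"
  unfolding hoare_def
proof (intro allI impI)
  fix s assume s: "St R A s"
  have e: "eval_expr F W s e = Some v"
    using sym_eval_sound [OF s assms(1)] .
  show "\<exists>t' s'. run F W (Cond e c1 c2) s t' s' \<and> t' \<le> Suc (cost e + t) \<and> Q s'"
  proof (cases "v = 0")
    case True
    then obtain t' s' where "run F W c2 s t' s'" "t' \<le> t" "Q s'"
      using assms(3) s unfolding hoare_def by blast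
    then show ?thesis
      using e True by (intro exI [of _ "Suc (cost e + t')"] exI [of _ s']) (auto intro: run_Cond_false)
  next
    case False
    then obtain t' s' where "run F W c1 s t' s'" "t' \<le> t" "Q s'"
      using assms(2) s unfolding hoare_def by blast
    then show ?thesis
      using e False by (intro exI [of _ "Suc (cost e + t')"] exI [of _ s']) (auto intro: run_Cond_true)
  qed
qed

text \<open>
  A region with unknown contents may be given a name before it is overwritten cell by cell.
\<close>

lemma hoare_region:
  assumes "\<And>g. hoare (St R (A(d \<mapsto> g))) c t Q"
  shows "hoare (St R A) c t Q"
  unfolding hoare_def
proof (intro allI impI)
  fix s assume s: "St R A s"
  obtain r mem where rm: "s = (r, mem)"
    by (cases s)
  have "St R (A(d \<mapsto> \<lambda>i. mem ! (d * 2 ^ m + i))) s"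
    using s unfolding rm by auto
  then show "\<exists>t' s'. run F W c s t' s' \<and> t' \<le> t \<and> Q s'"
    using assms unfolding hoare_def by blast
qed

text \<open>\<open>R i\<close> and \<open>A i\<close> describe the state before round
  \<open>i\<close>. The body has to preserve the counter, and the counter is forgotten at the exit.
  Each round adds 4 for the test and 4 for the increment; the initialization and the last test add 2
  and 4.\<close>

lemma hoare_for:
  assumes body: "\<And>i. i < n \<Longrightarrow> hoare (St ((R i)(x \<mapsto> i)) (A i)) c t (St ((R (Suc i))(x \<mapsto> i)) (A (Suc i)))"
    and R: "\<And>i. i \<le> n \<Longrightarrow> R i y = Some n" "R n x = None" and xy: "x \<noteq> y" and n: "n < W"
  shows "hoare (St (R 0) (A 0)) (For x y c) (n * (t + 8) + 6) (St (R n) (A n))"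
proof -
  let ?b = "Op ILess (Reg x) (Reg y)" and ?i = "Assign x (Op IAdd (Reg x) (Const 1))"
  have W: "1 < W"
  proof -
    have "(1::nat) \<le> 2 ^ m"
      by simp
    then show ?thesis
      using W_large by linarith
  qed
  have test: "sym_eval ((R i)(x \<mapsto> i)) A' ?b = Some (of_bool (i < n))" if "i \<le> n" for i A'
    using R(1) that n W xy by (auto simp: fit_def)
  have loop: "\<exists>t' s'. run F W (While ?b (Seq c ?i)) s t' s' \<and> t' \<le> (n - i) * (t + 8) + 4 \<and> St (R n) (A n) s'"
    if "i \<le> n" "St ((R i)(x \<mapsto> i)) (A i) s" for i s
    using that
  proof (induction "n - i" arbitrary: i s)
    case 0
    then have i: "i = n"
      by simp
    have "R n \<subseteq>\<^sub>m (R n)(x \<mapsto> n)"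
      using R(2) by (auto simp: map_le_def)
    then have "St (R n) (A n) s"
      using 0 St_mono unfolding i by (meson region_le_refl)
    moreover have "eval_expr F W s ?b = Some 0"
      using sym_eval_sound [OF 0(3) test [OF 0(2)]] by (simp only: i) simp
    then have "run F W (While ?b (Seq c ?i)) s (Suc (cost ?b)) s"
      by (rule run_While_false)
    ultimately show ?case
      by (intro exI [of _ "Suc (cost ?b)"] exI [of _ s]) simp
  next
    case (Suc k)
    then have i: "i < n"
      by simp
    obtain t1 s1 where c: "run F W c s t1 s1" "t1 \<le> t" "St ((R (Suc i))(x \<mapsto> i)) (A (Suc i)) s1"
      using body [OF i] Suc.prems(2) unfolding hoare_def by blast
    have "sym_exec ?i ((R (Suc i))(x \<mapsto> i), A (Suc i)) = Some (4, (R (Suc i))(x \<mapsto> Suc i), A (Suc i))"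
      using i n W by (simp add: fit_def)
    from sym_exec_sound [OF this c(3)] obtain s2
      where s2: "run F W ?i s1 4 s2" "St ((R (Suc i))(x \<mapsto> Suc i)) (A (Suc i)) s2"
      by blast
    obtain t3 s3 where s3: "run F W (While ?b (Seq c ?i)) s2 t3 s3" "t3 \<le> (n - Suc i) * (t + 8) + 4"
      "St (R n) (A n) s3"
    proof -
      have "k = n - Suc i" "Suc i \<le> n"
        using Suc.hyps(2) i by simp_all
      then show thesis
        using Suc.hyps(1) [OF _ _ s2(2)] that by blast
    qed
    have "eval_expr F W s ?b = Some 1"
      using sym_eval_sound [OF Suc.prems(2) test] i by simp
    then have "run F W (While ?b (Seq c ?i)) s (Suc (cost ?b + (t1 + 4) + t3)) s3"
      by (rule run_While_true) (use c s2 s3 in \<open>auto intro: run_Seq\<close>)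
    moreover have "Suc (cost ?b + (t1 + 4) + t3) \<le> (n - i) * (t + 8) + 4"
    proof -
      have "n - i = Suc (n - Suc i)"
        using i by simp
      then have "(n - i) * (t + 8) = (t + 8) + (n - Suc i) * (t + 8)"
        by simp
      then show ?thesis
        using c(2) s3(2) by simp
    qed
    ultimately show ?case
      using s3(3) by blast
  qed
  show ?thesis
    unfolding hoare_def
  proof (intro allI impI)
    fix s assume s: "St (R 0) (A 0) s"
    have "sym_exec (Assign x (Const 0)) (R 0, A 0) = Some (2, (R 0)(x \<mapsto> 0), A 0)"
      using W by (simp add: fit_def)
    from sym_exec_sound [OF this s] obtain s1
      where s1: "run F W (Assign x (Const 0)) s 2 s1" "St ((R 0)(x \<mapsto> 0)) (A 0) s1"
      by blast
    obtain t2 s2 where t2: "run F W (While ?b (Seq c ?i)) s1 t2 s2" "t2 \<le> n * (t + 8) + 4" "St (R n) (A n) s2"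
      using loop [OF le0 s1(2)] by (metis minus_nat.diff_0)
    have "run F W (For x y c) s (2 + t2) s2"
      unfolding For_def using s1(1) t2(1) by (rule run_Seq)
    then show "\<exists>t' s'. run F W (For x y c) s t' s' \<and> t' \<le> n * (t + 8) + 6 \<and> St (R n) (A n) s'"
      using t2 by (intro exI [of _ "2 + t2"] exI [of _ s2]) simp
  qed
qed

lemma fit_small [simp]: "v < 2 ^ m \<Longrightarrow> fit W v = Some v" "v \<le> 8 * 2 ^ m \<Longrightarrow> fit W v = Some v"
  using W_large by (auto simp: fit_def)

lemma sym_eval_addr:
  assumes "R ''q'' = Some (2 ^ m)" "sym_eval R A e = Some j" "j < 2 ^ m" "d < 8"
  shows "sym_eval R A (addr d e) = Some (d * 2 ^ m + j)"
proof -
  have "d * 2 ^ m + j < 8 * 2 ^ m" "d * 2 ^ m < 8 * 2 ^ m" "(2::nat) ^ m \<le> 8 * 2 ^ m" "(8::nat) \<le> 8 * 2 ^ m"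
    using addr_less [of d j] addr_less [of d 0] assms by auto
  then show ?thesis
    using assms by (simp add: addr_def)
qed

lemma sym_eval_At [simp]:
  assumes "R ''q'' = Some (2 ^ m)" "sym_eval R A e = Some j" "j < 2 ^ m" "d < 8" "A d = Some g"
  shows "sym_eval R A (At d e) = fit W (g j)"
  using assms addr_less [of d j] by (simp add: At_def sym_eval_addr)

lemma sym_exec_Put [simp]:
  assumes "R ''q'' = Some (2 ^ m)" "sym_eval R A i = Some j" "j < 2 ^ m" "d < 8" "A d = Some g"
    "sym_eval R A e = Some v"
  shows "sym_exec (Put d i e) (R, A) = Some (5 + cost i + cost e, R, A(d \<mapsto> g(j := v)))"
  using assms addr_less [of d j] by (simp add: Put_def sym_eval_addr cost_addr)

end

section \<open>Verified loops\<close>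

lemma bit_add_power:
  fixes i :: nat
  shows "bit (i + 2 ^ l) l \<longleftrightarrow> \<not> bit i l"
  by (simp add: bit_iff_odd)

lemma not_bit_diff_power:
  fixes j :: nat
  assumes "bit j l"
  shows "\<not> bit (j - 2 ^ l) l"
  using assms bit_add_power [of "j - 2 ^ l" l] power_le_of_bit [OF assms] by simp

text \<open>\<open>i div 2 ^ l\<close> is even and smaller than the even number
  \<open>2 ^ (m - l)\<close>, so its successor is smaller as well.\<close>

lemma add_power_less:
  fixes i :: nat
  assumes "i < 2 ^ m" "l < m" "\<not> bit i l"
  shows "i + 2 ^ l < 2 ^ m"
proof -
  obtain k where m: "m = l + Suc k"
    using assms(2) less_imp_Suc_add by auto
  have "i div 2 ^ l < 2 ^ Suc k"
    using assms(1) unfolding m power_add by (simp add: less_mult_imp_div_less mult.commute)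
  moreover have "even (i div 2 ^ l)" "even ((2::nat) ^ Suc k)"
    using assms(3) by (simp_all add: bit_iff_odd)
  ultimately have "Suc (i div 2 ^ l) < 2 ^ Suc k"
    by (metis Suc_lessI even_Suc)
  then have "(i + 2 ^ l) div 2 ^ l < 2 ^ Suc k"
    by simp
  then have "i + 2 ^ l < 2 ^ Suc k * 2 ^ l"
    by (subst (asm) div_less_iff_less_mult) simp_all
  then show ?thesis
    by (simp only: m power_add mult.commute)
qed

definition pass :: "nat \<Rightarrow> expr \<Rightarrow> prog" where
  "pass d e = For ''i'' ''q'' (Put d (Reg ''i'') e)"

text \<open>Only indices with bit \<open>l\<close> clear act, so each pair is treated once. Both
  values are loaded before either cell is overwritten, which makes the transform work in place.
  Register \<open>h\<close> holds \<open>2 ^ l\<close>.\<close>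

definition butterfly :: "nat \<Rightarrow> expr \<Rightarrow> expr \<Rightarrow> prog" where
  "butterfly d e1 e2 = Seq (Assign ''h'' (Const 1)) (For ''l'' ''m''
     (Seq
       (For ''i'' ''q'' (Cond (Op IBit (Reg ''i'') (Reg ''l'')) Skip
         (Seq (Assign ''u'' (At d (Reg ''i'')))
         (Seq (Assign ''v'' (At d (Op IAdd (Reg ''i'') (Reg ''h''))))
         (Seq (Put d (Reg ''i'') e1)
              (Put d (Op IAdd (Reg ''i'') (Reg ''h'')) e2))))))
       (Assign ''h'' (Op IAdd (Reg ''h'') (Reg ''h'')))))"

definition pointwise_power :: prog where
  "pointwise_power = For ''i'' ''q''
     (Seq (Assign ''b'' (At 5 (Reg ''i'')))
     (Seq (Assign ''e'' (At 4 (Reg ''i'')))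
     (Seq (Assign ''p'' (Reg ''o''))
     (Seq
       (For ''l'' ''m'' (Seq
         (Cond (Op IBit (Reg ''e'') (Reg ''l'')) (Assign ''p'' (Op FMul (Reg ''p'') (Reg ''b''))) Skip)
         (Assign ''b'' (Op FMul (Reg ''b'') (Reg ''b'')))))
       (Put 5 (Reg ''i'') (Reg ''p''))))))"

context ram
begin

lemma m_less: "m < 2 ^ m"
  by (rule less_exp)

lemma one_less_W: "1 < W" "m < W" "2 ^ m < W" "0 < W"
proof -
  have "(1::nat) \<le> 2 ^ m"
    by simp
  then show "1 < W" "m < W" "2 ^ m < W" "0 < W"
    using W_large m_less by linarith+
qed

lemma hoare_sym_exec_exact: "sym_exec c (R, A) = Some (t, R', A') \<Longrightarrow> hoare (St R A) c t (St R' A')"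
  by (rule hoare_sym_exec, assumption) simp_all

text \<open>During the pass region \<open>d\<close> is partly overwritten. The expression may
  therefore rely on the old contents only at the current index, hence the quantification over all
  \<open>g'\<close> that agree with \<open>g\<close> there.\<close>

lemma hoare_pass:
  assumes R: "R ''q'' = Some (2 ^ m)" "R ''i'' = None" and d: "d < 8"
    and e: "\<And>i g'. i < 2 ^ m \<Longrightarrow> g' i = g i \<Longrightarrow> sym_eval (R(''i'' \<mapsto> i)) (A(d \<mapsto> g')) e = Some (f i)"
  shows "hoare (St R (A(d \<mapsto> g))) (pass d e) (2 ^ m * (cost e + 14) + 6) (St R (A(d \<mapsto> f)))"
proof -
  define G where "G i j = (if j < i then f j else g j)" for i j
  have "hoare (St R (A(d \<mapsto> G 0))) (pass d e) (2 ^ m * (cost e + 6 + 8) + 6) (St R (A(d \<mapsto> G (2 ^ m))))"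
    unfolding pass_def
  proof (rule hoare_for [where R = "\<lambda>_. R" and A = "\<lambda>i. A(d \<mapsto> G i)"])
    fix i :: nat assume i: "i < 2 ^ m"
    show "hoare (St (R(''i'' \<mapsto> i)) (A(d \<mapsto> G i))) (Put d (Reg ''i'') e) (cost e + 6)
        (St (R(''i'' \<mapsto> i)) (A(d \<mapsto> G (Suc i))))"
    proof (rule hoare_sym_exec)
      show "sym_exec (Put d (Reg ''i'') e) (R(''i'' \<mapsto> i), A(d \<mapsto> G i)) =
          Some (5 + cost (Reg ''i'') + cost e, R(''i'' \<mapsto> i), (A(d \<mapsto> G i))(d \<mapsto> (G i)(i := f i)))"
        using R d i by (intro sym_exec_Put e) (simp_all add: G_def)
      show "A(d \<mapsto> G (Suc i)) \<preceq> (A(d \<mapsto> G i))(d \<mapsto> (G i)(i := f i))"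
        by (simp, rule region_le_upd) (auto simp: G_def)
    qed simp_all
  qed (use R one_less_W in simp_all)
  then show ?thesis
    by (rule hoare_mono) (auto intro!: region_le_upd simp: G_def)
qed

text \<open>\<open>V\<close> is an invariant set of values on which both expressions are defined:
  the nonzero elements for quotients, all field elements for the deformed transforms, and the
  numbers up to \<open>2 ^ m - 1\<close> for exponents.\<close>

lemma hoare_butterfly_level:
  assumes R: "R ''q'' = Some (2 ^ m)" "R ''l'' = Some l" "R ''h'' = Some (2 ^ l)"
      "R ''i'' = None" "R ''u'' = None" "R ''v'' = None"
    and d: "d < 8" and l: "l < m" and V: "\<And>a. a \<in> V \<Longrightarrow> a < 2 ^ m"
    and e1: "\<And>a b i A. a \<in> V \<Longrightarrow> b \<in> V \<Longrightarrow> sym_eval (R(''i'' \<mapsto> i, ''u'' \<mapsto> a, ''v'' \<mapsto> b)) A e1 = Some (f1 a b)"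
    and e2: "\<And>a b i A. a \<in> V \<Longrightarrow> b \<in> V \<Longrightarrow> sym_eval (R(''i'' \<mapsto> i, ''u'' \<mapsto> a, ''v'' \<mapsto> b)) A e2 = Some (f2 a b)"
    and g: "\<And>i. i < 2 ^ m \<Longrightarrow> g i \<in> V"
  shows "hoare (St R (A(d \<mapsto> g)))
     (For ''i'' ''q'' (Cond (Op IBit (Reg ''i'') (Reg ''l'')) Skip
         (Seq (Assign ''u'' (At d (Reg ''i'')))
         (Seq (Assign ''v'' (At d (Op IAdd (Reg ''i'') (Reg ''h''))))
         (Seq (Put d (Reg ''i'') e1)
              (Put d (Op IAdd (Reg ''i'') (Reg ''h'')) e2))))))
     (2 ^ m * (cost e1 + cost e2 + 50) + 6) (St R (A(d \<mapsto> level f1 f2 l g)))"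
proof -
  \<comment> \<open>The lower index of the pair containing \<open>j\<close>. A cell is final once
    the loop has passed this index, even if the cell itself lies ahead.\<close>
  define low where "low j = (if bit j l then j - 2 ^ l else j)" for j :: nat
  define G where "G i j = (if low j < i then level f1 f2 l g j else g j)" for i j
  let ?c = "Cond (Op IBit (Reg ''i'') (Reg ''l'')) Skip
         (Seq (Assign ''u'' (At d (Reg ''i'')))
         (Seq (Assign ''v'' (At d (Op IAdd (Reg ''i'') (Reg ''h''))))
         (Seq (Put d (Reg ''i'') e1)
              (Put d (Op IAdd (Reg ''i'') (Reg ''h'')) e2))))"
  have low: "low j = i \<longleftrightarrow> j = i \<or> j = i + 2 ^ l" if "\<not> bit i l" for i j
    using that power_le_of_bit [of j l] by (auto simp: low_def bit_add_power)
  have not_bit_low: "\<not> bit (low j) l" for j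
    by (simp add: low_def not_bit_diff_power)
  have l_less: "l < 2 ^ m" "(2::nat) ^ l < 2 ^ m"
    using l m_less by (auto intro: less_trans)
  have "hoare (St R (A(d \<mapsto> G 0))) (For ''i'' ''q'' ?c) (2 ^ m * (cost e1 + cost e2 + 42 + 8) + 6)
      (St R (A(d \<mapsto> G (2 ^ m))))"
  proof (rule hoare_for [where R = "\<lambda>_. R" and A = "\<lambda>i. A(d \<mapsto> G i)"])
    fix i :: nat assume i: "i < 2 ^ m"
    let ?R = "R(''i'' \<mapsto> i)"
    show "hoare (St ?R (A(d \<mapsto> G i))) ?c (cost e1 + cost e2 + 42) (St ?R (A(d \<mapsto> G (Suc i))))"
    proof (cases "bit i l")
      case True
      have test: "sym_eval ?R (A(d \<mapsto> G i)) (Op IBit (Reg ''i'') (Reg ''l'')) = Some 1"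
        using R i l_less True one_less_W by simp
      show ?thesis
      proof (rule hoare_sym_exec)
        show "sym_exec ?c (?R, A(d \<mapsto> G i)) = Some (5, ?R, A(d \<mapsto> G i))"
          by (simp add: test del: sym_eval.simps(4))
        have "G (Suc i) = G i"
          using not_bit_low True by (force simp: G_def less_Suc_eq)
        then show "A(d \<mapsto> G (Suc i)) \<preceq> A(d \<mapsto> G i)"
          by simp
      qed simp_all
    next
      case False
      define a b where "a = g i" "b = g (i + 2 ^ l)"
      have il: "i + 2 ^ l < 2 ^ m"
        using add_power_less i l False by blast
      have ab: "a \<in> V" "b \<in> V"
        using g i il by (simp_all add: a_b_def)
      have Gi: "G i i = a" "G i (i + 2 ^ l) = b"
        using low [OF False, of i] low [OF False, of "i + 2 ^ l"] by (simp_all add: G_def a_b_def)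
      have test: "sym_eval ?R A' (Op IBit (Reg ''i'') (Reg ''l'')) = Some 0" for A'
        using R i l_less False one_less_W by simp
      let ?R2 = "?R(''u'' \<mapsto> a, ''v'' \<mapsto> b)"
      let ?A1 = "A(d \<mapsto> (G i)(i := f1 a b))"
      let ?A2 = "A(d \<mapsto> (G i)(i := f1 a b, i + 2 ^ l := f2 a b))"
      have u: "sym_exec (Assign ''u'' (At d (Reg ''i''))) (?R, A(d \<mapsto> G i)) = Some (7, ?R(''u'' \<mapsto> a), A(d \<mapsto> G i))"
        using R d i Gi V [OF ab(1)] by simp
      have v: "sym_exec (Assign ''v'' (At d (Op IAdd (Reg ''i'') (Reg ''h'')))) (?R(''u'' \<mapsto> a), A(d \<mapsto> G i)) =
          Some (9, ?R2, A(d \<mapsto> G i))"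
        using R d i il l_less Gi V [OF ab(2)] by simp
      have p1: "sym_exec (Put d (Reg ''i'') e1) (?R2, A(d \<mapsto> G i)) = Some (6 + cost e1, ?R2, ?A1)"
        using R d i e1 [OF ab] by simp
      have p2: "sym_exec (Put d (Op IAdd (Reg ''i'') (Reg ''h'')) e2) (?R2, ?A1) = Some (8 + cost e2, ?R2, ?A2)"
        using R d i il l_less e2 [OF ab] by simp
      show ?thesis
      proof (rule hoare_sym_exec)
        show "sym_exec ?c (?R, A(d \<mapsto> G i)) = Some (34 + cost e1 + cost e2, ?R2, ?A2)"
          by (simp add: test u v p1 p2 del: sym_eval.simps(4) sym_exec.simps(2))
        show "?R \<subseteq>\<^sub>m ?R2"
          using R by (auto simp: map_le_def)
        show "A(d \<mapsto> G (Suc i)) \<preceq> ?A2"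
        proof (rule region_le_upd)
          fix j
          have "level f1 f2 l g i = f1 a b" "level f1 f2 l g (i + 2 ^ l) = f2 a b"
            using False bit_add_power [of i l] by (simp_all add: level_def a_b_def)
          moreover have "low j < Suc i \<longleftrightarrow> low j < i \<or> j = i \<or> j = i + 2 ^ l"
            using low [OF False, of j] by auto
          ultimately show "G (Suc i) j = ((G i)(i := f1 a b, i + 2 ^ l := f2 a b)) j"
            by (auto simp: G_def)
        qed simp
      qed simp
    qed
  qed (use R one_less_W in simp_all)
  moreover have "low j < 2 ^ m" if "j < 2 ^ m" for j
    using that by (auto simp: low_def)
  ultimately show ?thesis
    by (elim hoare_mono) (auto intro!: region_le_upd simp: G_def)
qed

lemma hoare_butterfly:
  assumes R: "R ''q'' = Some (2 ^ m)" "R ''m'' = Some m" "R ''l'' = None" "R ''h'' = None"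
      "R ''i'' = None" "R ''u'' = None" "R ''v'' = None"
    and d: "d < 8" and V: "\<And>a. a \<in> V \<Longrightarrow> a < 2 ^ m"
    and f: "\<And>a b. a \<in> V \<Longrightarrow> b \<in> V \<Longrightarrow> f1 a b \<in> V \<and> f2 a b \<in> V"
    and e1: "\<And>a b A. a \<in> V \<Longrightarrow> b \<in> V \<Longrightarrow> sym_eval (R(''u'' \<mapsto> a, ''v'' \<mapsto> b)) A e1 = Some (f1 a b)"
    and e2: "\<And>a b A. a \<in> V \<Longrightarrow> b \<in> V \<Longrightarrow> sym_eval (R(''u'' \<mapsto> a, ''v'' \<mapsto> b)) A e2 = Some (f2 a b)"
    and g: "\<And>i. i < 2 ^ m \<Longrightarrow> g i \<in> V"
  shows "hoare (St R (A(d \<mapsto> g))) (butterfly d e1 e2)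
     (2 ^ m * m * (cost e1 + cost e2 + 80)) (St R (A(d \<mapsto> bfly f1 f2 m g)))"
proof -
  let ?R = "\<lambda>l. R(''h'' \<mapsto> 2 ^ l)"
  let ?c = "For ''i'' ''q'' (Cond (Op IBit (Reg ''i'') (Reg ''l'')) Skip
         (Seq (Assign ''u'' (At d (Reg ''i'')))
         (Seq (Assign ''v'' (At d (Op IAdd (Reg ''i'') (Reg ''h''))))
         (Seq (Put d (Reg ''i'') e1)
              (Put d (Op IAdd (Reg ''i'') (Reg ''h'')) e2)))))"
  let ?t = "2 ^ m * (cost e1 + cost e2 + 50) + 6"
  \<comment> \<open>\<open>bfly_closed\<close> speaks of indices below \<open>2 ^ l\<close> only,
    while the intermediate levels act on the whole region.\<close>
  have gV: "bfly f1 f2 l g i \<in> V" if "l \<le> m" "i < 2 ^ m" for l i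
    using that
  proof (induction l arbitrary: i)
    case 0
    then show ?case using g by simp
  next
    case (Suc l)
    have "i + 2 ^ l < 2 ^ m" if "\<not> bit i l"
      using that Suc.prems by (intro add_power_less) auto
    then show ?case
      using Suc f by (simp add: level_def less_imp_diff_less)
  qed
  have "hoare (St (?R 0) (A(d \<mapsto> bfly f1 f2 0 g)))
     (For ''l'' ''m'' (Seq ?c (Assign ''h'' (Op IAdd (Reg ''h'') (Reg ''h'')))))
     (m * (?t + 4 + 8) + 6) (St (?R m) (A(d \<mapsto> bfly f1 f2 m g)))"
  proof (rule hoare_for [where R = ?R and A = "\<lambda>l. A(d \<mapsto> bfly f1 f2 l g)"])
    fix l assume l: "l < m"
    let ?R1 = "(?R l)(''l'' \<mapsto> l)"
    have "R(''u'' \<mapsto> a, ''v'' \<mapsto> b) \<subseteq>\<^sub>m ?R1(''i'' \<mapsto> i, ''u'' \<mapsto> a, ''v'' \<mapsto> b)" for i a b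
      using R by (auto simp: map_le_def)
    note le = sym_eval_mono [OF this]
    have "hoare (St ?R1 (A(d \<mapsto> bfly f1 f2 l g))) ?c ?t (St ?R1 (A(d \<mapsto> level f1 f2 l (bfly f1 f2 l g))))"
      by (rule hoare_butterfly_level [where V = V])
        (use R d V l gV in \<open>auto intro!: le e1 e2\<close>)
    moreover have "hoare (St ?R1 (A(d \<mapsto> bfly f1 f2 (Suc l) g))) (Assign ''h'' (Op IAdd (Reg ''h'') (Reg ''h''))) 4
        (St ((?R (Suc l))(''l'' \<mapsto> l)) (A(d \<mapsto> bfly f1 f2 (Suc l) g)))"
    proof (rule hoare_sym_exec)
      have "(2::nat) ^ Suc l \<le> 2 ^ m"
        using l by (intro power_increasing) auto
      then have "(2::nat) ^ l < 2 ^ m" "(2::nat) ^ l + 2 ^ l \<le> 8 * 2 ^ m"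
        using l by simp_all
      then show "sym_exec (Assign ''h'' (Op IAdd (Reg ''h'') (Reg ''h''))) (?R1, A(d \<mapsto> bfly f1 f2 (Suc l) g)) =
          Some (4, ?R1(''h'' \<mapsto> 2 ^ l + 2 ^ l), A(d \<mapsto> bfly f1 f2 (Suc l) g))"
        using l by simp
      show "(?R (Suc l))(''l'' \<mapsto> l) \<subseteq>\<^sub>m ?R1(''h'' \<mapsto> 2 ^ l + 2 ^ l)"
        by (auto simp: map_le_def mult_2)
    qed simp_all
    ultimately show "hoare (St ?R1 (A(d \<mapsto> bfly f1 f2 l g))) (Seq ?c (Assign ''h'' (Op IAdd (Reg ''h'') (Reg ''h''))))
        (?t + 4) (St ((?R (Suc l))(''l'' \<mapsto> l)) (A(d \<mapsto> bfly f1 f2 (Suc l) g)))"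
      unfolding bfly.simps by (rule hoare_seq)
  qed (use R one_less_W in simp_all)
  moreover have "hoare (St R (A(d \<mapsto> g))) (Assign ''h'' (Const 1)) 2 (St (?R 0) (A(d \<mapsto> bfly f1 f2 0 g)))"
    by (rule hoare_sym_exec_exact) (use one_less_W in \<open>simp add: fit_def\<close>)
  ultimately have "hoare (St R (A(d \<mapsto> g))) (butterfly d e1 e2) (2 + (m * (?t + 4 + 8) + 6))
      (St (?R m) (A(d \<mapsto> bfly f1 f2 m g)))"
    unfolding butterfly_def by (intro hoare_seq)
  then show ?thesis
  proof (rule hoare_mono)
    show "R \<subseteq>\<^sub>m ?R m"
      using R by (auto simp: map_le_def)
    \<comment> \<open>The surplus of 80 over 50 yields \<open>30 * Z\<close>, which absorbs the loop
      overhead \<open>18 * m + 8\<close>.\<close>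
    define Z where "Z = 2 ^ m * m"
    have "1 \<le> Z" "m \<le> Z"
      using m_pos by (simp_all add: Z_def)
    moreover have "m * (?t + 4 + 8) = Z * (cost e1 + cost e2 + 50) + 18 * m"
      by (simp add: Z_def algebra_simps)
    moreover have "Z * (cost e1 + cost e2 + 80) = Z * (cost e1 + cost e2 + 50) + 30 * Z"
      by (simp add: algebra_simps)
    ultimately show "2 + (m * (?t + 4 + 8) + 6) \<le> 2 ^ m * m * (cost e1 + cost e2 + 80)"
      unfolding Z_def [symmetric] by linarith
  qed simp_all
qed

lemma hoare_pointwise_power:
  assumes R: "R ''q'' = Some (2 ^ m)" "R ''m'' = Some m" "R ''o'' = Some \<one>" "R ''l'' = None" 
      "R ''i'' = None" "R ''b'' = None" "R ''e'' = None" "R ''p'' = None"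
    and A: "A 4 = Some h" and h: "\<And>i. i < 2 ^ m \<Longrightarrow> h i < 2 ^ m" and g: "\<And>i. i < 2 ^ m \<Longrightarrow> g i < 2 ^ m"
  shows "hoare (St R (A(5 \<mapsto> g))) pointwise_power (2 ^ m * m * 80) (St R (A(5 \<mapsto> \<lambda>i. g i [^] h i)))"
proof -
  define G where "G i j = (if j < i then g j [^] h j else g j)" for i j
  let ?step = "Seq (Cond (Op IBit (Reg ''e'') (Reg ''l'')) (Assign ''p'' (Op FMul (Reg ''p'') (Reg ''b''))) Skip)
         (Assign ''b'' (Op FMul (Reg ''b'') (Reg ''b'')))"
  let ?c = "(Seq (Assign ''b'' (At 5 (Reg ''i'')))
     (Seq (Assign ''e'' (At 4 (Reg ''i'')))
     (Seq (Assign ''p'' (Reg ''o''))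
     (Seq (For ''l'' ''m'' ?step)
       (Put 5 (Reg ''i'') (Reg ''p''))))))"
  have "hoare (St R (A(5 \<mapsto> G 0))) (For ''i'' ''q'' ?c) (2 ^ m * ((7 + (7 + (2 + ((m * (15 + 8) + 6) + 7)))) + 8) + 6)
      (St R (A(5 \<mapsto> G (2 ^ m))))"
  proof (rule hoare_for [where R = "\<lambda>_. R" and A = "\<lambda>i. A(5 \<mapsto> G i)"])
    fix i :: nat assume i: "i < 2 ^ m"
    let ?Ri = "R(''i'' \<mapsto> i)"
    let ?A = "A(5 \<mapsto> G i)"
    let ?R1 = "?Ri(''b'' \<mapsto> g i)"
    let ?R2 = "?R1(''e'' \<mapsto> h i)"
    \<comment> \<open>The invariant of binary exponentiation from the lowest bit: \<open>p\<close>
      accounts for the low \<open>l\<close> bits of the exponent. As \<open>h i < 2 ^ m\<close>,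
      truncation to \<open>m\<close> bits is the whole exponent.\<close>
    let ?S = "\<lambda>l. ?R2(''b'' \<mapsto> g i [^] (2 ^ l :: nat), ''p'' \<mapsto> g i [^] take_bit l (h i))"
    have c: "g i [^] (k::nat) \<in> carrier F" "g i [^] (k::nat) < 2 ^ m" for k
      using g [OF i] nat_pow_closed [of "g i" k] by (auto simp: carrier_eq)
    have "hoare (St ?Ri ?A) (Assign ''b'' (At 5 (Reg ''i''))) 7 (St ?R1 ?A)"
      by (rule hoare_sym_exec_exact) (use R i g [OF i] in \<open>simp add: G_def\<close>)
    moreover have "hoare (St ?R1 ?A) (Assign ''e'' (At 4 (Reg ''i''))) 7 (St ?R2 ?A)"
      by (rule hoare_sym_exec_exact) (use R i h [OF i] A in simp)
    moreover have "hoare (St ?R2 ?A) (Assign ''p'' (Reg ''o'')) 2 (St (?S 0) ?A)"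
    proof (rule hoare_sym_exec)
      show "sym_exec (Assign ''p'' (Reg ''o'')) (?R2, ?A) = Some (2, ?R2(''p'' \<mapsto> \<one>), ?A)"
        using R one_bounds by simp
      show "?S 0 \<subseteq>\<^sub>m ?R2(''p'' \<mapsto> \<one>)"
        using g [OF i] by (auto simp: map_le_def carrier_eq)
    qed simp_all
    moreover have "hoare (St (?S 0) ?A) (For ''l'' ''m'' ?step) (m * (15 + 8) + 6) (St (?S m) ?A)"
    proof (rule hoare_for [where R = ?S and A = "\<lambda>l. ?A"])
      fix l assume l: "l < m"
      have ll: "l < 2 ^ m"
        using l m_less by (rule less_trans)
      define b where "b = g i [^] (2 ^ l :: nat)"
      define p where "p = g i [^] take_bit l (h i)"
      have bp: "b < 2 ^ m" "p < 2 ^ m" "b \<in> carrier F" "p \<in> carrier F"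
        using c by (simp_all add: b_def p_def)
      then have prods: "p \<otimes> b < 2 ^ m" "b \<otimes> b < 2 ^ m"
        using m_closed [of p b] m_closed [of b b] by (simp_all add: carrier_eq)
      have b': "g i [^] (2 ^ Suc l :: nat) = b \<otimes> b"
        using g [OF i] by (simp add: b_def nat_pow_mult mult_2 carrier_eq)
      have p': "g i [^] take_bit (Suc l) (h i) = (if bit (h i) l then p \<otimes> b else p)"
        using g [OF i] by (simp add: b_def p_def nat_pow_mult carrier_eq take_bit_Suc_from_most add.commute)
      let ?R1 = "(?S l)(''l'' \<mapsto> l)"
      let ?R3 = "?R1(''p'' \<mapsto> (if bit (h i) l then p \<otimes> b else p))"
      let ?R4 = "?R3(''b'' \<mapsto> b \<otimes> b)"
      have 1: "sym_exec (Cond (Op IBit (Reg ''e'') (Reg ''l'')) (Assign ''p'' (Op FMul (Reg ''p'') (Reg ''b''))) Skip) (?R1, ?A) =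
          Some (if bit (h i) l then 8 else 5, ?R3, ?A)"
        using bp prods ll h [OF i] one_less_W
        by (auto simp: b_def [symmetric] p_def [symmetric] fun_upd_idem_iff fun_eq_iff)
      have 2: "sym_exec (Assign ''b'' (Op FMul (Reg ''b'') (Reg ''b''))) (?R3, ?A) = Some (4, ?R4, ?A)"
        using bp prods by (auto simp: b_def [symmetric] p_def [symmetric])
      show "hoare (St ?R1 ?A) ?step 15 (St ((?S (Suc l))(''l'' \<mapsto> l)) ?A)"
      proof (rule hoare_sym_exec)
        show "sym_exec ?step (?R1, ?A) = Some ((if bit (h i) l then 8 else 5) + 4, ?R4, ?A)"
          by (simp only: sym_exec.simps(4) 1 2 Option.bind_lunit prod.case)
        show "(?S (Suc l))(''l'' \<mapsto> l) \<subseteq>\<^sub>m ?R4"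
          unfolding b' p' by (auto simp: map_le_def)
      qed simp_all
    qed (use R one_less_W in simp_all)
    moreover have "hoare (St (?S m) ?A) (Put 5 (Reg ''i'') (Reg ''p'')) 7 (St ?Ri (A(5 \<mapsto> G (Suc i))))"
    proof (rule hoare_sym_exec)
      have t: "take_bit m (h i) = h i"
        using h [OF i] by (simp add: take_bit_nat_eq_self)
      show "sym_exec (Put 5 (Reg ''i'') (Reg ''p'')) (?S m, ?A) =
          Some (7, ?S m, ?A(5 \<mapsto> (G i)(i := g i [^] h i)))"
        using R i c t by simp
      show "?Ri \<subseteq>\<^sub>m ?S m"
        using R by (auto simp: map_le_def)
      show "A(5 \<mapsto> G (Suc i)) \<preceq> ?A(5 \<mapsto> (G i)(i := g i [^] h i))"
        by (simp, rule region_le_upd) (auto simp: G_def)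
    qed simp
    ultimately show "hoare (St ?Ri ?A) ?c (7 + (7 + (2 + ((m * (15 + 8) + 6) + 7)))) (St ?Ri (A(5 \<mapsto> G (Suc i))))"
      by (intro hoare_seq)
  qed (use R one_less_W in simp_all)
  then show ?thesis
    unfolding pointwise_power_def
  proof (rule hoare_mono)
    define Z where "Z = 2 ^ m * m"
    have "1 \<le> Z" "2 ^ m \<le> Z"
      using m_pos by (simp_all add: Z_def)
    moreover have "2 ^ m * (7 + (7 + (2 + (m * (15 + 8) + 6 + 7))) + 8) = 23 * Z + 37 * 2 ^ m"
      by (simp add: Z_def algebra_simps)
    ultimately show "2 ^ m * (7 + (7 + (2 + (m * (15 + 8) + 6 + 7))) + 8) + 6 \<le> 2 ^ m * m * 80"
      unfolding Z_def [symmetric] by linarith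
  qed (auto intro!: region_le_upd simp: G_def)
qed

end

section \<open>The program\<close>

text \<open>
  Region 0 holds the input and finally the codeword, region 1 the rest of the input, 2 the known
  values and later their products with \<open>L\<close>, 3 the indicator of the known points, 5 the values of
  \<open>L\<close>, 6 the sum over the deformation parameters and 7 the kernel \<open>1 / x\<close>; region 4 is scratch space.
\<close>

definition setup_registers :: prog where
  "setup_registers = Seq (Assign ''q'' (Const 1))
     (Seq (For ''l'' ''m'' (Assign ''q'' (Op IAdd (Reg ''q'') (Reg ''q''))))
     (Seq (Assign ''o'' (Op FDiv (Const 1) (Const 1)))
     (Seq (Assign ''B'' (Const 1))
       (For ''l'' ''m'' (Cond (Op ILess (Reg ''B'') (Op IAdd (Reg ''m'') (Const 2)))
          (Assign ''B'' (Op IAdd (Reg ''B'') (Reg ''B''))) Skip)))))"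

definition scatter_input :: prog where
  "scatter_input = For ''i'' ''n''
     (Seq (Assign ''u'' (Load (Reg ''i'')))
     (Seq (Assign ''v'' (Load (Op IAdd (Reg ''n'') (Reg ''i''))))
     (Seq (Put 2 (Reg ''u'') (Reg ''v''))
          (Put 3 (Reg ''u'') (Const 1)))))"

text \<open>A truth value used as an integer factor selects without branching, so that the choice is
  a single expression, as \<open>pass\<close> expects.\<close>

definition unit_word_expr :: expr where
  "unit_word_expr = Op IAdd (Reg ''i'') (Op IMul (Op IEq (Reg ''i'') (Const 0)) (Reg ''o''))"

definition compute_locator :: prog where
  "compute_locator =
     Seq (pass 4 (Op ISub (Const 1) (At 3 (Reg ''i''))))
     (Seq (pass 5 unit_word_expr)
     (Seq (butterfly 4
            (Op IMod (Op IAdd (Reg ''u'') (Reg ''v'')) (Op ISub (Reg ''q'') (Const 1)))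
            (Op IMod (Op ISub (Op IAdd (Reg ''u'') (Op ISub (Reg ''q'') (Const 1))) (Reg ''v''))
               (Op ISub (Reg ''q'') (Const 1))))
     (Seq (butterfly 5 (Op FMul (Reg ''u'') (Reg ''v'')) (Op FDiv (Reg ''u'') (Reg ''v'')))
     (Seq pointwise_power
          (butterfly 5 (Op FMul (Reg ''u'') (Reg ''v'')) (Op FDiv (Reg ''u'') (Reg ''v'')))))))"

text \<open>The transforms depend on \<open>c\<close> and overwrite their input, so weighted values
  and kernel are written anew to regions 4 and 7 in every round. The kernel divides by a unit word,
  hence never by 0, and a truth value then blanks out index 0.\<close>

definition deformed_step :: prog where
  "deformed_step =
     (let mix = Op FAdd (Reg ''u'') (Op FMul (Op FAdd (Reg ''o'') (Reg ''c'')) (Reg ''v''));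
          quot = Op FDiv (Op FAdd (Reg ''u'') (Reg ''v'')) (Reg ''c'')
      in Seq (pass 4 (At 2 (Reg ''i'')))
        (Seq (pass 7 (Op IMul (Op ILess (Const 0) (Reg ''i'')) (Op FDiv (Reg ''o'') unit_word_expr)))
        (Seq (butterfly 4 (Op FAdd (Reg ''u'') (Reg ''v'')) mix)
        (Seq (butterfly 7 (Op FAdd (Reg ''u'') (Reg ''v'')) mix)
        (Seq (pass 4 (Op FMul (At 4 (Reg ''i'')) (At 7 (Reg ''i''))))
        (Seq (butterfly 4 (Op FAdd (Reg ''u'') quot) quot)
             (pass 6 (Op FAdd (At 6 (Reg ''i'')) (At 4 (Reg ''i''))))))))))"

text \<open>The last pass takes \<open>P * L\<close> from region 2 at known points and from region 6
  at erased ones. In the integer sum one summand is always 0, and a single division by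
  \<open>L\<close> serves both cases.\<close>

definition decode_large :: prog where
  "decode_large = Seq setup_registers (Seq scatter_input (Seq compute_locator
     (Seq (pass 2 (Op FMul (At 2 (Reg ''i'')) (At 5 (Reg ''i''))))
     (Seq (For ''c'' ''B'' (Cond (Reg ''c'') deformed_step Skip))
          (pass 0 (Op FDiv (Op IAdd (Op IMul (At 3 (Reg ''i'')) (At 2 (Reg ''i'')))
             (Op IMul (Op ISub (Const 1) (At 3 (Reg ''i''))) (At 6 (Reg ''i''))))
             (At 5 (Reg ''i''))))))))"

text \<open>With two field elements, the points are \<open>u\<close> and \<open>1 - u\<close>. Cell
  \<open>2 * n - 1\<close> holds the last known value: for \<open>n = 2\<close> it belongs to the
  other point, and for \<open>n = 1\<close> the polynomial is constant, so the same value is right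
  there too. All loads precede the stores into the input area.\<close>

definition decode_two :: prog where
  "decode_two = Seq (Assign ''u'' (Load (Const 0)))
     (Seq (Assign ''v'' (Load (Reg ''n'')))
     (Seq (Assign ''w'' (Load (Op ISub (Op IAdd (Reg ''n'') (Reg ''n'')) (Const 1))))
     (Seq (Store (Reg ''u'') (Reg ''v''))
          (Store (Op ISub (Const 1) (Reg ''u'')) (Reg ''w'')))))"

definition decoder :: prog where
  "decoder = Cond (Op IEq (Reg ''m'') (Const 1)) decode_two decode_large"

text \<open>
  The size of the subgroup of deformation parameters. For \<open>m = 1\<close> it would exceed the field, hence
  the separate program \<open>decode_two\<close>.
\<close>

primrec node_count :: "nat \<Rightarrow> nat \<Rightarrow> nat" where
  "node_count m 0 = 1"
| "node_count m (Suc i) = (if node_count m i < m + 2 then 2 * node_count m i else node_count m i)"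

text \<open>A doubling starts from at most \<open>m + 1\<close>, whence the bound
  \<open>2 * m + 2\<close>. If \<open>m + 2\<close> has not been reached, all \<open>i\<close>
  rounds have doubled.\<close>

lemma node_count:
  "\<exists>s\<le>i. node_count m i = 2 ^ s \<and> node_count m i \<le> 2 * m + 2 \<and> (m + 2 \<le> node_count m i \<or> s = i)"
proof (induction i)
  case (Suc i)
  then obtain s where "s \<le> i" "node_count m i = 2 ^ s" "node_count m i \<le> 2 * m + 2"
      "m + 2 \<le> node_count m i \<or> s = i"
    by blast
  then show ?case
    by (cases "node_count m i < m + 2") (auto intro: exI [of _ "Suc s"] exI [of _ s])
qed simp

section \<open>Effect and running time of the single stages\<close>

context ram
begin

lemma fit_bounds [simp]: "fit W (Suc 0) = Some (Suc 0)" "fit W 0 = Some 0" "fit W m = Some m"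
  "fit W (2 ^ m) = Some (2 ^ m)"
  using one_less_W by (simp_all add: fit_def)

lemma field_ops_less [simp]:
  assumes "x < 2 ^ m" "y < 2 ^ m"
  shows "x \<oplus> y < 2 ^ m" "x \<otimes> y < 2 ^ m"
  using assms a_closed [of x y] m_closed [of x y] by (simp_all add: carrier_eq)

lemma inv_less [simp]: "x < 2 ^ m \<Longrightarrow> x \<noteq> 0 \<Longrightarrow> inv x < 2 ^ m"
  using inv_closed' [of x] by (simp add: carrier_eq zero_eq_0)

lemma one_less [simp]: "\<one> < 2 ^ m"
  by (rule one_bounds)

lemma sym_eval_field_ops [simp]:
  assumes "sym_eval R A d = Some x" "sym_eval R A e = Some y" "x < 2 ^ m" "y < 2 ^ m"
  shows "sym_eval R A (Op FAdd d e) = Some (x \<oplus> y)" "sym_eval R A (Op FMul d e) = Some (x \<otimes> y)"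
    "y \<noteq> 0 \<Longrightarrow> sym_eval R A (Op FDiv d e) = Some (x \<otimes> inv y)"
  using assms by (simp_all add: carrier_eq zero_eq_0)

lemma hoare_pass_new:
  assumes "R ''q'' = Some (2 ^ m)" "R ''i'' = None" "d < 8"
    and "\<And>i g. i < 2 ^ m \<Longrightarrow> sym_eval (R(''i'' \<mapsto> i)) (A(d \<mapsto> g)) e = Some (f i)"
  shows "hoare (St R A) (pass d e) (2 ^ m * (cost e + 14) + 6) (St R (A(d \<mapsto> f)))"
  using assms by (intro hoare_region [of R A d] hoare_pass)

lemma hoare_pass_upd:
  assumes "R ''q'' = Some (2 ^ m)" "R ''i'' = None" "d < 8" "A d = Some g"
    and "\<And>i g'. i < 2 ^ m \<Longrightarrow> g' i = g i \<Longrightarrow> sym_eval (R(''i'' \<mapsto> i)) (A(d \<mapsto> g')) e = Some (f i)"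
  shows "hoare (St R A) (pass d e) (2 ^ m * (cost e + 14) + 6) (St R (A(d \<mapsto> f)))"
  using hoare_pass [where g = g, OF assms(1-3,5)] assms(4) by (simp add: fun_upd_idem)

lemma hoare_butterfly_upd:
  assumes R: "R ''q'' = Some (2 ^ m)" "R ''m'' = Some m" "R ''l'' = None" "R ''h'' = None"
      "R ''i'' = None" "R ''u'' = None" "R ''v'' = None"
    and "d < 8" "A d = Some g" "\<And>a. a \<in> V \<Longrightarrow> a < 2 ^ m"
    and "\<And>a b. a \<in> V \<Longrightarrow> b \<in> V \<Longrightarrow> f1 a b \<in> V \<and> f2 a b \<in> V"
    and "\<And>a b A. a \<in> V \<Longrightarrow> b \<in> V \<Longrightarrow> sym_eval (R(''u'' \<mapsto> a, ''v'' \<mapsto> b)) A e1 = Some (f1 a b)"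
    and "\<And>a b A. a \<in> V \<Longrightarrow> b \<in> V \<Longrightarrow> sym_eval (R(''u'' \<mapsto> a, ''v'' \<mapsto> b)) A e2 = Some (f2 a b)"
    and "\<And>i. i < 2 ^ m \<Longrightarrow> g i \<in> V"
  shows "hoare (St R A) (butterfly d e1 e2) (2 ^ m * m * (cost e1 + cost e2 + 80))
    (St R (A(d \<mapsto> bfly f1 f2 m g)))"
  using hoare_butterfly [where g = g and A = A, OF R assms(8,10-)] assms(9) by (simp add: fun_upd_idem)

lemma hoare_setup:
  "hoare (St [''m'' \<mapsto> m, ''n'' \<mapsto> n] A) setup_registers (m * 50 + 50)
     (St [''m'' \<mapsto> m, ''n'' \<mapsto> n, ''q'' \<mapsto> 2 ^ m, ''o'' \<mapsto> \<one>, ''B'' \<mapsto> node_count m m] A)"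
proof -
  let ?Q = "\<lambda>i. [''m'' \<mapsto> m, ''n'' \<mapsto> n, ''q'' \<mapsto> 2 ^ i]"
  let ?O = "(?Q m)(''o'' \<mapsto> \<one>)"
  let ?N = "\<lambda>i. ?O(''B'' \<mapsto> node_count m i)"
  have "hoare (St [''m'' \<mapsto> m, ''n'' \<mapsto> n] A) (Assign ''q'' (Const 1)) 2 (St (?Q 0) A)"
    by (rule hoare_sym_exec_exact) simp
  moreover have "hoare (St (?Q 0) A) (For ''l'' ''m'' (Assign ''q'' (Op IAdd (Reg ''q'') (Reg ''q''))))
      (m * (4 + 8) + 6) (St (?Q m) A)"
  proof (rule hoare_for [where R = ?Q and A = "\<lambda>_. A"])
    fix i assume "i < m"
    then have "(2::nat) ^ Suc i \<le> 2 ^ m"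
      by (intro power_increasing) auto
    then have "(2::nat) ^ i \<le> 8 * 2 ^ m" "2 * (2::nat) ^ i \<le> 8 * 2 ^ m"
      by simp_all
    then show "hoare (St ((?Q i)(''l'' \<mapsto> i)) A) (Assign ''q'' (Op IAdd (Reg ''q'') (Reg ''q''))) 4
        (St ((?Q (Suc i))(''l'' \<mapsto> i)) A)"
      by (intro hoare_sym_exec [where t' = 4 and ?R1.0 = "(?Q i)(''l'' \<mapsto> i, ''q'' \<mapsto> 2 ^ i + 2 ^ i)" and ?A1.0 = A])
        (auto simp: map_le_def mult_2)
  qed (use one_less_W in simp_all)
  moreover have "hoare (St (?Q m) A) (Assign ''o'' (Op FDiv (Const 1) (Const 1))) 4 (St ?O A)"
  proof (rule hoare_sym_exec_exact)
    \<comment> \<open>The word 1 is a nonzero field element, though perhaps not the one; its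
      quotient by itself is the one in every basis.\<close>
    have "(2::nat) ^ 1 \<le> 2 ^ m"
      using m_pos by (intro power_increasing) auto
    then have "Suc 0 \<in> carrier F" "Suc 0 \<noteq> \<zero>"
      by (simp_all add: carrier_eq zero_eq_0)
    then show "sym_exec (Assign ''o'' (Op FDiv (Const 1) (Const 1))) (?Q m, A) = Some (4, ?O, A)"
      by simp
  qed
  moreover have "hoare (St ?O A) (Assign ''B'' (Const 1)) 2 (St (?N 0) A)"
    by (rule hoare_sym_exec_exact) simp
  moreover have "hoare (St (?N 0) A) (For ''l'' ''m'' (Cond (Op ILess (Reg ''B'') (Op IAdd (Reg ''m'') (Const 2)))
          (Assign ''B'' (Op IAdd (Reg ''B'') (Reg ''B''))) Skip)) (m * (10 + 8) + 6) (St (?N m) A)"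
  proof (rule hoare_for [where R = ?N and A = "\<lambda>_. A"])
    fix i assume "i < m"
    let ?R = "(?N i)(''l'' \<mapsto> i)"
    let ?c = "Cond (Op ILess (Reg ''B'') (Op IAdd (Reg ''m'') (Const 2)))
          (Assign ''B'' (Op IAdd (Reg ''B'') (Reg ''B''))) Skip"
    have le: "node_count m i \<le> 8 * 2 ^ m" "2 + m \<le> 8 * 2 ^ m" "2 \<le> 8 * (2::nat) ^ m" "m \<le> 8 * 2 ^ m"
    proof -
      have "node_count m i \<le> 2 * m + 2"
        using node_count by blast
      then show "node_count m i \<le> 8 * 2 ^ m" "2 + m \<le> 8 * 2 ^ m" "2 \<le> 8 * (2::nat) ^ m" "m \<le> 8 * 2 ^ m"
        using m_less by linarith+
    qed
    show "hoare (St ?R A) ?c 10 (St ((?N (Suc i))(''l'' \<mapsto> i)) A)"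
    proof (cases "node_count m i < m + 2")
      case True
      then have "2 * node_count m i \<le> 8 * 2 ^ m"
        using m_less by linarith
      then show ?thesis
        using True le
        by (intro hoare_sym_exec [where t' = 10 and ?R1.0 = "?R(''B'' \<mapsto> node_count m i + node_count m i)" and ?A1.0 = A])
          (auto simp: map_le_def mult_2)
    next
      case False
      then show ?thesis
        using le by (intro hoare_sym_exec [where t' = 7 and ?R1.0 = ?R and ?A1.0 = A]) (auto simp: map_le_def)
    qed
  qed (use one_less_W in simp_all)
  ultimately have "hoare (St [''m'' \<mapsto> m, ''n'' \<mapsto> n] A) setup_registers
      (2 + ((m * (4 + 8) + 6) + (4 + (2 + (m * (10 + 8) + 6))))) (St (?N m) A)"
    unfolding setup_registers_def by (intro hoare_seq)
  then show ?thesis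
    by (rule hoare_time) simp
qed

lemma cost_unit_word: "cost unit_word_expr = 7"
  by (simp add: unit_word_expr_def)

lemma sym_eval_unit_word:
  assumes "R ''i'' = Some i" "R ''o'' = Some \<one>" "i < 2 ^ m"
  shows "sym_eval R A unit_word_expr = Some (unit_word i)"
  using assms by (cases "i = 0") (simp_all add: unit_word_expr_def unit_word_def)

lemma unit_word_bounds: "i < 2 ^ m \<Longrightarrow> unit_word i < 2 ^ m" "unit_word i \<noteq> 0"
  using one_bounds by (auto simp: unit_word_def)

lemma hoare_scatter:
  assumes R: "R ''q'' = Some (2 ^ m)" "R ''n'' = Some (length xs)" "R ''i'' = None" "R ''u'' = None" "R ''v'' = None"
    and xs: "set xs \<subseteq> carrier F" "length xs \<le> 2 ^ m" and P: "\<And>x. x < 2 ^ m \<Longrightarrow> P x < 2 ^ m"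
    and M: "M = xs @ map P xs @ replicate k 0" "length M = 8 * 2 ^ m"
  defines "A \<equiv> \<lambda>d. Some (\<lambda>i. M ! (d * 2 ^ m + i))"
  shows "hoare (St R A) scatter_input (2 ^ m * 60 + 6)
    (St R [2 \<mapsto> \<lambda>x. if x \<in> set xs then P x else 0, 3 \<mapsto> \<lambda>x. of_bool (x \<in> set xs), 6 \<mapsto> \<lambda>_. 0])"
proof -
  define V where "V i x = (if x \<in> set (take i xs) then P x else 0)" for i x
  define K where "K i x = (of_bool (x \<in> set (take i xs)) :: nat)" for i x
  let ?A = "\<lambda>i. A(2 \<mapsto> V i, 3 \<mapsto> K i)"
  let ?c = "Seq (Assign ''u'' (Load (Reg ''i'')))
     (Seq (Assign ''v'' (Load (Op IAdd (Reg ''n'') (Reg ''i''))))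
     (Seq (Put 2 (Reg ''u'') (Reg ''v''))
          (Put 3 (Reg ''u'') (Const 1))))"
  \<comment> \<open>The input occupies at most \<open>2 * 2 ^ m\<close> cells, that is, regions 0
    and 1, and the loop writes to regions 2 and 3, so it always reads unchanged input.\<close>
  have load: "sym_eval R' (?A i) (Load e) = fit W (M ! a)" if "sym_eval R' (?A i) e = Some a" "a < 2 * 2 ^ m" for R' i e a
  proof -
    have "a div 2 ^ m < 2"
      using that by (simp add: less_mult_imp_div_less)
    then have "?A i (a div 2 ^ m) = A (a div 2 ^ m)"
      by simp
    then show ?thesis
      using that by (simp add: A_def div_mult_mod_eq)
  qed
  \<comment> \<open>The padding with zeros provides the initial contents of the value table, of the
    indicator and of the accumulator in region 6.\<close>
  have zeros: "M ! a = 0" if "2 * 2 ^ m \<le> a" "a < 8 * 2 ^ m" for a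
    using that xs M(2) unfolding M(1) by (auto simp: nth_append)
  have "hoare (St R (?A 0)) (For ''i'' ''n'' ?c) (length xs * (40 + 8) + 6) (St R (?A (length xs)))"
  proof (rule hoare_for [where R = "\<lambda>_. R" and A = ?A])
    fix i assume i: "i < length xs"
    define x where "x = xs ! i"
    have x: "x < 2 ^ m" "P x < 2 ^ m"
      using nth_mem [OF i] xs P by (auto simp: x_def carrier_eq)
    have M': "M ! i = x" "M ! (length xs + i) = P x"
      using i by (simp_all add: M(1) x_def nth_append)
    let ?Ri = "R(''i'' \<mapsto> i)"
    let ?Rv = "?Ri(''u'' \<mapsto> x, ''v'' \<mapsto> P x)"
    have bounds: "i < 2 ^ m" "length xs + i < 2 * 2 ^ m"
      using i xs by simp_all
    have 1: "sym_exec (Assign ''u'' (Load (Reg ''i''))) (?Ri, ?A i) = Some (3, ?Ri(''u'' \<mapsto> x), ?A i)"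
      using load [of ?Ri i "Reg ''i''" i] bounds M' x by simp
    have 2: "sym_exec (Assign ''v'' (Load (Op IAdd (Reg ''n'') (Reg ''i'')))) (?Ri(''u'' \<mapsto> x), ?A i) = Some (5, ?Rv, ?A i)"
      using load [of "?Ri(''u'' \<mapsto> x)" i "Op IAdd (Reg ''n'') (Reg ''i'')" "length xs + i"] R bounds M' x xs
      by simp
    have 3: "sym_exec (Put 2 (Reg ''u'') (Reg ''v'')) (?Rv, ?A i) = Some (7, ?Rv, (?A i)(2 \<mapsto> (V i)(x := P x)))"
      using R x by simp
    have 4: "sym_exec (Put 3 (Reg ''u'') (Const 1)) (?Rv, (?A i)(2 \<mapsto> (V i)(x := P x))) =
        Some (7, ?Rv, (?A i)(2 \<mapsto> (V i)(x := P x), 3 \<mapsto> (K i)(x := 1)))"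
      using R x by simp
    have take: "set (take (Suc i) xs) = insert x (set (take i xs))"
      using i by (simp add: take_Suc_conv_app_nth x_def)
    show "hoare (St ?Ri (?A i)) ?c 40 (St ?Ri (?A (Suc i)))"
    proof (rule hoare_sym_exec)
      show "sym_exec ?c (?Ri, ?A i) = Some (3 + (5 + (7 + 7)), ?Rv, (?A i)(2 \<mapsto> (V i)(x := P x), 3 \<mapsto> (K i)(x := 1)))"
        by (simp only: sym_exec.simps(4) 1 2 3 4 Option.bind_lunit prod.case)
      show "?Ri \<subseteq>\<^sub>m ?Rv"
        using R by (auto simp: map_le_def)
      have "(V i)(x := P x) = V (Suc i)" "(K i)(x := 1) = K (Suc i)"
        by (auto simp: V_def K_def take fun_eq_iff)
      then show "?A (Suc i) \<preceq> (?A i)(2 \<mapsto> (V i)(x := P x), 3 \<mapsto> (K i)(x := 1))"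
        by (simp add: fun_upd_twist)
    qed simp
  qed (use R xs one_less_W in auto)
  then have "hoare (St R A) scatter_input (length xs * (40 + 8) + 6) (St R (?A (length xs)))"
    unfolding scatter_input_def
  proof (rule hoare_mono)
    show "?A 0 \<preceq> A"
    proof -
      have "A d = Some (\<lambda>i. M ! (d * 2 ^ m + i))" for d
        by (simp add: A_def)
      from region_le_upd_left [OF this] show ?thesis
        using zeros by (simp add: V_def K_def)
    qed
  qed simp_all
  then show ?thesis
  proof (rule hoare_mono)
    show "[2 \<mapsto> \<lambda>x. if x \<in> set xs then P x else 0, 3 \<mapsto> \<lambda>x. of_bool (x \<in> set xs), 6 \<mapsto> \<lambda>_. 0] \<preceq> ?A (length xs)"
      using zeros by (auto simp: region_le_def A_def V_def K_def split: if_splits)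
    show "length xs * (40 + 8) + 6 \<le> 2 ^ m * 60 + 6"
      using xs by simp
  qed simp_all
qed

abbreviation base_regs :: regs where
  "base_regs \<equiv> [''m'' \<mapsto> m, ''q'' \<mapsto> 2 ^ m, ''o'' \<mapsto> \<one>, ''B'' \<mapsto> node_count m m]"

lemma inv_nonzero [simp]: "x \<in> carrier F \<Longrightarrow> x \<noteq> \<zero> \<Longrightarrow> inv x \<noteq> \<zero>"
  by (metis r_inv' r_null one_not_zero)

lemma hoare_locator:
  fixes V Z :: "nat \<Rightarrow> nat"
  assumes m: "2 \<le> m" and S: "S \<subseteq> carrier F" and R: "R = base_regs"
  defines "A \<equiv> [2 \<mapsto> V, 3 \<mapsto> \<lambda>x. of_bool (x \<in> S), 6 \<mapsto> Z]"
  shows "hoare (St R A) compute_locator (2 ^ m * m * 500)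
    (St R (A(5 \<mapsto> nodal (carrier F - S))))"
proof -
  define E where "E = carrier F - S"
  let ?q1 = "Op ISub (Reg ''q'') (Const 1)"
  let ?add = "Op IMod (Op IAdd (Reg ''u'') (Reg ''v'')) ?q1"
  let ?sub = "Op IMod (Op ISub (Op IAdd (Reg ''u'') ?q1) (Reg ''v'')) ?q1"
  define H0 where "H0 = (\<lambda>x. of_bool (x \<in> E) :: nat)"
  define G1 where "G1 = mwht m unit_word"
  define H1 where "H1 = cwht m H0"
  define G2 where "G2 = (\<lambda>x. G1 x [^] H1 x)"
  let ?A1 = "A(4 \<mapsto> H0)"
  let ?A2 = "?A1(5 \<mapsto> unit_word)"
  let ?A3 = "?A2(4 \<mapsto> H1)"
  let ?A4 = "?A3(5 \<mapsto> G1)"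
  let ?A5 = "?A4(5 \<mapsto> G2)"
  let ?A6 = "?A5(5 \<mapsto> mwht m G2)"
  have q: "(2::nat) ^ 2 \<le> 2 ^ m"
    using m by (intro power_increasing) auto
  have mult: "a \<otimes> b \<in> carrier F - {0} \<and> a \<otimes> inv b \<in> carrier F - {0}"
    if "a \<in> carrier F - {0}" "b \<in> carrier F - {0}" for a b
    using that unfolding zero_eq_0 [symmetric] by (auto simp: integral_iff)
  have mult_eval: "sym_eval (R(''u'' \<mapsto> a, ''v'' \<mapsto> b)) A' (Op FMul (Reg ''u'') (Reg ''v'')) = Some (a \<otimes> b)"
     "sym_eval (R(''u'' \<mapsto> a, ''v'' \<mapsto> b)) A' (Op FDiv (Reg ''u'') (Reg ''v'')) = Some (a \<otimes> inv b)"
    if "a \<in> carrier F - {0}" "b \<in> carrier F - {0}" for a b A'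
    using that by (auto simp: carrier_eq zero_eq_0)
  have unit: "unit_word i \<in> carrier F - {0}" if "i < 2 ^ m" for i
    using that unit_word_bounds by (simp add: carrier_eq)
  have G1: "G1 i \<in> carrier F - {0}" if "i < 2 ^ m" for i
    unfolding G1_def using mult unit that by (intro bfly_closed) auto
  have G2: "G2 i \<in> carrier F - {0}" if "i < 2 ^ m" for i
  proof -
    have "x [^] n \<in> carrier F - {0}" if "x \<in> carrier F - {0}" for x and n :: nat
      using that mult one_bounds by (induction n) (auto simp: carrier_eq)
    then show ?thesis
      using G1 that by (simp add: G2_def)
  qed
  have H1: "H1 i < 2 ^ m" if "i < 2 ^ m" for i
  proof -
    have "H1 i \<in> {..2 ^ m - 1}"
      unfolding H1_def cwht_def using that q by (intro bfly_closed) (auto simp: H0_def less_imp_le_nat)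
    then show ?thesis
      by (simp add: le_diff_conv2 flip: Suc_le_eq)
  qed
  have 1: "hoare (St R A) (pass 4 (Op ISub (Const 1) (At 3 (Reg ''i'')))) (2 ^ m * (8 + 14) + 6) (St R ?A1)"
    using hoare_pass_new [of R 4 A "Op ISub (Const 1) (At 3 (Reg ''i''))" H0] S
    by (simp add: R A_def H0_def E_def carrier_eq)
  have 2: "hoare (St R ?A1) (pass 5 unit_word_expr) (2 ^ m * (7 + 14) + 6) (St R ?A2)"
    using hoare_pass_new [of R 5 ?A1 unit_word_expr unit_word]
    by (simp add: R sym_eval_unit_word cost_unit_word)
  have 3: "hoare (St R ?A2) (butterfly 4 ?add ?sub) (2 ^ m * m * (7 + 11 + 80)) (St R ?A3)"
  proof -
    have "hoare (St R ?A2) (butterfly 4 ?add ?sub) (2 ^ m * m * (cost ?add + cost ?sub + 80))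
       (St R (?A2(4 \<mapsto> bfly (\<lambda>a b. (a + b) mod (2 ^ m - 1)) (\<lambda>a b. (a + (2 ^ m - 1) - b) mod (2 ^ m - 1)) m H0)))"
    proof (rule hoare_butterfly_upd [where V = "{..2 ^ m - 1}"])
      fix a b :: nat and A' :: regions
      assume "a \<in> {..2 ^ m - 1}" "b \<in> {..2 ^ m - 1}"
      then have ab: "a < 2 ^ m" "b < 2 ^ m"
        by (simp_all add: le_diff_conv2 flip: Suc_le_eq)
      have pos: "(2::nat) ^ m - 1 > 0"
        using q by simp
      have "a + b \<le> 8 * 2 ^ m" "a + (2 ^ m - Suc 0) \<le> 8 * 2 ^ m" "a + (2 ^ m - Suc 0) - b \<le> 8 * 2 ^ m" "2 ^ m - Suc 0 \<le> 8 * 2 ^ m"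
        using ab by auto
      moreover have "x mod (2 ^ m - Suc 0) < 2 ^ m" for x
        using pos by (metis One_nat_def mod_less_divisor diff_le_self less_le_trans)
      ultimately show "sym_eval (R(''u'' \<mapsto> a, ''v'' \<mapsto> b)) A' ?add = Some ((a + b) mod (2 ^ m - 1))"
        "sym_eval (R(''u'' \<mapsto> a, ''v'' \<mapsto> b)) A' ?sub = Some ((a + (2 ^ m - 1) - b) mod (2 ^ m - 1))"
        using ab pos by (simp_all add: R)
      show "(a + b) mod (2 ^ m - 1) \<in> {..2 ^ m - 1} \<and> (a + (2 ^ m - 1) - b) mod (2 ^ m - 1) \<in> {..2 ^ m - 1}"
        using pos by (simp add: less_imp_le_nat)
    next
      show "a < 2 ^ m" if "a \<in> {..2 ^ m - 1}" for a :: nat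
        using that by (simp add: le_diff_conv2 flip: Suc_le_eq)
      have "(4::nat) \<le> 2 ^ m"
        using q by simp
      then have "Suc 0 \<le> 2 ^ m - Suc 0"
        by linarith
      then show "H0 i \<in> {..2 ^ m - 1}" for i
        by (simp add: H0_def)
    qed (simp_all add: R)
    then show ?thesis
      by (simp add: H1_def cwht_def del: bfly.simps)
  qed
  have 4: "hoare (St R ?A3) (butterfly 5 (Op FMul (Reg ''u'') (Reg ''v'')) (Op FDiv (Reg ''u'') (Reg ''v'')))
      (2 ^ m * m * (3 + 3 + 80)) (St R ?A4)"
  proof -
    have "hoare (St R ?A3) (butterfly 5 (Op FMul (Reg ''u'') (Reg ''v'')) (Op FDiv (Reg ''u'') (Reg ''v'')))
      (2 ^ m * m * (cost (Op FMul (Reg ''u'') (Reg ''v'')) + cost (Op FDiv (Reg ''u'') (Reg ''v'')) + 80)) (St R ?A4)"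
      unfolding G1_def
      by (rule hoare_butterfly_upd [where V = "carrier F - {0}"])
        (use mult mult_eval unit in \<open>simp_all add: R carrier_eq\<close>)
    then show ?thesis
      by simp
  qed
  have 5: "hoare (St R ?A4) pointwise_power (2 ^ m * m * 80) (St R ?A5)"
    using hoare_pointwise_power [of R ?A4 H1 G1] G1 H1 by (simp add: R G2_def carrier_eq)
  have 6: "hoare (St R ?A5) (butterfly 5 (Op FMul (Reg ''u'') (Reg ''v'')) (Op FDiv (Reg ''u'') (Reg ''v'')))
      (2 ^ m * m * (3 + 3 + 80)) (St R ?A6)"
  proof -
    have "hoare (St R ?A5) (butterfly 5 (Op FMul (Reg ''u'') (Reg ''v'')) (Op FDiv (Reg ''u'') (Reg ''v'')))
      (2 ^ m * m * (cost (Op FMul (Reg ''u'') (Reg ''v'')) + cost (Op FDiv (Reg ''u'') (Reg ''v'')) + 80)) (St R ?A6)"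
      by (rule hoare_butterfly_upd [where V = "carrier F - {0}"])
        (use mult mult_eval G2 in \<open>simp_all add: R carrier_eq\<close>)
    then show ?thesis
      by simp
  qed
  have "hoare (St R A) compute_locator ((2 ^ m * (8 + 14) + 6) + ((2 ^ m * (7 + 14) + 6) +
      ((2 ^ m * m * (7 + 11 + 80)) + ((2 ^ m * m * (3 + 3 + 80)) + (2 ^ m * m * 80 + 2 ^ m * m * (3 + 3 + 80))))))
      (St R ?A6)"
    unfolding compute_locator_def by (rule 1 2 3 4 5 6 hoare_seq)+
  then show ?thesis
  proof (rule hoare_mono)
    show "A(5 \<mapsto> nodal (carrier F - S)) \<preceq> ?A6"
    proof -
      have "mwht m G2 x = nodal E x" if "x < 2 ^ m" for x
        using nodal_via_wht [OF m, of E x] that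
        by (simp add: G2_def G1_def H1_def H0_def E_def carrier_eq)
      then show ?thesis
        by (auto simp: region_le_def A_def E_def split: if_splits)
    qed
    define Y where "Y = 2 ^ m * m"
    have "1 \<le> Y" "2 ^ m \<le> Y"
      using m by (simp_all add: Y_def)
    then show "(2 ^ m * (8 + 14) + 6) + ((2 ^ m * (7 + 14) + 6) +
      ((2 ^ m * m * (7 + 11 + 80)) + ((2 ^ m * m * (3 + 3 + 80)) + (2 ^ m * m * 80 + 2 ^ m * m * (3 + 3 + 80)))))
      \<le> 2 ^ m * m * 500"
      unfolding Y_def [symmetric] by simp
  qed simp_all
qed

text \<open>Regions 4 and 7 are taken as unknown, so the whole step appears as an update of region 6
  alone and fits the invariant of the loop over \<open>c\<close>.\<close>

lemma hoare_deformed_step: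
  assumes c: "c \<in> carrier F" "c \<noteq> 0" and R: "R = base_regs(''c'' \<mapsto> c)"
    and A: "A 2 = Some Q" "A 6 = Some a" "A 4 = None" "A 7 = None"
    and Q: "\<And>i. i < 2 ^ m \<Longrightarrow> Q i < 2 ^ m" and a: "\<And>i. i < 2 ^ m \<Longrightarrow> a i < 2 ^ m"
  shows "hoare (St R A) deformed_step (2 ^ m * m * 450)
    (St R (A(6 \<mapsto> \<lambda>x. a x \<oplus> undeform c m (\<lambda>u. deform c m Q u \<otimes> deform c m recip u) x)))"
proof -
  let ?mix = "Op FAdd (Reg ''u'') (Op FMul (Op FAdd (Reg ''o'') (Reg ''c'')) (Reg ''v''))"
  let ?quot = "Op FDiv (Op FAdd (Reg ''u'') (Reg ''v'')) (Reg ''c'')"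
  let ?sum = "Op FAdd (Reg ''u'') (Reg ''v'')"
  let ?kernel = "Op IMul (Op ILess (Const 0) (Reg ''i'')) (Op FDiv (Reg ''o'') unit_word_expr)"
  define G where "G = (\<lambda>u. deform c m Q u \<otimes> deform c m recip u)"
  let ?A1 = "A(4 \<mapsto> Q)"
  let ?A2 = "?A1(7 \<mapsto> recip)"
  let ?A3 = "?A2(4 \<mapsto> deform c m Q)"
  let ?A4 = "?A3(7 \<mapsto> deform c m recip)"
  let ?A5 = "?A4(4 \<mapsto> G)"
  let ?A6 = "?A5(4 \<mapsto> undeform c m G)"
  let ?A7 = "?A6(6 \<mapsto> \<lambda>x. a x \<oplus> undeform c m G x)"
  have c': "c < 2 ^ m"
    using c by (simp add: carrier_eq)
  have recip: "recip i < 2 ^ m" if "i < 2 ^ m" for i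
    using that recip_closed [of i] by (simp add: carrier_eq)
  have T: "deform c m f i < 2 ^ m" if "i < 2 ^ m" "\<And>i. i < 2 ^ m \<Longrightarrow> f i < 2 ^ m" for f i
    using deform_closed [of c m f i] that c by (simp add: carrier_eq)
  have G: "G i < 2 ^ m" if "i < 2 ^ m" for i
    using that T Q recip by (simp add: G_def)
  have I: "undeform c m G i < 2 ^ m" if "i < 2 ^ m" for i
  proof -
    have "undeform c m G i \<in> {..<2 ^ m}"
      using that G c c' by (intro bfly_closed) auto
    then show ?thesis
      by simp
  qed
  have 1: "hoare (St R A) (pass 4 (At 2 (Reg ''i''))) (2 ^ m * (6 + 14) + 6) (St R ?A1)"
    using hoare_pass_new [of R 4 A "At 2 (Reg ''i'')" Q] Q A by (simp add: R)
  have 2: "hoare (St R ?A1) (pass 7 ?kernel) (2 ^ m * (13 + 14) + 6) (St R ?A2)"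
  proof -
    have "sym_eval (R(''i'' \<mapsto> i)) (?A1(7 \<mapsto> g)) ?kernel = Some (recip i)" if i: "i < 2 ^ m" for i g
    proof -
      have d: "sym_eval (R(''i'' \<mapsto> i)) (?A1(7 \<mapsto> g)) (Op FDiv (Reg ''o'') unit_word_expr) = Some (\<one> \<otimes> inv (unit_word i))"
        using i unit_word_bounds by (simp add: R sym_eval_unit_word carrier_eq zero_eq_0)
      have "inv (unit_word i) \<in> carrier F"
        using unit_word_bounds [of i] i by (intro inv_closed') (auto simp: carrier_eq zero_eq_0)
      then have "\<one> \<otimes> inv (unit_word i) = inv (unit_word i)" "inv (unit_word i) < 2 ^ m"
        by (simp_all add: carrier_eq)
      then show ?thesis
        using i d by (cases "i = 0") (simp_all add: R recip_def zero_eq_0 unit_word_def)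
    qed
    then show ?thesis
      using hoare_pass_new [of R 7 ?A1 ?kernel recip] by (simp add: R cost_unit_word)
  qed
  have mix: "sym_eval (R(''u'' \<mapsto> x, ''v'' \<mapsto> y)) A' ?mix = Some (x \<oplus> (\<one> \<oplus> c) \<otimes> y)"
    "sym_eval (R(''u'' \<mapsto> x, ''v'' \<mapsto> y)) A' ?sum = Some (x \<oplus> y)"
    "sym_eval (R(''u'' \<mapsto> x, ''v'' \<mapsto> y)) A' ?quot = Some ((x \<oplus> y) \<otimes> inv c)"
    "sym_eval (R(''u'' \<mapsto> x, ''v'' \<mapsto> y)) A' (Op FAdd (Reg ''u'') ?quot) = Some (x \<oplus> (x \<oplus> y) \<otimes> inv c)"
    if "x \<in> {..<2 ^ m}" "y \<in> {..<2 ^ m}" for x y A'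
    using that c c' by (auto simp: R carrier_eq zero_eq_0)
  have closed: "x \<oplus> y \<in> {..<2 ^ m} \<and> x \<oplus> (\<one> \<oplus> c) \<otimes> y \<in> {..<2 ^ m}"
    "x \<oplus> (x \<oplus> y) \<otimes> inv c \<in> {..<2 ^ m} \<and> (x \<oplus> y) \<otimes> inv c \<in> {..<2 ^ m}"
    if "x \<in> {..<2 ^ m}" "y \<in> {..<2 ^ m}" for x y
    using that c c' by auto
  have bf: "hoare (St R A') (butterfly d ?sum ?mix) (2 ^ m * m * (cost ?sum + cost ?mix + 80)) (St R (A'(d \<mapsto> deform c m g)))"
    if "d < 8" "A' d = Some g" "\<And>i. i < 2 ^ m \<Longrightarrow> g i < 2 ^ m" for A' d g
    by (rule hoare_butterfly_upd [where V = "{..<2 ^ m}"])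
      (use that mix closed in \<open>simp_all add: R del: sym_eval.simps sym_eval_field_ops\<close>)
  have 3: "hoare (St R ?A2) (butterfly 4 ?sum ?mix) (2 ^ m * m * (3 + 7 + 80)) (St R ?A3)"
    using bf [of 4 ?A2 Q] Q by simp
  have 4: "hoare (St R ?A3) (butterfly 7 ?sum ?mix) (2 ^ m * m * (3 + 7 + 80)) (St R ?A4)"
    using bf [of 7 ?A3 recip] recip by simp
  have 5: "hoare (St R ?A4) (pass 4 (Op FMul (At 4 (Reg ''i'')) (At 7 (Reg ''i'')))) (2 ^ m * (13 + 14) + 6) (St R ?A5)"
    using hoare_pass_upd [of R 4 ?A4 "deform c m Q" "Op FMul (At 4 (Reg ''i'')) (At 7 (Reg ''i''))" G] T Q recip
    by (simp add: R G_def carrier_eq)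
  have 6: "hoare (St R ?A5) (butterfly 4 (Op FAdd (Reg ''u'') ?quot) ?quot) (2 ^ m * m * (7 + 5 + 80)) (St R ?A6)"
  proof -
    have "hoare (St R ?A5) (butterfly 4 (Op FAdd (Reg ''u'') ?quot) ?quot)
      (2 ^ m * m * (cost (Op FAdd (Reg ''u'') ?quot) + cost ?quot + 80)) (St R ?A6)"
      by (rule hoare_butterfly_upd [where V = "{..<2 ^ m}"])
        (use mix closed G in \<open>simp_all add: R del: sym_eval.simps sym_eval_field_ops\<close>)
    then show ?thesis
      by simp
  qed
  have 7: "hoare (St R ?A6) (pass 6 (Op FAdd (At 6 (Reg ''i'')) (At 4 (Reg ''i'')))) (2 ^ m * (13 + 14) + 6) (St R ?A7)"
    using hoare_pass_upd [of R 6 ?A6 a "Op FAdd (At 6 (Reg ''i'')) (At 4 (Reg ''i''))" "\<lambda>x. a x \<oplus> undeform c m G x"] a I A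
    by (simp add: R carrier_eq)
  have "hoare (St R A) deformed_step ((2 ^ m * (6 + 14) + 6) + ((2 ^ m * (13 + 14) + 6) + (2 ^ m * m * (3 + 7 + 80) +
     (2 ^ m * m * (3 + 7 + 80) + ((2 ^ m * (13 + 14) + 6) + (2 ^ m * m * (7 + 5 + 80) + (2 ^ m * (13 + 14) + 6))))))) (St R ?A7)"
    unfolding deformed_step_def Let_def by (rule 1 2 3 4 5 6 7 hoare_seq)+
  then show ?thesis
  proof (rule hoare_mono)
    show "A(6 \<mapsto> \<lambda>x. a x \<oplus> undeform c m (\<lambda>u. deform c m Q u \<otimes> deform c m recip u) x) \<preceq> ?A7"
      using A by (auto simp: region_le_def G_def split: if_splits)
    define Y where "Y = 2 ^ m * m"
    have "1 \<le> Y" "2 ^ m \<le> Y"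
      using m_pos by (simp_all add: Y_def)
    then show "(2 ^ m * (6 + 14) + 6) + ((2 ^ m * (13 + 14) + 6) + (2 ^ m * m * (3 + 7 + 80) +
     (2 ^ m * m * (3 + 7 + 80) + ((2 ^ m * (13 + 14) + 6) + (2 ^ m * m * (7 + 5 + 80) + (2 ^ m * (13 + 14) + 6))))))
      \<le> 2 ^ m * m * 450"
      unfolding Y_def [symmetric] by simp
  qed simp_all
qed

end

section \<open>Correctness and running time\<close>

context ram
begin

lemma hoare_decode_large:
  assumes m: "2 \<le> m" and P: "poly_fun d P" and xs: "distinct xs" "set xs \<subseteq> carrier F" "d + 1 \<le> length xs"
    and M: "M = xs @ map P xs @ replicate k 0" "length M = 8 * 2 ^ m"
  defines "A \<equiv> \<lambda>d. Some (\<lambda>i. M ! (d * 2 ^ m + i))"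
  shows "hoare (St [''m'' \<mapsto> m, ''n'' \<mapsto> length xs] A) decode_large (2 ^ m * m\<^sup>2 * 3000) (St Map.empty [0 \<mapsto> P])"
proof -
  define E where "E = carrier F - set xs"
  define V where "V = (\<lambda>x. if x \<in> set xs then P x else 0)"
  define K where "K = (\<lambda>x. of_bool (x \<in> set xs) :: nat)"
  define Q where "Q = weighted E P"
  define D where "D c x = undeform c m (\<lambda>u. deform c m Q u \<otimes> deform c m recip u) x" for c x
  \<comment> \<open>The range \<open>{1..<j}\<close> is empty for \<open>j = 0\<close> and for
    \<open>j = 1\<close>, in accordance with the skipped round \<open>c = 0\<close>.\<close>
  define acc where "acc j x = (\<Oplus>c\<in>{1..<j}. D c x)" for j x
  let ?Rn = "[''m'' \<mapsto> m, ''n'' \<mapsto> length xs, ''q'' \<mapsto> 2 ^ m, ''o'' \<mapsto> \<one>, ''B'' \<mapsto> node_count m m]"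
  let ?A1 = "[2 \<mapsto> V, 3 \<mapsto> K, 6 \<mapsto> \<lambda>_. 0]"
  let ?A2 = "?A1(5 \<mapsto> nodal E)"
  let ?A3 = "[2 \<mapsto> Q, 3 \<mapsto> K, 5 \<mapsto> nodal E]"
  let ?B = "node_count m m"
  have E: "E \<subseteq> carrier F"
    by (auto simp: E_def)
  have card: "card (carrier F) = 2 ^ m"
    by (simp add: carrier_eq)
  have len: "length xs \<le> 2 ^ m"
    using distinct_card [OF xs(1)] card_mono [OF finite_carrier xs(2)] card by simp
  have cardE: "card E = 2 ^ m - length xs"
    using card_Diff_subset [of "set xs" "carrier F"] xs distinct_card [OF xs(1)] card by (simp add: E_def)
  have Pc: "P x \<in> carrier F" "P x < 2 ^ m" if "x < 2 ^ m" for x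
    using poly_fun_closed [OF P, of x] that by (simp_all add: carrier_eq)
  have nod: "nodal E x \<in> carrier F" "nodal E x < 2 ^ m" "nodal E x \<noteq> \<zero>" if "x < 2 ^ m" for x
    using nodal_closed [OF E, of x] nodal_nonzero [OF E, of x] that by (simp_all add: carrier_eq)
  have Qc: "Q x \<in> carrier F" "Q x < 2 ^ m" if "x < 2 ^ m" for x
    using weighted_closed [OF E, of x P] Pc [OF that] that by (simp_all add: Q_def carrier_eq)
  \<comment> \<open>This fails for \<open>m = 1\<close>. It ensures that \<open>m\<close> doublings
    reach \<open>m + 2\<close> without leaving the field.\<close>
  have m2: "m + 2 \<le> 2 ^ m"
  proof -
    have "n + 2 \<le> 2 ^ n" if "2 \<le> n" for n :: nat
      using that by (induction n rule: dec_induct) simp_all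
    then show ?thesis
      using m .
  qed
  obtain s where s: "s \<le> m" "?B = 2 ^ s" "?B \<le> 2 * m + 2" and s': "m + 2 \<le> ?B \<or> s = m"
    using node_count [of m m] by blast
  have s4: "m + 2 \<le> 2 ^ s"
    using s' m2 s(2) by auto
  have B: "?B \<le> 2 ^ m"
    using s by simp
  have rc: "recip y \<in> carrier F" if "y < 2 ^ m" for y
    using that by (intro recip_closed) (simp add: carrier_eq)
  have Dc: "D c x \<in> carrier F" if "c \<in> carrier F" "c \<noteq> 0" "x < 2 ^ m" for c x
  proof -
    have G: "deform c m Q y \<otimes> deform c m recip y \<in> carrier F" if "y < 2 ^ m" for y
      using deform_closed [of c m Q y] deform_closed [of c m recip y] Qc rc that \<open>c \<in> carrier F\<close> by blast
    have c: "inv c \<in> carrier F"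
      using that by (intro inv_closed') (simp_all add: zero_eq_0)
    show ?thesis
      unfolding D_def
      by (rule bfly_closed [where V = "carrier F"]) (use G c that in simp_all)
  qed
  have accc: "acc j x \<in> carrier F" "acc j x < 2 ^ m" if "j \<le> ?B" "x < 2 ^ m" for j x
  proof -
    show "acc j x \<in> carrier F"
      unfolding acc_def using that B Dc by (intro finsum_closed) (auto simp: carrier_eq)
    then show "acc j x < 2 ^ m"
      by (simp add: carrier_eq)
  qed
  have acc_Suc: "acc (Suc c) x = acc c x \<oplus> D c x" if "c \<noteq> 0" "c < ?B" "x < 2 ^ m" for c x
  proof -
    have "{1..<Suc c} = insert c {1..<c}"
      using that by auto
    moreover have "finsum F (\<lambda>c. D c x) (insert c {1..<c}) = D c x \<oplus> (\<Oplus>c\<in>{1..<c}. D c x)"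
      using that B Dc by (intro finsum_insert) (auto simp: carrier_eq)
    moreover have "D c x \<in> carrier F"
      using that B by (intro Dc) (auto simp: carrier_eq)
    ultimately show ?thesis
      using accc [of c x] that unfolding acc_def by (simp add: a_comm)
  qed
  have total: "acc ?B x = P x \<otimes> nodal E x" if "x \<in> E" for x
  proof -
    have "acc ?B x = (\<Oplus>y\<in>carrier F. Q y \<otimes> recip (x \<oplus> y))"
      unfolding acc_def D_def s(2) using Qc rc that E s(1) s4
      by (intro deformed_convolution_sum) auto
    also have "\<dots> = P x \<otimes> nodal E x"
      unfolding Q_def using P E that cardE card xs len by (intro erasure_identity) auto
    finally show ?thesis .
  qed
  have 1: "hoare (St [''m'' \<mapsto> m, ''n'' \<mapsto> length xs] A) setup_registers (m * 50 + 50) (St ?Rn A)"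
    by (rule hoare_setup)
  have 2: "hoare (St ?Rn A) scatter_input (2 ^ m * 60 + 6) (St base_regs ?A1)"
  proof -
    have "hoare (St ?Rn A) scatter_input (2 ^ m * 60 + 6) (St ?Rn ?A1)"
      unfolding A_def V_def K_def using xs(2) len Pc M by (intro hoare_scatter) auto
    then show ?thesis
      by (rule hoare_mono) (auto simp: map_le_def)
  qed
  have 3: "hoare (St base_regs ?A1) compute_locator (2 ^ m * m * 500) (St base_regs ?A2)"
    unfolding E_def K_def using m xs(2) by (intro hoare_locator) auto
  have 4: "hoare (St base_regs ?A2) (pass 2 (Op FMul (At 2 (Reg ''i'')) (At 5 (Reg ''i'')))) (2 ^ m * (13 + 14) + 6)
      (St base_regs (?A3(6 \<mapsto> acc 0)))"
  proof -
    have "V i < 2 ^ m" "V i \<otimes> nodal E i = Q i" if i: "i < 2 ^ m" for i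
    proof -
      show "V i < 2 ^ m"
        using Pc i by (simp add: V_def)
      show "V i \<otimes> nodal E i = Q i"
      proof (cases "i \<in> set xs")
        case True
        then show ?thesis
          by (simp add: V_def Q_def weighted_def E_def)
      next
        case False
        then have "i \<in> E" "V i = \<zero>"
          using i by (simp_all add: E_def V_def carrier_eq zero_eq_0)
        then show ?thesis
          using nod [OF i] by (simp add: Q_def weighted_def)
      qed
    qed
    then have "hoare (St base_regs ?A2) (pass 2 (Op FMul (At 2 (Reg ''i'')) (At 5 (Reg ''i'')))) (2 ^ m * (13 + 14) + 6)
      (St base_regs (?A2(2 \<mapsto> Q)))"
      using hoare_pass_upd [of base_regs 2 ?A2 V "Op FMul (At 2 (Reg ''i'')) (At 5 (Reg ''i''))" Q] nod Qc
      by (simp add: carrier_eq)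
    then show ?thesis
      by (rule hoare_mono) (auto simp: region_le_def acc_def zero_eq_0 split: if_splits)
  qed
  have 5: "hoare (St base_regs (?A3(6 \<mapsto> acc 0))) (For ''c'' ''B'' (Cond (Reg ''c'') deformed_step Skip))
      (?B * (Suc (1 + 2 ^ m * m * 450) + 8) + 6) (St base_regs (?A3(6 \<mapsto> acc ?B)))"
  proof (rule hoare_for [where R = "\<lambda>_. base_regs" and A = "\<lambda>j. ?A3(6 \<mapsto> acc j)"])
    fix c assume c: "c < ?B"
    let ?Rc = "base_regs(''c'' \<mapsto> c)"
    have "hoare (St ?Rc (?A3(6 \<mapsto> acc c))) (Cond (Reg ''c'') deformed_step Skip)
        (Suc (cost (Reg ''c'') + 2 ^ m * m * 450)) (St ?Rc (?A3(6 \<mapsto> acc (Suc c))))"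
    proof (rule hoare_cond)
      show "sym_eval ?Rc (?A3(6 \<mapsto> acc c)) (Reg ''c'') = Some c"
        using c B by simp
    next
      assume c0: "c \<noteq> 0"
      have "hoare (St ?Rc (?A3(6 \<mapsto> acc c))) deformed_step (2 ^ m * m * 450)
         (St ?Rc ((?A3(6 \<mapsto> acc c))(6 \<mapsto> \<lambda>x. acc c x \<oplus> D c x)))"
        unfolding D_def using c c0 B Qc accc [of c] by (intro hoare_deformed_step) (auto simp: carrier_eq)
      then show "hoare (St ?Rc (?A3(6 \<mapsto> acc c))) deformed_step (2 ^ m * m * 450) (St ?Rc (?A3(6 \<mapsto> acc (Suc c))))"
      proof (rule hoare_mono)
        show "?A3(6 \<mapsto> acc (Suc c)) \<preceq> (?A3(6 \<mapsto> acc c))(6 \<mapsto> \<lambda>x. acc c x \<oplus> D c x)"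
          using acc_Suc [OF c0 c] by (auto intro!: region_le_upd)
      qed simp_all
    next
      assume c0: "c = 0"
      have "1 \<le> 2 ^ m * m"
        using m by simp
      then have "1 \<le> 2 ^ m * m * 450"
        by linarith
      moreover have "acc (Suc c) = acc c"
        by (simp add: c0 acc_def fun_eq_iff)
      ultimately show "hoare (St ?Rc (?A3(6 \<mapsto> acc c))) Skip (2 ^ m * m * 450) (St ?Rc (?A3(6 \<mapsto> acc (Suc c))))"
        by (intro hoare_sym_exec [where t' = 1]) auto
    qed
    then show "hoare (St ?Rc (?A3(6 \<mapsto> acc c))) (Cond (Reg ''c'') deformed_step Skip)
        (Suc (1 + 2 ^ m * m * 450)) (St ?Rc (?A3(6 \<mapsto> acc (Suc c))))"
      by simp
  next
    show "?B < W"
      using B one_less_W(3) by linarith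
  qed simp_all
  let ?e = "Op FDiv (Op IAdd (Op IMul (At 3 (Reg ''i'')) (At 2 (Reg ''i'')))
             (Op IMul (Op ISub (Const 1) (At 3 (Reg ''i''))) (At 6 (Reg ''i'')))) (At 5 (Reg ''i''))"
  have 6: "hoare (St base_regs (?A3(6 \<mapsto> acc ?B))) (pass 0 ?e) (2 ^ m * (36 + 14) + 6)
      (St base_regs (?A3(6 \<mapsto> acc ?B, 0 \<mapsto> P)))"
  proof -
    have "sym_eval (base_regs(''i'' \<mapsto> i)) (?A3(6 \<mapsto> acc ?B, 0 \<mapsto> g)) ?e = Some (P i)" if i: "i < 2 ^ m" for i g
    proof -
      \<comment> \<open>One of the integer factors is 1 and the other 0. At known points
        \<open>Q\<close> is the product by definition, at erased ones \<open>total\<close>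
        applies.\<close>
      have num: "K i * Q i + (1 - K i) * acc ?B i = P i \<otimes> nodal E i"
      proof (cases "i \<in> set xs")
        case True
        then show ?thesis
          by (simp add: K_def Q_def weighted_def E_def)
      next
        case False
        then show ?thesis
          using total [of i] i by (simp add: K_def E_def carrier_eq)
      qed
      have PN: "P i \<otimes> nodal E i < 2 ^ m"
        using Pc nod i by simp
      have "K i = 0 \<or> K i = 1"
        by (simp add: K_def)
      then have "sym_eval (base_regs(''i'' \<mapsto> i)) (?A3(6 \<mapsto> acc ?B, 0 \<mapsto> g))
          (Op IAdd (Op IMul (At 3 (Reg ''i'')) (At 2 (Reg ''i'')))
             (Op IMul (Op ISub (Const 1) (At 3 (Reg ''i''))) (At 6 (Reg ''i'')))) = Some (P i \<otimes> nodal E i)"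
        using i Qc accc [of ?B i] num PN by auto
      moreover have "(P i \<otimes> nodal E i) \<otimes> inv (nodal E i) = P i"
        using mult_mult_inv [of "P i" \<one> "nodal E i"] Pc nod i by simp
      ultimately show ?thesis
        using i nod Pc PN by (simp add: carrier_eq zero_eq_0)
    qed
    then show ?thesis
      using hoare_pass_new [of base_regs 0 "?A3(6 \<mapsto> acc ?B)" ?e P] by simp
  qed
  have "hoare (St [''m'' \<mapsto> m, ''n'' \<mapsto> length xs] A) decode_large ((m * 50 + 50) + ((2 ^ m * 60 + 6) + (2 ^ m * m * 500 +
     ((2 ^ m * (13 + 14) + 6) + ((?B * (Suc (1 + 2 ^ m * m * 450) + 8) + 6) + (2 ^ m * (36 + 14) + 6))))))
     (St base_regs (?A3(6 \<mapsto> acc ?B, 0 \<mapsto> P)))"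
    unfolding decode_large_def by (rule 1 2 3 4 5 6 hoare_seq)+
  then show ?thesis
  proof (rule hoare_mono)
    show "[0 \<mapsto> P] \<preceq> ?A3(6 \<mapsto> acc ?B, 0 \<mapsto> P)"
      by (simp add: region_le_def)
    define Y where "Y = 2 ^ m * m"
    have Y: "1 \<le> Y" "2 ^ m \<le> Y" "m \<le> Y"
      using m by (simp_all add: Y_def)
    define YY where "YY = m * Y"
    have mY: "2 ^ m * m\<^sup>2 = YY"
      by (simp add: YY_def Y_def power2_eq_square)
    have YY: "Y \<le> YY"
      using m by (simp add: YY_def)
    \<comment> \<open>\<open>2 * m + 2 \<le> 3 * m\<close> by \<open>2 \<le> m\<close>, and one
      round costs at most \<open>450 * Y + 10\<close>; the product gives \<open>1380 * YY\<close>,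
      which leaves ample room below 3000.\<close>
    have "?B * (Suc (1 + Y * 450) + 8) \<le> (3 * m) * (460 * Y)"
      using s(3) m Y by (intro mult_le_mono) simp_all
    then have BX: "?B * (Suc (1 + Y * 450) + 8) \<le> 1380 * YY"
      by (simp add: YY_def)
    show "(m * 50 + 50) + ((2 ^ m * 60 + 6) + (2 ^ m * m * 500 +
       ((2 ^ m * (13 + 14) + 6) + ((?B * (Suc (1 + 2 ^ m * m * 450) + 8) + 6) + (2 ^ m * (36 + 14) + 6))))) \<le> 2 ^ m * m\<^sup>2 * 3000"
      unfolding mY unfolding Y_def [symmetric] using YY BX Y by simp
  qed simp_all
qed

text \<open>Covers the case of \<open>decode_two\<close> in which a single value is known.\<close>

lemma poly_fun_0_const:
  "poly_fun d f \<Longrightarrow> d = 0 \<Longrightarrow> x \<in> carrier F \<Longrightarrow> y \<in> carrier F \<Longrightarrow> f x = f y"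
  by (induction rule: poly_fun.induct) auto

lemma hoare_decode_two:
  assumes m: "m = 1" and P: "poly_fun d P" and xs: "distinct xs" "set xs \<subseteq> carrier F" "d + 1 \<le> length xs"
    and M: "M = xs @ map P xs @ replicate k 0" "length M = 8 * 2 ^ m"
  defines "A \<equiv> \<lambda>d. Some (\<lambda>i. M ! (d * 2 ^ m + i))"
  shows "hoare (St [''m'' \<mapsto> m, ''n'' \<mapsto> length xs] A) decode_two 50 (St Map.empty [0 \<mapsto> P])"
proof -
  have card: "card (carrier F) = 2"
    using m by (simp add: carrier_eq)
  have "length xs \<le> 2"
    using distinct_card [OF xs(1)] card_mono [OF finite_carrier xs(2)] card by simp
  then have n: "length xs = 1 \<or> length xs = 2"
    using xs(3) by linarith
  define x where "x = xs ! 0"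
  define z where "z = P (xs ! (length xs - 1))"
  have x: "x < 2"
  proof -
    have "xs ! 0 \<in> set xs"
      using n by (intro nth_mem) auto
    then show ?thesis
      using xs(2) m by (auto simp: x_def carrier_eq)
  qed
  have in2: "i \<in> carrier F" if "i < 2" for i
    using that m by (simp add: carrier_eq)
  have Pc: "P i < 2" if "i < 2" for i
    using poly_fun_closed [OF P in2 [OF that]] m by (simp add: carrier_eq)
  have z: "z = P (1 - x)"
    using n
  proof
    assume "length xs = 1"
    then have "d = 0"
      using xs(3) by simp
    then show ?thesis
      using poly_fun_0_const [OF P] in2 x \<open>length xs = 1\<close> by (simp add: z_def x_def)
  next
    assume l: "length xs = 2"
    then have "xs ! 0 \<noteq> xs ! 1" "xs ! 1 < 2"
    proof -
      show "xs ! 0 \<noteq> xs ! 1"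
        using xs(1) l by (simp add: nth_eq_iff_index_eq)
      have "xs ! 1 \<in> set xs"
        using l by (intro nth_mem) simp
      then show "xs ! 1 < 2"
        using xs(2) m by (auto simp: carrier_eq)
    qed
    then have "xs ! 1 = 1 - x"
      using x by (auto simp: x_def)
    then show ?thesis
      using l by (simp add: z_def)
  qed
  have zb: "z < 2"
    unfolding z by (rule Pc) simp
  have Mx: "M ! 0 = x" "M ! length xs = P x" "M ! (length xs + length xs - 1) = z"
    using n by (auto simp: M(1) nth_append x_def z_def)
  have load: "sym_eval R A (Load e) = fit W (M ! a)" if "sym_eval R A e = Some a" "a < 8 * 2 ^ m" for R e a
    using that by (simp add: A_def div_mult_mod_eq)
  have A0: "A 0 = Some ((!) M)"
    by (simp add: A_def)
  have small: "v < 2 \<Longrightarrow> v < 2 ^ m" for v :: nat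
    using m by simp
  have bounds: "length xs < 8 * 2 ^ m" "length xs + length xs \<le> 8 * 2 ^ m"
      "length xs + length xs - Suc 0 < 8 * 2 ^ m"
    using n m by auto
  let ?R0 = "[''m'' \<mapsto> m, ''n'' \<mapsto> length xs]"
  let ?R1 = "?R0(''u'' \<mapsto> x)"
  let ?R2 = "?R1(''v'' \<mapsto> P x)"
  let ?R3 = "?R2(''w'' \<mapsto> z)"
  let ?g = "((!) M)(x := P x)"
  have 1: "sym_exec (Assign ''u'' (Load (Const 0))) (?R0, A) = Some (3, ?R1, A)"
    using load [of ?R0 "Const 0" 0] Mx small [OF x] by simp
  have 2: "sym_exec (Assign ''v'' (Load (Reg ''n''))) (?R1, A) = Some (3, ?R2, A)"
    using load [of ?R1 "Reg ''n''" "length xs"] Mx small [OF Pc [OF x]] bounds by simp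
  have 3: "sym_exec (Assign ''w'' (Load (Op ISub (Op IAdd (Reg ''n'') (Reg ''n'')) (Const 1)))) (?R2, A) = Some (7, ?R3, A)"
    using load [of ?R2 "Op ISub (Op IAdd (Reg ''n'') (Reg ''n'')) (Const 1)" "length xs + length xs - 1"]
      Mx small [OF zb] bounds by simp
  have 4: "sym_exec (Store (Reg ''u'') (Reg ''v'')) (?R3, A) = Some (3, ?R3, A(0 \<mapsto> ?g))"
    using small [OF x] small [OF Pc [OF x]] A0 by simp
  have 5: "sym_exec (Store (Op ISub (Const 1) (Reg ''u'')) (Reg ''w'')) (?R3, A(0 \<mapsto> ?g)) =
     Some (5, ?R3, A(0 \<mapsto> ?g(1 - x := z)))"
    using small [OF x] small [OF zb] small [of "1 - x"] by simp
  show ?thesis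
  proof (rule hoare_sym_exec)
    show "sym_exec decode_two (?R0, A) = Some (3 + (3 + (7 + (3 + 5))), ?R3, A(0 \<mapsto> ?g(1 - x := z)))"
      unfolding decode_two_def by (simp only: sym_exec.simps(4) 1 2 3 4 5 Option.bind_lunit prod.case)
    have "P i = (?g(1 - x := z)) i" if "i < 2 ^ m" for i
    proof -
      have "i = x \<or> i = 1 - x"
        using that m x by auto
      then show ?thesis
        using z by auto
    qed
    then show "[0 \<mapsto> P] \<preceq> A(0 \<mapsto> ?g(1 - x := z))"
      by (simp add: region_le_def)
  qed simp_all
qed

lemma hoare_decoder:
  assumes P: "poly_fun d P" and xs: "distinct xs" "set xs \<subseteq> carrier F" "d + 1 \<le> length xs"
    and M: "M = xs @ map P xs @ replicate k 0" "length M = 8 * 2 ^ m"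
  shows "hoare (St [''m'' \<mapsto> m, ''n'' \<mapsto> length xs] (\<lambda>d. Some (\<lambda>i. M ! (d * 2 ^ m + i)))) decoder
     (2 ^ m * m\<^sup>2 * 3010) (St Map.empty [0 \<mapsto> P])"
proof -
  let ?Z = "2 ^ m * m\<^sup>2"
  have "1 \<le> ?Z"
    using m_pos by simp
  then have Z: "50 \<le> ?Z * 3000" "Suc (3 + ?Z * 3000) \<le> ?Z * 3010"
    by linarith+
  have "hoare (St [''m'' \<mapsto> m, ''n'' \<mapsto> length xs] (\<lambda>d. Some (\<lambda>i. M ! (d * 2 ^ m + i)))) decoder
     (Suc (cost (Op IEq (Reg ''m'') (Const 1)) + ?Z * 3000)) (St Map.empty [0 \<mapsto> P])"
    unfolding decoder_def
  proof (rule hoare_cond)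
    show "sym_eval [''m'' \<mapsto> m, ''n'' \<mapsto> length xs] (\<lambda>d. Some (\<lambda>i. M ! (d * 2 ^ m + i))) (Op IEq (Reg ''m'') (Const 1)) = Some (of_bool (m = 1))"
      by simp
    show "hoare (St [''m'' \<mapsto> m, ''n'' \<mapsto> length xs] (\<lambda>d. Some (\<lambda>i. M ! (d * 2 ^ m + i)))) decode_two (?Z * 3000) (St Map.empty [0 \<mapsto> P])"
      if "of_bool (m = 1) \<noteq> (0::nat)"
      using hoare_decode_two [OF _ P xs M] that Z(1) by (intro hoare_time [OF _ Z(1)]) simp
    show "hoare (St [''m'' \<mapsto> m, ''n'' \<mapsto> length xs] (\<lambda>d. Some (\<lambda>i. M ! (d * 2 ^ m + i)))) decode_large (?Z * 3000) (St Map.empty [0 \<mapsto> P])"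
      if "of_bool (m = 1) = (0::nat)"
      using hoare_decode_large [OF _ P xs M] that m_pos by simp
  qed
  then show ?thesis
    by (rule hoare_time) (use Z(2) in simp)
qed

end

section \<open>From symbolic states to the decoding problem\<close>

lemma decoder_correct:
  assumes m: "1 \<le> m" and k: "1 \<le> k" and F: "binary_field m F" and p: "p \<in> polys_below F k"
    and xs: "distinct xs" "set xs \<subseteq> carrier F" "k \<le> length xs"
  shows "\<exists>t r mem. 2 * length xs \<le> 8 * 2 ^ m \<and>
     run F (2 ^ (8 * m)) decoder (initial_state (8 * 2 ^ m) m k xs (map (ring.eval F p) xs)) t (r, mem) \<and>
     take (2 ^ m) mem = value_vector m F p \<and> t \<le> 2 ^ m * m\<^sup>2 * 3010"
proof -
  interpret word_field m F
    using F by (simp add: word_field_def word_field_axioms_def binary_field_def)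
  interpret ram m F "2 ^ (8 * m)"
  proof
    \<comment> \<open>Eight regions of \<open>2 ^ m\<close> cells amount to
      \<open>2 ^ (3 + m)\<close> addresses, and \<open>3 + m < 8 * m\<close> for
      \<open>m \<ge> 1\<close>.\<close>
    have "(2::nat) ^ (3 + m) < 2 ^ (8 * m)"
      using m by (intro power_strict_increasing) simp_all
    then show "8 * 2 ^ m < (2::nat) ^ (8 * m)"
      by (simp add: power_add)
  qed (rule m)
  define P where "P = eval p"
  have pp: "set p \<subseteq> carrier F" "degree p < k"
    using p polynomial_in_carrier [OF carrier_is_subring] by (auto simp: polys_below_def univ_poly_carrier [symmetric])
  have P: "poly_fun (degree p) P"
    unfolding P_def using poly_fun_eval [OF pp(1)] by simp
  have len: "length xs \<le> 2 ^ m"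
    using distinct_card [OF xs(1)] card_mono [OF finite_carrier xs(2)] by (simp add: carrier_eq)
  define M where "M = xs @ map P xs @ replicate (8 * 2 ^ m - (length xs + length xs)) 0"
  have lenM: "length M = 8 * 2 ^ m"
    using len by (simp add: M_def)
  define s0 where "s0 = initial_state (8 * 2 ^ m) m k xs (map P xs)"
  have "St [''m'' \<mapsto> m, ''n'' \<mapsto> length xs] (\<lambda>d. Some (\<lambda>i. M ! (d * 2 ^ m + i))) s0"
    using lenM by (auto simp: s0_def initial_state_def M_def)
  moreover have "hoare (St [''m'' \<mapsto> m, ''n'' \<mapsto> length xs] (\<lambda>d. Some (\<lambda>i. M ! (d * 2 ^ m + i)))) decoder
     (2 ^ m * m\<^sup>2 * 3010) (St Map.empty [0 \<mapsto> P])"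
  proof (rule hoare_decoder [OF P xs(1,2) _ M_def lenM])
    show "degree p + 1 \<le> length xs"
      using pp xs(3) by simp
  qed
  ultimately obtain t s where t: "run F (2 ^ (8 * m)) decoder s0 t s" "t \<le> 2 ^ m * m\<^sup>2 * 3010" "St Map.empty [0 \<mapsto> P] s"
    unfolding hoare_def by blast
  obtain r mem where s: "s = (r, mem)"
    by (cases s)
  have mem: "length mem = 8 * 2 ^ m" "mem ! i = P i" if "i < 2 ^ m" for i
    using St_D(2) [OF t(3) [unfolded s]] St_D(3) [OF t(3) [unfolded s], of 0 P i] that by simp_all
  have "take (2 ^ m) mem = value_vector m F p"
  proof (rule nth_equalityI)
    have "length mem = 8 * 2 ^ m"
      using mem(1) [of 0] by simp
    then show "length (take (2 ^ m) mem) = length (value_vector m F p)"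
      by (simp add: value_vector_def)
  next
    fix i assume "i < length (take (2 ^ m) mem)"
    then have "i < 2 ^ m"
      by simp
    then show "take (2 ^ m) mem ! i = value_vector m F p ! i"
      using mem(2) by (simp add: value_vector_def P_def)
  qed
  then show ?thesis
    using t len unfolding s s0_def P_def by (intro exI [of _ t] exI [of _ r] exI [of _ mem]) simp
qed

theorem mainTheorem1:
  shows "(\<exists>c w. \<exists>C::real. decodes_erasures c w
            (\<lambda>q. C * (q * (log 2 q)\<^sup>2)) (\<lambda>q. C * (q * log 2 q))) \<and>
         (\<exists>c w. \<exists>C::real. decodes_erasures c w
            (\<lambda>q. C * (q * (log 2 q) ^ 3)) (\<lambda>q. C * q))"
proof -
  \<comment> \<open>Bounds are compared only at powers of two with \<open>m \<ge> 1\<close>. There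
    \<open>log 2 q = m \<ge> 1\<close>, so the time \<open>3010 * q * m\<^sup>2\<close> and the
    memory \<open>8 * q\<close> satisfy both pairs of bounds with \<open>C = 3010\<close>.\<close>
  have dec: "decodes_erasures decoder 8 T M"
    if T: "\<And>m::nat. 1 \<le> m \<Longrightarrow> 3010 * (2 ^ m * (real m)\<^sup>2) \<le> T (2 ^ m)" and M: "\<And>m::nat. 1 \<le> m \<Longrightarrow> 8 * 2 ^ m \<le> M (2 ^ m)"
    for T M :: "real \<Rightarrow> real"
    unfolding decodes_erasures_def
  proof (intro allI impI, elim conjE)
    fix m k F p xs
    assume *: "1 \<le> m" "1 \<le> k" "k \<le> 2 ^ m" "binary_field m F" "p \<in> polys_below F k"
      "distinct xs" "set xs \<subseteq> carrier F" "k \<le> length xs"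
    obtain t r mem where t: "2 * length xs \<le> 8 * 2 ^ m"
      "run F (2 ^ (8 * m)) decoder (initial_state (8 * 2 ^ m) m k xs (map (ring.eval F p) xs)) t (r, mem)"
      "take (2 ^ m) mem = value_vector m F p" "t \<le> 2 ^ m * m\<^sup>2 * 3010"
      using decoder_correct [OF *(1,2,4-)] by blast
    have "real t \<le> real (2 ^ m * m\<^sup>2 * 3010)"
      using t(4) by (rule of_nat_mono)
    then have "real t \<le> T (2 ^ m)"
      using T [OF *(1)] by (simp add: mult.commute mult.left_commute)
    moreover have "real (8 * 2 ^ m) \<le> M (2 ^ m)"
      using M [OF *(1)] by simp
    ultimately show "\<exists>N t r mem. 2 * length xs \<le> N \<and>
        run F (2 ^ (8 * m)) decoder (initial_state N m k xs (map (ring.eval F p) xs)) t (r, mem) \<and>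
        take (2 ^ m) mem = value_vector m F p \<and> real t \<le> T (2 ^ m) \<and> real N \<le> M (2 ^ m)"
      using t by blast
  qed
  have log: "log 2 (2 ^ m) = real m" for m
    by (simp add: log_nat_power)
  have "decodes_erasures decoder 8 (\<lambda>q. 3010 * (q * (log 2 q)\<^sup>2)) (\<lambda>q. 3010 * (q * log 2 q))"
  proof (rule dec)
    fix m :: nat assume "1 \<le> m"
    then have "2 ^ m * 1 \<le> 2 ^ m * real m"
      by (intro mult_left_mono) simp_all
    then show "8 * 2 ^ m \<le> 3010 * (2 ^ m * log 2 (2 ^ m))"
      unfolding log using zero_le_power [of "2::real" m] by linarith
  qed (simp add: log)
  moreover have "decodes_erasures decoder 8 (\<lambda>q. 3010 * (q * (log 2 q) ^ 3)) (\<lambda>q. 3010 * q)"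
  proof (rule dec)
    fix m :: nat assume "1 \<le> m"
    then have "(real m)\<^sup>2 \<le> real m ^ 3"
      by (intro power_increasing) simp_all
    then show "3010 * (2 ^ m * (real m)\<^sup>2) \<le> 3010 * (2 ^ m * (log 2 (2 ^ m)) ^ 3)"
      unfolding log by (intro mult_left_mono) simp_all
  qed simp
  ultimately show ?thesis
    by blast
qed

end
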